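(* Let $\mathcal{M}_{\rm I}$ be the weighted blow-up of $\mathbb{C}P^3(3,2,4,5)$ with weights $6,4,5$ at the point $p$ (the total space for the first Painlevé equation (P$_{\rm I}$): $dx/dz=6y^2+z$, $dy/dz=x$), as defined in the context. Then $\mathcal{M}_{\rm I}$ is decomposed into the disjoint union of (1) the fiber space $\mathcal{P}=\{(\xi,z):\xi\in E(z),\ z\in\mathbb{C}\}$ for (P$_{\rm I}$) divided by the $\mathbb{Z}_5$-action; (2) an elliptic fibration obtained from the Weierstrass normal form $X^2=4Y^3+2Y-g_3$, whose base space is the moduli space $\mathbb{C}P^1(6,4)\setminus\{q\}$ and whose fibers are isomorphism classes of elliptic curves, including the singular curve but excluding the curve with $g_2=0$; (3) a projective line $\mathbb{C}P^1$.
   Context: $\mathbb{C}P^3(3,2,4,5)$ is the quotient of $\mathbb{C}^4\setminus\{0\}$ by $(x,y,z,\varepsilon)\sim(\lambda^3x,\lambda^2y,\lambda^4z,\lambda^5\varepsilon)$, $\lambda\in\mathbb{C}^*$, with inhomogeneous coordinates $(x,y,z)$, $(Y_1,Z_1,\varepsilon_1)$, $(X_2,Z_2,\varepsilon_2)$, $(X_3,Y_3,\varepsilon_3)$ related by $$x=\varepsilon_1^{-3/5}=X_2\varepsilon_2^{-3/5}=X_3\varepsilon_3^{-3/5},\quad y=Y_1\varepsilon_1^{-2/5}=\varepsilon_2^{-2/5}=Y_3\varepsilon_3^{-2/5},\quad z=Z_1\varepsilon_1^{-4/5}=Z_2\varepsilon_2^{-4/5}=\varepsilon_3^{-4/5},$$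 which are divided by the $\mathbb{Z}_5$-, $\mathbb{Z}_3$-, $\mathbb{Z}_2$- and $\mathbb{Z}_4$-actions generated by $(x,y,z)\mapsto(\zeta^3x,\zeta^2y,\zeta^4z)$ with $\zeta=e^{2\pi i/5}$; $(Y_1,Z_1,\varepsilon_1)\mapsto(\omega Y_1,\omega^2Z_1,\omega\varepsilon_1)$ with $\omega=e^{2\pi i/3}$; $(X_2,Z_2,\varepsilon_2)\mapsto(-X_2,Z_2,-\varepsilon_2)$; $(X_3,Y_3,\varepsilon_3)\mapsto(iX_3,-Y_3,-i\varepsilon_3)$. The point $p$ is $(X_2,Z_2,\varepsilon_2)=(2,0,0)\sim(-2,0,0)$. Near it use coordinates $(u,v,w)$ with $X_2-2=u+\frac12v-\frac12w$, $Z_2=v$, $\varepsilon_2=w$. The weighted blow-up at $p$ with weights $6,4,5$ replaces $p$ by the exceptional divisor $\mathbb{C}P^2(6,4,5)$ via the charts $$(u,v,w)=(u_1^6,\,u_1^4v_1,\,u_1^5w_1)=(v_2^6u_2,\,v_2^4,\,v_2^5w_2)=(w_3^6u_3,\,w_3^4v_3,\,w_3^5)$$ (divided by the corresponding cyclic groups), the exceptional divisor being $\{u_1=0\}\cup\{v_2=0\}\cup\{w_3=0\}$. The point $q$ is $(u_1,v_1,w_1)=(0,0,0)$, and $\mathbb{C}P^1(6,4)\subset\mathbb{C}P^2(6,4,5)$ is the locus with vanishing third homogeneous coordinate; thus $\mathbb{C}P^1(6,4)\setminus\{q\}$ is $\{v_2=w_2=0\}$ divided by $u_2\mapsto-u_2$.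 $E(z)$ is the space of initial conditions for (P$_{\rm I}$): $E(z)=\mathbb{C}^2_{(x,y)}\cup M(z)$, with $M(z)=\{V^2=UW^4+2zW^3+4W\}\subset\mathbb{C}^3$, glued by $x=VW^{-2}-\frac12W$, $y=W^{-1}$. The $\mathbb{Z}_5$-action on $\mathcal{P}$ is the one extending $(x,y,z)\mapsto(\zeta^3x,\zeta^2y,\zeta^4z)$. For (2): as a set, this piece is $\mathbb{C}^2/\mathbb{Z}_4\,\cup\,(\mathbb{C}P^1(6,4)\setminus\{q\})$, where $\mathbb{C}^2=\{\varepsilon_3=0\}$ in the $(X_3,Y_3,\varepsilon_3)$-chart. This plane, with coordinates $(X,Y)=(X_3,Y_3)$, is foliated by the curves $X^2=4Y^3+2Y-g_3$, $g_3\in\mathbb{C}$ (the Weierstrass normal form $X^2=4Y^3-g_2Y-g_3$ with $g_2=-2$; singular for two values of $g_3$). The $\mathbb{Z}_4$-action $(X,Y)\mapsto(iX,-Y)$ maps the curve with parameter $g_3$ to the one with parameter $-g_3$. Complex tori with parameters $(g_2,g_3)$ and $(g_2',g_3')$ are isomorphic if $(g_2,g_3)=(\lambda^4g_2',\lambda^6g_3')$ for some $\lambda\neq0$ (so $\mathbb{C}P^1(6,4)$ minus one point is a moduli space of complex tori); with $g_2=g_2'=-2$ this holds if and only if $g_3'=\pm g_3$, so the curves identified by the $\mathbb{Z}_4$-action are isomorphic. The isomorphism class of $X^2=4Y^3+2Y\mp g_3$ meets the base $\mathbb{C}P^1(6,4)\setminus\{q\}$ at the point $(u_2,v_2,w_2)=(g_3/4,0,0)\sim(-g_3/4,0,0)$.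 *)

theory Defs
  imports "HOL-Analysis.Analysis"
begin

section \<open>Spaces with holomorphic functions\<close>

text \<open>
  Weighted projective spaces, weighted blow-ups and quotients by finite groups are singular, so
  they are treated as reduced ringed spaces: a topology together with, for every open set
  \<open>U\<close>, the set of functions that are holomorphic on \<open>U\<close>. Functions are total;
  only their values on \<open>U\<close> matter.
\<close>

datatype 'a fspace = FSpace (ftop: "'a topology") (fhol: "'a set \<Rightarrow> ('a \<Rightarrow> complex) set")

abbreviation fpts :: "'a fspace \<Rightarrow> 'a set" where
  "fpts X \<equiv> topspace (ftop X)"

text \<open>Complex differentiability in several variables: the Frechet derivative is complex linear.\<close>

definition cspace :: "(complex ^ 'n) fspace" where
  "cspace = FSpace euclidean
     (\<lambda>U. {f. \<forall>x\<in>U. \<exists>D. (f has_derivative D) (at x) \<and> (\<forall>c v. D (c *s v) = c * D v)})"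

text \<open>Subspaces: holomorphic functions are those that locally extend to the ambient space.\<close>

definition fsub :: "'a fspace \<Rightarrow> 'a set \<Rightarrow> 'a fspace" where
  "fsub X S = FSpace (subtopology (ftop X) S)
     (\<lambda>U. {f. \<forall>x\<in>U. \<exists>N. openin (ftop X) N \<and> x \<in> N \<and> (\<exists>g\<in>fhol X N. \<forall>y\<in>N \<inter> U. f y = g y)})"

definition fsum :: "'a fspace \<Rightarrow> 'b fspace \<Rightarrow> ('a + 'b) fspace" (infixr "\<oplus>\<^sub>f" 65) where
  "X \<oplus>\<^sub>f Y = FSpace
     (topology (\<lambda>U. openin (ftop X) (Inl -` U) \<and> openin (ftop Y) (Inr -` U)))
     (\<lambda>U. {f. f \<circ> Inl \<in> fhol X (Inl -` U) \<and> f \<circ> Inr \<in> fhol Y (Inr -` U)})"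

text \<open>
  The structure coinduced by a map \<open>\<pi>\<close>: the carrier is the image of \<open>\<pi>\<close>, with
  the quotient topology, and a function is holomorphic iff its pullback along \<open>\<pi>\<close> is.
\<close>

definition fquot :: "('a \<Rightarrow> 'b) \<Rightarrow> 'a fspace \<Rightarrow> 'b fspace" where
  "fquot \<pi> X = FSpace
     (topology (\<lambda>U. U \<subseteq> \<pi> ` fpts X \<and> openin (ftop X) {x \<in> fpts X. \<pi> x \<in> U}))
     (\<lambda>U. {f. f \<circ> \<pi> \<in> fhol X {x \<in> fpts X. \<pi> x \<in> U}})"

definition hol_map :: "'a fspace \<Rightarrow> 'b fspace \<Rightarrow> ('a \<Rightarrow> 'b) \<Rightarrow> bool" where
  "hol_map X Y f \<longleftrightarrow> continuous_map (ftop X) (ftop Y) f \<and>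
     (\<forall>V. openin (ftop Y) V \<longrightarrow> (\<forall>g\<in>fhol Y V. g \<circ> f \<in> fhol X {x \<in> fpts X. f x \<in> V}))"

definition biholomorphic_map :: "'a fspace \<Rightarrow> 'b fspace \<Rightarrow> ('a \<Rightarrow> 'b) \<Rightarrow> bool" where
  "biholomorphic_map X Y f \<longleftrightarrow> bij_betw f (fpts X) (fpts Y) \<and> hol_map X Y f \<and>
     hol_map Y X (inv_into (fpts X) f)"

text \<open>Quotient by the cyclic group generated by a bijection \<open>s\<close> of finite order.\<close>

definition cyc_orbit :: "('a \<Rightarrow> 'a) \<Rightarrow> 'a \<Rightarrow> 'a set" where
  "cyc_orbit s x = {(s ^^ n) x | n. True}"

definition cyc_quot :: "('a \<Rightarrow> 'a) \<Rightarrow> 'a fspace \<Rightarrow> 'a set fspace" where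
  "cyc_quot s X = fquot (cyc_orbit s) X"

lemma openin_fsum:
  "openin (ftop (X \<oplus>\<^sub>f Y)) U \<longleftrightarrow> openin (ftop X) (Inl -` U) \<and> openin (ftop Y) (Inr -` U)"
proof -
  have "istopology (\<lambda>U. openin (ftop X) (Inl -` U) \<and> openin (ftop Y) (Inr -` U))"
    unfolding istopology_def by (auto simp: vimage_Union)
  then show ?thesis
    by (simp add: fsum_def topology_inverse')
qed

lemma openin_fquot:
  "openin (ftop (fquot \<pi> X)) U \<longleftrightarrow> U \<subseteq> \<pi> ` fpts X \<and> openin (ftop X) {x \<in> fpts X. \<pi> x \<in> U}"
proof -
  have "istopology (\<lambda>U. U \<subseteq> \<pi> ` fpts X \<and> openin (ftop X) {x \<in> fpts X. \<pi> x \<in> U})"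
    unfolding istopology_def
  proof (intro conjI allI impI, goal_cases)
    case (1 S T) then show ?case by blast
  next
    case (2 S T)
    have "{x \<in> fpts X. \<pi> x \<in> S \<inter> T} = {x \<in> fpts X. \<pi> x \<in> S} \<inter> {x \<in> fpts X. \<pi> x \<in> T}" by blast
    with 2 show ?case by auto
  next
    case (3 K) then show ?case by blast
  next
    case (4 K)
    have "{x \<in> fpts X. \<pi> x \<in> \<Union>K} = (\<Union>S\<in>K. {x \<in> fpts X. \<pi> x \<in> S})" by blast
    with 4 show ?case by auto
  qed
  then show ?thesis
    by (simp add: fquot_def topology_inverse')
qed

lemma fpts_cspace [simp]: "fpts (cspace :: (complex ^ 'n) fspace) = UNIV"
  by (simp add: cspace_def)

lemma fpts_fsub [simp]: "fpts (fsub X S) = fpts X \<inter> S"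
  by (simp add: fsub_def)

lemma fpts_fsum: "fpts (X \<oplus>\<^sub>f Y) = Inl ` fpts X \<union> Inr ` fpts Y"
proof
  have "openin (ftop (X \<oplus>\<^sub>f Y)) (fpts (X \<oplus>\<^sub>f Y))" by simp
  then have *: "Inl -` fpts (X \<oplus>\<^sub>f Y) \<subseteq> fpts X" "Inr -` fpts (X \<oplus>\<^sub>f Y) \<subseteq> fpts Y"
    by (auto simp only: openin_fsum dest: openin_subset)
  show "fpts (X \<oplus>\<^sub>f Y) \<subseteq> Inl ` fpts X \<union> Inr ` fpts Y"
  proof
    fix a assume "a \<in> fpts (X \<oplus>\<^sub>f Y)"
    with * show "a \<in> Inl ` fpts X \<union> Inr ` fpts Y" by (cases a) auto
  qed
  have "Inl -` (Inl ` fpts X \<union> Inr ` fpts Y) = fpts X"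
    "Inr -` (Inl ` fpts X \<union> Inr ` fpts Y) = fpts Y" by auto
  then have "openin (ftop (X \<oplus>\<^sub>f Y)) (Inl ` fpts X \<union> Inr ` fpts Y)"
    by (simp add: openin_fsum)
  then show "Inl ` fpts X \<union> Inr ` fpts Y \<subseteq> fpts (X \<oplus>\<^sub>f Y)"
    by (rule openin_subset)
qed

lemma fpts_fquot [simp]: "fpts (fquot \<pi> X) = \<pi> ` fpts X"
proof
  have "openin (ftop (fquot \<pi> X)) (fpts (fquot \<pi> X))" by simp
  then show "fpts (fquot \<pi> X) \<subseteq> \<pi> ` fpts X" by (simp only: openin_fquot)
  have "{x \<in> fpts X. \<pi> x \<in> \<pi> ` fpts X} = fpts X" by auto
  then have "openin (ftop (fquot \<pi> X)) (\<pi> ` fpts X)" by (simp add: openin_fquot)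
  then show "\<pi> ` fpts X \<subseteq> fpts (fquot \<pi> X)" by (rule openin_subset)
qed


section \<open>Weighted projective spaces\<close>

text \<open>
  Points are the orbits of \<open>c \<cdot> (x\<^sub>1, \<dots>, x\<^sub>n) = (c^w\<^sub>1 x\<^sub>1, \<dots>, c^w\<^sub>n x\<^sub>n)\<close> with \<open>c \<noteq> 0\<close>.
  Note that in the index type \<open>4\<close> the literals \<open>4\<close> and \<open>0\<close> coincide, so
  \<open>t $ 4\<close> is the last component.
\<close>

definition worbit :: "nat ^ 'n \<Rightarrow> complex ^ 'n \<Rightarrow> (complex ^ 'n) set" where
  "worbit w x = {(\<chi> i. c ^ (w $ i) * x $ i) | c. c \<noteq> 0}"

definition wproj :: "nat ^ 'n \<Rightarrow> (complex ^ 'n) set fspace" where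
  "wproj w = fquot (worbit w) (fsub cspace (- {0}))"

lemma vector_4 [simp]:
  "(vector [x,y,z,t] :: 'a::zero ^ 4) $ 1 = x"
  "(vector [x,y,z,t] :: 'a::zero ^ 4) $ 2 = y"
  "(vector [x,y,z,t] :: 'a::zero ^ 4) $ 3 = z"
  "(vector [x,y,z,t] :: 'a::zero ^ 4) $ 4 = t"
  unfolding vector_def by simp_all

abbreviation w3245 :: "nat ^ 4" where "w3245 \<equiv> vector [3, 2, 4, 5]"
abbreviation w645 :: "nat ^ 3" where "w645 \<equiv> vector [6, 4, 5]"
abbreviation CP1 :: "(complex ^ 2) set fspace" where "CP1 \<equiv> wproj (vector [1, 1])"
abbreviation CP2 :: "(complex ^ 3) set fspace" where "CP2 \<equiv> wproj (vector [1, 1, 1])"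

text \<open>The point with homogeneous coordinates \<open>[x : y : z : \<epsilon>]\<close> in \<open>CP\<^sup>3(3,2,4,5)\<close>.
  The inhomogeneous charts are the slices on which one coordinate is \<open>1\<close>, e.g.
  \<open>(X\<^sub>2, Z\<^sub>2, \<epsilon>\<^sub>2)\<close> is \<open>[X\<^sub>2 : 1 : Z\<^sub>2 : \<epsilon>\<^sub>2]\<close>.\<close>

definition pt3245 :: "complex \<Rightarrow> complex \<Rightarrow> complex \<Rightarrow> complex \<Rightarrow> (complex ^ 4) set" where
  "pt3245 x y z \<epsilon> = worbit w3245 (vector [x, y, z, \<epsilon>])"

definition pt645 :: "complex \<Rightarrow> complex \<Rightarrow> complex \<Rightarrow> (complex ^ 3) set" where
  "pt645 a b c = worbit w645 (vector [a, b, c])"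


section \<open>The weighted blow-up\<close>

definition p_pt :: "(complex ^ 4) set" where
  "p_pt = pt3245 2 1 0 0"

text \<open>The point with coordinates \<open>(u, v, w)\<close> about \<open>p\<close>; these are coordinates near the origin only:
  \<open>(-4, 0, 0)\<close> represents \<open>p\<close> as well.\<close>

definition uvw_pt :: "complex \<Rightarrow> complex \<Rightarrow> complex \<Rightarrow> (complex ^ 4) set" where
  "uvw_pt u v w = pt3245 (2 + u + v / 2 - w / 2) 1 v w"

text \<open>Points of the blow-up: \<open>Inl\<close> of a point other than \<open>p\<close>, or \<open>Inr\<close> of a point of the
  exceptional divisor \<open>CP\<^sup>2(6,4,5)\<close>.\<close>

type_synonym mpoint = "(complex ^ 4) set + (complex ^ 3) set"

definition chart1 :: "complex ^ 3 \<Rightarrow> mpoint" where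
  "chart1 t = (let u1 = t $ 1; v1 = t $ 2; w1 = t $ 3 in
     if u1 = 0 then Inr (pt645 1 v1 w1) else Inl (uvw_pt (u1 ^ 6) (u1 ^ 4 * v1) (u1 ^ 5 * w1)))"

definition chart2 :: "complex ^ 3 \<Rightarrow> mpoint" where
  "chart2 t = (let u2 = t $ 1; v2 = t $ 2; w2 = t $ 3 in
     if v2 = 0 then Inr (pt645 u2 1 w2) else Inl (uvw_pt (v2 ^ 6 * u2) (v2 ^ 4) (v2 ^ 5 * w2)))"

definition chart3 :: "complex ^ 3 \<Rightarrow> mpoint" where
  "chart3 t = (let u3 = t $ 1; v3 = t $ 2; w3 = t $ 3 in
     if w3 = 0 then Inr (pt645 u3 v3 1) else Inl (uvw_pt (w3 ^ 6 * u3) (w3 ^ 4 * v3) (w3 ^ 5)))"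

text \<open>The condition \<open>chart t \<noteq> Inl p\<close> removes the parameters with \<open>(u, v, w) = (-4, 0, 0)\<close>.\<close>

abbreviation chart_dom :: "(complex ^ 3 \<Rightarrow> mpoint) \<Rightarrow> (complex ^ 3) fspace" where
  "chart_dom ch \<equiv> fsub cspace {t. ch t \<noteq> Inl p_pt}"

definition M_I :: "mpoint fspace" where
  "M_I = fquot (case_sum Inl (case_sum chart1 (case_sum chart2 chart3)))
     (fsub (wproj w3245) (- {p_pt}) \<oplus>\<^sub>f chart_dom chart1 \<oplus>\<^sub>f chart_dom chart2 \<oplus>\<^sub>f chart_dom chart3)"

definition q_pt :: mpoint where
  "q_pt = chart1 (vector [0, 0, 0])"

definition CP1_64 :: "mpoint set" where
  "CP1_64 = {Inr (pt645 a b 0) | a b. (a, b) \<noteq> (0, 0)}"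


section \<open>The fiber space of the first Painleve equation\<close>

definition M_fib :: "complex \<Rightarrow> (complex ^ 3) set" where
  "M_fib z = {t. let U = t $ 1; V = t $ 2; W = t $ 3 in V ^ 2 = U * W ^ 4 + 2 * z * W ^ 3 + 4 * W}"

definition E_glue :: "complex \<Rightarrow> complex ^ 2 + complex ^ 3 \<Rightarrow> complex ^ 2 + complex ^ 3 \<Rightarrow> bool" where
  "E_glue z a b \<longleftrightarrow> (\<exists>U V W. W \<noteq> 0 \<and> vector [U, V, W] \<in> M_fib z \<and>
     a = Inl (vector [V / W ^ 2 - W / 2, 1 / W]) \<and> b = Inr (vector [U, V, W]))"

definition E_class :: "complex \<Rightarrow> complex ^ 2 + complex ^ 3 \<Rightarrow> (complex ^ 2 + complex ^ 3) set" where
  "E_class z a = {b. equivclp (E_glue z) a b}"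

definition E_fib :: "complex \<Rightarrow> (complex ^ 2 + complex ^ 3) set set" where
  "E_fib z = E_class z ` (range Inl \<union> Inr ` M_fib z)"

type_synonym ppoint = "(complex ^ 2 + complex ^ 3) set \<times> complex"

definition P_xyz :: "complex ^ 3 \<Rightarrow> ppoint" where
  "P_xyz t = (E_class (t $ 3) (Inl (vector [t $ 1, t $ 2])), t $ 3)"

definition P_UVWz :: "complex ^ 4 \<Rightarrow> ppoint" where
  "P_UVWz t = (E_class (t $ 4) (Inr (vector [t $ 1, t $ 2, t $ 3])), t $ 4)"

definition P_space :: "ppoint fspace" where
  "P_space = fquot (case_sum P_xyz P_UVWz)
     (cspace \<oplus>\<^sub>f fsub cspace {t. vector [t $ 1, t $ 2, t $ 3] \<in> M_fib (t $ 4)})"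

lemma fpts_P_space: "fpts P_space = {(\<xi>, z). \<xi> \<in> E_fib z}"
proof
  show "fpts P_space \<subseteq> {(\<xi>, z). \<xi> \<in> E_fib z}"
    by (auto simp: P_space_def fpts_fsum P_xyz_def P_UVWz_def E_fib_def)
  show "{(\<xi>, z). \<xi> \<in> E_fib z} \<subseteq> fpts P_space"
  proof clarify
    fix \<xi> z assume "\<xi> \<in> E_fib z"
    then consider t where "\<xi> = E_class z (Inl t)" | t where "t \<in> M_fib z" "\<xi> = E_class z (Inr t)"
      by (auto simp: E_fib_def)
    then show "(\<xi>, z) \<in> fpts P_space"
    proof cases
      case 1
      have "t = vector [t $ 1, t $ 2]" by (simp add: vec_eq_iff forall_2)
      with 1 have "(\<xi>, z) = P_xyz (vector [t $ 1, t $ 2, z])" by (simp add: P_xyz_def)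
      then show ?thesis by (force simp: P_space_def fpts_fsum image_Un image_image)
    next
      case 2
      have "t = vector [t $ 1, t $ 2, t $ 3]" by (simp add: vec_eq_iff forall_3)
      with 2 have "(\<xi>, z) = P_UVWz (vector [t $ 1, t $ 2, t $ 3, z])"
        "vector [t $ 1, t $ 2, t $ 3] \<in> M_fib z" by (simp_all add: P_UVWz_def)
      then show ?thesis
        by (auto simp: P_space_def fpts_fsum image_Un image_image
            intro!: image_eqI[where x = "vector [t $ 1, t $ 2, t $ 3, z]"])
    qed
  qed
qed

text \<open>
  The gluing forces the extension of \<open>(x, y, z) \<mapsto> (\<zeta>\<^sup>3 x, \<zeta>\<^sup>2 y, \<zeta>\<^sup>4 z)\<close> to be
  \<open>(U, V, W, z) \<mapsto> (\<zeta> U, \<zeta>^(-1) V, \<zeta>^(-2) W, \<zeta>\<^sup>4 z)\<close> on the second chart.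
\<close>

definition z5_act :: "ppoint \<Rightarrow> ppoint" where
  "z5_act = (\<lambda>(\<xi>, z). let \<zeta> = cis (2 * pi / 5) in
     (map_sum (\<lambda>t. vector [\<zeta> ^ 3 * t $ 1, \<zeta> ^ 2 * t $ 2])
              (\<lambda>t. vector [\<zeta> * t $ 1, \<zeta> ^ 4 * t $ 2, \<zeta> ^ 3 * t $ 3]) ` \<xi>, \<zeta> ^ 4 * z))"


section \<open>Elliptic curves in Weierstrass form\<close>

text \<open>Homogeneous coordinates are \<open>[X : Y : T]\<close>; the point at infinity is \<open>[1 : 0 : 0]\<close>.\<close>

definition wcubic :: "complex \<Rightarrow> complex \<Rightarrow> (complex ^ 3) set" where
  "wcubic g2 g3 = {t. let X = t $ 1; Y = t $ 2; T = t $ 3 in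
     X ^ 2 * T = 4 * Y ^ 3 - g2 * Y * T ^ 2 - g3 * T ^ 3}"

definition wcurve :: "complex \<Rightarrow> complex \<Rightarrow> (complex ^ 3) set set" where
  "wcurve g2 g3 = worbit (vector [1, 1, 1]) ` (wcubic g2 g3 - {0})"

text \<open>The partial derivatives of \<open>X\<^sup>2T - 4Y\<^sup>3 + g\<^sub>2YT\<^sup>2 + g\<^sub>3T\<^sup>3\<close> have a common zero on the curve.\<close>

definition wsingular :: "complex \<Rightarrow> complex \<Rightarrow> bool" where
  "wsingular g2 g3 \<longleftrightarrow> (\<exists>t \<in> wcubic g2 g3 - {0}. let X = t $ 1; Y = t $ 2; T = t $ 3 in
     2 * X * T = 0 \<and> - 12 * Y ^ 2 + g2 * T ^ 2 = 0 \<and>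
     X ^ 2 + 2 * g2 * Y * T + 3 * g3 * T ^ 2 = 0)"

definition wiso :: "complex \<times> complex \<Rightarrow> complex \<times> complex \<Rightarrow> bool" where
  "wiso = (\<lambda>(g2, g3) (g2', g3'). \<exists>c. c \<noteq> 0 \<and> g2 = c ^ 4 * g2' \<and> g3 = c ^ 6 * g3')"

text \<open>The family of the curves \<open>X\<^sup>2 = 4Y\<^sup>3 + 2Y - g\<^sub>3\<close>, each completed by its point at infinity.\<close>

type_synonym wpoint = "(complex ^ 3) set \<times> complex"

definition W_hom :: "complex ^ 4 \<Rightarrow> wpoint" where
  "W_hom t = (worbit (vector [1, 1, 1]) (vector [t $ 1, t $ 2, t $ 3]), t $ 4)"

definition W_space :: "wpoint fspace" where
  "W_space = fquot W_hom
     (fsub cspace {t. vector [t $ 1, t $ 2, t $ 3] \<in> wcubic (-2) (t $ 4) - {0}})"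

lemma fpts_W_space: "fpts W_space = {(\<xi>, g3). \<xi> \<in> wcurve (-2) g3}"
proof
  show "fpts W_space \<subseteq> {(\<xi>, g3). \<xi> \<in> wcurve (-2) g3}"
    by (auto simp: W_space_def W_hom_def wcurve_def)
  show "{(\<xi>, g3). \<xi> \<in> wcurve (-2) g3} \<subseteq> fpts W_space"
  proof clarify
    fix \<xi> g3 assume "\<xi> \<in> wcurve (-2) g3"
    then obtain t where t: "t \<in> wcubic (-2) g3 - {0}" "\<xi> = worbit (vector [1, 1, 1]) t"
      by (auto simp: wcurve_def)
    have eq: "vector [t $ 1, t $ 2, t $ 3] = t" by (simp add: vec_eq_iff forall_3)
    then have "(\<xi>, g3) = W_hom (vector [t $ 1, t $ 2, t $ 3, g3])"
      using t by (simp add: W_hom_def)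
    then show "(\<xi>, g3) \<in> fpts W_space"
      using t eq unfolding W_space_def
      by (auto intro!: image_eqI[where x = "vector [t $ 1, t $ 2, t $ 3, g3]"])
  qed
qed

text \<open>\<open>(X, Y) \<mapsto> (iX, -Y)\<close>, which maps the curve with parameter \<open>g\<^sub>3\<close> to that with \<open>-g\<^sub>3\<close>.\<close>

definition z4_act :: "wpoint \<Rightarrow> wpoint" where
  "z4_act = (\<lambda>(\<xi>, g3). ((\<lambda>t. vector [\<i> * t $ 1, - t $ 2, t $ 3]) ` \<xi>, - g3))"

text \<open>The part \<open>\<complex>\<^sup>2/\<int>\<^sub>4 \<union> (CP\<^sup>1(6,4) - {q})\<close> of the divisor \<open>\<epsilon> = 0\<close>.\<close>

definition ell_base :: "mpoint set" where
  "ell_base = CP1_64 - {q_pt}"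

definition ell_total :: "mpoint set" where
  "ell_total = {Inl (pt3245 X Y 1 0) | X Y. True} \<union> ell_base"

text \<open>
  The point of \<open>CP\<^sup>1(6,4)\<close> representing the curve with parameters \<open>(g\<^sub>2, g\<^sub>3)\<close>, normalised so that
  \<open>(-2, g\<^sub>3)\<close> is \<open>(u\<^sub>2, v\<^sub>2, w\<^sub>2) = (g\<^sub>3/4, 0, 0)\<close>.
\<close>

definition moduli_pt :: "complex \<times> complex \<Rightarrow> mpoint" where
  "moduli_pt = (\<lambda>(g2, g3). Inr (pt645 (g3 / 4) (- g2 / 2) 0))"

end

theory Submission
  imports Defs "HOL-Complex_Analysis.Cauchy_Integral_Formula"
begin

text \<open>
  In the third chart \<open>\<epsilon>\<^sub>2 = w\<^sup>5\<close>, so \<open>x = 2 w^(-3) + \<dots>\<close> and \<open>y = w^(-2)\<close>; hence \<open>W = w\<^sup>2\<close>, \<open>V\<close> and \<open>U\<close> are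
  polynomials in \<open>(u, v, w)\<close>, which identifies the part of the blow-up with \<open>\<epsilon> \<noteq> 0\<close>, or with
  nonzero third coordinate on the exceptional divisor, with \<open>\<P> / \<int>\<^sub>5\<close>.  Conversely
  \<open>w = V / h\<close> with \<open>h\<^sup>2 = 4 + 2 z W\<^sup>2 + U W\<^sup>3\<close>, where \<open>u\<close> is holomorphic at \<open>W = 0\<close>.
  The divisor \<open>\<epsilon> = 0\<close> is treated in the same way with \<open>z = 1\<close>, \<open>U = - g\<^sub>3\<close> and \<open>w = v\<^sub>2\<close>: in the
  second chart \<open>4 Y\<^sup>3 + 2 Y - X\<^sup>2\<close> extends to the exceptional divisor by \<open>- 4 u\<^sub>2\<close>, which
  compactifies each curve \<open>X\<^sup>2 = 4 Y\<^sup>3 + 2 Y - g\<^sub>3\<close> by one point of \<open>CP\<^sup>1(6,4)\<close>.  What remains is the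
  strict transform of the line \<open>z = \<epsilon> = 0\<close>, on which \<open>[x\<^sup>2 : y\<^sup>3]\<close> is a coordinate.
\<close>

section \<open>Germwise holomorphy\<close>

text \<open>The shift in \<open>uvw_pt\<close> is tailored to the gluing: with
  \<open>W = w^2\<close> and \<open>V = w h\<close>, the relation \<open>x = V / W^2 - W / 2\<close>
  becomes \<open>w^3 x = h - w^5 / 2\<close>, and \<open>h = 2 + w^6 u + w^4 v / 2\<close> starts
  with the constant and the \<open>z\<close>-term of the square root of
  \<open>4 + 2 z W^2 + U W^3\<close>, so that \<open>u\<close> is what carries \<open>U\<close>. The
  obstacle is that the spaces are singular, so inverses cannot be obtained from derivatives.
  Holomorphy is tested germ by germ: a map out of a quotient is checked on the charts above it, and
  a map into a quotient is lifted locally, taking a root of a nonzero coordinate to normalise it to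
  \<open>1\<close>. Where a square root would branch, the inverse is polynomial in the chart; on the
  projective line the removable singularity theorem takes over. The piece with
  \<open>\<epsilon> \<noteq> 0\<close> is open, the other two are not. Functions on those have to be
  extended locally to the blow-up, by a retraction for (2) and by a formula valid near the line for
  (3).\<close>

abbreviation fopen :: "'a fspace \<Rightarrow> 'a set \<Rightarrow> bool" where
  "fopen X \<equiv> openin (ftop X)"

text \<open>The zero function is required only so that \<open>hol_at\<close> below implies continuity.\<close>

definition sheafy :: "'a fspace \<Rightarrow> bool" where
  "sheafy X \<longleftrightarrow> (\<forall>U. fopen X U \<longrightarrow> (\<lambda>_. 0) \<in> fhol X U) \<and>
     (\<forall>U f. fopen X U \<and> (\<forall>x\<in>U. \<exists>N. fopen X N \<and> x \<in> N \<and> (\<exists>g\<in>fhol X N. \<forall>y\<in>N \<inter> U. f y = g y)) \<longrightarrow>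
        f \<in> fhol X U)"

lemma sheafyI:
  assumes "\<And>U. fopen X U \<Longrightarrow> (\<lambda>_. 0) \<in> fhol X U"
    and "\<And>U f. fopen X U \<Longrightarrow>
      (\<And>x. x \<in> U \<Longrightarrow> \<exists>N. fopen X N \<and> x \<in> N \<and> (\<exists>g\<in>fhol X N. \<forall>y\<in>N \<inter> U. f y = g y)) \<Longrightarrow> f \<in> fhol X U"
  shows "sheafy X"
  unfolding sheafy_def
proof (intro conjI allI impI; (elim conjE)?)
  show "(\<lambda>_. 0) \<in> fhol X U" if "fopen X U" for U by (rule assms(1)[OF that])
  fix U f assume U: "fopen X U"
    and loc: "\<forall>x\<in>U. \<exists>N. fopen X N \<and> x \<in> N \<and> (\<exists>g\<in>fhol X N. \<forall>y\<in>N \<inter> U. f y = g y)"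
  show "f \<in> fhol X U" by (rule assms(2)[OF U bspec[OF loc]])
qed

lemma sheafy_zero:
  assumes "sheafy X" "fopen X U" shows "(\<lambda>_. 0) \<in> fhol X U"
  using conjunct1[OF iffD1[OF sheafy_def assms(1)]] assms(2) by blast

lemma sheafy_glue:
  assumes "sheafy X" "fopen X U"
    and "\<And>x. x \<in> U \<Longrightarrow> \<exists>N. fopen X N \<and> x \<in> N \<and> (\<exists>g\<in>fhol X N. \<forall>y\<in>N \<inter> U. f y = g y)"
  shows "f \<in> fhol X U"
  by (rule mp[OF spec[OF spec[OF conjunct2[OF iffD1[OF sheafy_def assms(1)]]]]]) (intro conjI ballI assms(2,3))

lemma sheafy_restrict:
  assumes "sheafy X" "f \<in> fhol X U" "fopen X U" "fopen X V" "V \<subseteq> U"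
  shows "f \<in> fhol X V"
  by (rule sheafy_glue[OF assms(1,4)], rule exI[of _ U], intro conjI bexI[of _ f]) (use assms in auto)

lemma sheafy_cong:
  assumes "sheafy X" "f \<in> fhol X U" "fopen X U" "\<And>x. x \<in> U \<Longrightarrow> f x = g x"
  shows "g \<in> fhol X U"
  by (rule sheafy_glue[OF assms(1,3)], rule exI[of _ U], intro conjI bexI[of _ f]) (use assms in auto)

lemma sheafy_local:
  assumes "sheafy X" "fopen X U"
    and "\<And>x. x \<in> U \<Longrightarrow> \<exists>N. fopen X N \<and> x \<in> N \<and> N \<subseteq> U \<and> f \<in> fhol X N"
  shows "f \<in> fhol X U"
proof (rule sheafy_glue[OF assms(1,2)])
  fix x assume "x \<in> U"
  from assms(3)[OF this] obtain N where "fopen X N" "x \<in> N" "f \<in> fhol X N" by (elim exE conjE)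
  then show "\<exists>N. fopen X N \<and> x \<in> N \<and> (\<exists>g\<in>fhol X N. \<forall>y\<in>N \<inter> U. f y = g y)"
    by (intro exI[of _ N] conjI bexI[of _ f]) auto
qed

text \<open>Every germ at \<open>f x\<close> is pulled back to a germ at \<open>x\<close>. The
  neighbourhood \<open>N\<close> must be mapped into \<open>V\<close>, so that testing on the zero
  function yields continuity.\<close>

definition hol_at :: "'a fspace \<Rightarrow> 'b fspace \<Rightarrow> 'a \<Rightarrow> ('a \<Rightarrow> 'b) \<Rightarrow> bool" where
  "hol_at X Y x f \<longleftrightarrow> x \<in> fpts X \<and> f x \<in> fpts Y \<and>
     (\<forall>V g. fopen Y V \<and> f x \<in> V \<and> g \<in> fhol Y V \<longrightarrow>
        (\<exists>N. fopen X N \<and> x \<in> N \<and> f ` N \<subseteq> V \<and> g \<circ> f \<in> fhol X N))"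

lemma hol_atE:
  assumes "hol_at X Y x f" "fopen Y V" "f x \<in> V" "g \<in> fhol Y V"
  obtains N where "fopen X N" "x \<in> N" "f ` N \<subseteq> V" "g \<circ> f \<in> fhol X N"
  using assms unfolding hol_at_def by blast

lemma hol_at_pts: "hol_at X Y x f \<Longrightarrow> x \<in> fpts X" "hol_at X Y x f \<Longrightarrow> f x \<in> fpts Y"
  by (auto simp: hol_at_def)

lemma hol_at_comp:
  assumes "hol_at X Y x f" "hol_at Y Z (f x) g"
  shows "hol_at X Z x (g \<circ> f)"
  unfolding hol_at_def
proof (intro conjI allI impI; (elim conjE)?)
  show "x \<in> fpts X" "(g \<circ> f) x \<in> fpts Z" using assms by (auto simp: hol_at_def)
  fix V k assume V: "fopen Z V" "(g \<circ> f) x \<in> V" "k \<in> fhol Z V"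
  then obtain N where N: "fopen Y N" "f x \<in> N" "g ` N \<subseteq> V" "k \<circ> g \<in> fhol Y N"
    using hol_atE[OF assms(2)] by (metis comp_apply)
  then obtain N' where "fopen X N'" "x \<in> N'" "f ` N' \<subseteq> N" "(k \<circ> g) \<circ> f \<in> fhol X N'"
    using hol_atE[OF assms(1)] by metis
  then show "\<exists>N. fopen X N \<and> x \<in> N \<and> (g \<circ> f) ` N \<subseteq> V \<and> k \<circ> (g \<circ> f) \<in> fhol X N"
    using N(3) by (intro exI[of _ N']) (auto simp: comp_assoc)
qed

lemma hol_at_cong:
  assumes X: "sheafy X" and "hol_at X Y x f" and N0: "fopen X N0" "x \<in> N0"
    and eq: "\<And>y. y \<in> N0 \<Longrightarrow> f y = g y"
  shows "hol_at X Y x g"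
  unfolding hol_at_def
proof (intro conjI allI impI; (elim conjE)?)
  show "x \<in> fpts X" "g x \<in> fpts Y" using assms by (auto simp: hol_at_def)
  fix V k assume V: "fopen Y V" "g x \<in> V" "k \<in> fhol Y V"
  then obtain N where N: "fopen X N" "x \<in> N" "f ` N \<subseteq> V" "k \<circ> f \<in> fhol X N"
    using hol_atE[OF assms(2)] eq N0 by metis
  have o: "fopen X (N \<inter> N0)" using N N0 by auto
  have "k \<circ> f \<in> fhol X (N \<inter> N0)" by (rule sheafy_restrict[OF X N(4) N(1) o]) auto
  then have "k \<circ> g \<in> fhol X (N \<inter> N0)" by (rule sheafy_cong[OF X _ o]) (auto simp: eq)
  with o N N0 eq show "\<exists>N. fopen X N \<and> x \<in> N \<and> g ` N \<subseteq> V \<and> k \<circ> g \<in> fhol X N"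
    by (intro exI[of _ "N \<inter> N0"]) auto
qed

lemma hol_at_comp':
  assumes "sheafy X" "hol_at X Y x f" "hol_at Y Z (f x) g" "fopen X N" "x \<in> N"
    and "\<And>y. y \<in> N \<Longrightarrow> h y = g (f y)"
  shows "hol_at X Z x h"
  using hol_at_cong[OF assms(1) hol_at_comp[OF assms(2,3)] assms(4,5)] assms(6) by simp

text \<open>The zero function is a section over every open \<open>V\<close>; tested on it,
  \<open>hol_at\<close> gives around each point a neighbourhood that is mapped into
  \<open>V\<close>.\<close>

lemma hol_at_openin_vimage:
  assumes "fopen X D" "sheafy Y" "\<And>x. x \<in> D \<Longrightarrow> hol_at X Y x f" "fopen Y V"
  shows "fopen X {x \<in> D. f x \<in> V}"
proof (subst openin_subopen, intro ballI)
  fix x assume x: "x \<in> {x \<in> D. f x \<in> V}"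
  then obtain N where "fopen X N" "x \<in> N" "f ` N \<subseteq> V"
    using hol_atE[OF assms(3) assms(4) _ sheafy_zero[OF assms(2,4)]] by (metis (no_types, lifting) mem_Collect_eq)
  then show "\<exists>T. fopen X T \<and> x \<in> T \<and> T \<subseteq> {x \<in> D. f x \<in> V}"
    using x assms(1) by (intro exI[of _ "N \<inter> D"]) auto
qed

lemma hol_at_fhol_comp:
  assumes X: "sheafy X" and Y: "sheafy Y" and D: "fopen X D"
    and f: "\<And>x. x \<in> D \<Longrightarrow> hol_at X Y x f" and V: "fopen Y V" and g: "g \<in> fhol Y V"
  shows "g \<circ> f \<in> fhol X {x \<in> D. f x \<in> V}"
proof (rule sheafy_local[OF X])
  show o: "fopen X {x \<in> D. f x \<in> V}" by (rule hol_at_openin_vimage[OF D Y f V])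
  fix x assume x: "x \<in> {x \<in> D. f x \<in> V}"
  then obtain N where N: "fopen X N" "x \<in> N" "f ` N \<subseteq> V" "g \<circ> f \<in> fhol X N"
    using hol_atE[OF f V _ g] by (metis (no_types, lifting) mem_Collect_eq)
  have o': "fopen X (N \<inter> D)" using N D by auto
  have "g \<circ> f \<in> fhol X (N \<inter> D)" by (rule sheafy_restrict[OF X N(4) N(1) o']) auto
  then show "\<exists>N. fopen X N \<and> x \<in> N \<and> N \<subseteq> {x \<in> D. f x \<in> V} \<and> g \<circ> f \<in> fhol X N"
    using o' N x by (intro exI[of _ "N \<inter> D"]) auto
qed

lemma hol_mapI:
  assumes X: "sheafy X" and Y: "sheafy Y" and f: "\<And>x. x \<in> fpts X \<Longrightarrow> hol_at X Y x f"
  shows "hol_map X Y f"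
  unfolding hol_map_def continuous_map
  using hol_at_openin_vimage[OF openin_topspace Y f] hol_at_fhol_comp[OF X Y openin_topspace f] f
  by (auto simp: hol_at_def)

lemma biholomorphic_mapI:
  assumes X: "sheafy X" and Y: "sheafy Y"
    and f: "\<And>x. x \<in> fpts X \<Longrightarrow> hol_at X Y x f" and g: "\<And>y. y \<in> fpts Y \<Longrightarrow> hol_at Y X y g"
    and gf: "\<And>x. x \<in> fpts X \<Longrightarrow> g (f x) = x" and fg: "\<And>y. y \<in> fpts Y \<Longrightarrow> f (g y) = y"
  shows "biholomorphic_map X Y f"
proof -
  have b: "bij_betw f (fpts X) (fpts Y)"
    by (rule bij_betw_byWitness[where f' = g]) (use f g gf fg in \<open>auto simp: hol_at_def\<close>)
  have "inv_into (fpts X) f y = g y" if "y \<in> fpts Y" for y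
    by (rule inv_into_f_eq) (use b that g fg in \<open>auto simp: bij_betw_def hol_at_def\<close>)
  then have "hol_at Y X y (inv_into (fpts X) f)" if "y \<in> fpts Y" for y
    by (intro hol_at_cong[OF Y g[OF that] openin_topspace that]) auto
  with b show ?thesis unfolding biholomorphic_map_def
    by (auto intro!: hol_mapI X Y f)
qed

section \<open>Subspaces, sums and quotients\<close>

lemma openin_fsub: "fopen (fsub X S) U \<longleftrightarrow> (\<exists>T. fopen X T \<and> U = T \<inter> S)"
  by (simp add: fsub_def openin_subtopology)

lemma fhol_fsub:
  "f \<in> fhol (fsub X S) U \<longleftrightarrow>
     (\<forall>x\<in>U. \<exists>N. fopen X N \<and> x \<in> N \<and> (\<exists>g\<in>fhol X N. \<forall>y\<in>N \<inter> U. f y = g y))"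
  by (simp add: fsub_def)

lemma fhol_fsubE:
  assumes "f \<in> fhol (fsub X S) U" "x \<in> U"
  obtains N g where "fopen X N" "x \<in> N" "g \<in> fhol X N" "\<And>y. y \<in> N \<Longrightarrow> y \<in> U \<Longrightarrow> f y = g y"
  using bspec[OF iffD1[OF fhol_fsub assms(1)] assms(2)] by (elim exE conjE bexE) auto

lemma sheafy_fsub:
  assumes X: "sheafy X" shows "sheafy (fsub X S)"
proof (rule sheafyI)
  fix U assume "fopen (fsub X S) U"
  then have "U \<subseteq> fpts X" using openin_subset by fastforce
  then show "(\<lambda>_. 0) \<in> fhol (fsub X S) U"
    unfolding fhol_fsub
    by (intro ballI exI[of _ "fpts X"] conjI bexI[of _ "\<lambda>_. 0"] sheafy_zero[OF X]) auto
next
  fix U f assume U: "fopen (fsub X S) U" and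
    loc: "\<And>x. x \<in> U \<Longrightarrow> \<exists>N. fopen (fsub X S) N \<and> x \<in> N \<and> (\<exists>g\<in>fhol (fsub X S) N. \<forall>y\<in>N \<inter> U. f y = g y)"
  show "f \<in> fhol (fsub X S) U" unfolding fhol_fsub
  proof
    fix x assume "x \<in> U"
    from loc[OF this] obtain N g where N: "fopen (fsub X S) N" "x \<in> N" "g \<in> fhol (fsub X S) N"
      "\<forall>y\<in>N \<inter> U. f y = g y" by (elim exE conjE bexE)
    obtain N1 h where N1: "fopen X N1" "x \<in> N1" "h \<in> fhol X N1" "\<And>y. y \<in> N1 \<Longrightarrow> y \<in> N \<Longrightarrow> g y = h y"
      using fhol_fsubE[OF N(3,2)] by blast
    obtain T where T: "fopen X T" "N = T \<inter> S" using N(1) by (auto simp: openin_fsub)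
    have US: "U \<subseteq> S" using openin_subset[OF U] by auto
    have o: "fopen X (N1 \<inter> T)" using N1 T by auto
    have eq: "f y = h y" if "y \<in> N1 \<inter> T \<inter> U" for y
    proof -
      have "y \<in> N" using that T(2) US by blast
      then show ?thesis using N(4) N1(4)[of y] that by simp
    qed
    have "h \<in> fhol X (N1 \<inter> T)" by (rule sheafy_restrict[OF X N1(3,1) o]) auto
    moreover have "x \<in> N1 \<inter> T" using N(2) N1(2) T(2) by blast
    ultimately show "\<exists>N. fopen X N \<and> x \<in> N \<and> (\<exists>g\<in>fhol X N. \<forall>y\<in>N \<inter> U. f y = g y)"
      using o eq by (intro exI[of _ "N1 \<inter> T"] conjI bexI[of _ h] ballI)
  qed
qed

lemma hol_at_fsub_incl:
  assumes "x \<in> fpts X" "x \<in> S"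
  shows "hol_at (fsub X S) X x (\<lambda>x. x)"
  unfolding hol_at_def
proof (intro conjI allI impI; (elim conjE)?)
  show "x \<in> fpts (fsub X S)" "x \<in> fpts X" using assms by auto
  fix V g assume V: "fopen X V" "x \<in> V" "g \<in> fhol X V"
  have "g \<in> fhol (fsub X S) (V \<inter> S)" unfolding fhol_fsub using V by auto
  then show "\<exists>N. fopen (fsub X S) N \<and> x \<in> N \<and> (\<lambda>x. x) ` N \<subseteq> V \<and> g \<circ> (\<lambda>x. x) \<in> fhol (fsub X S) N"
    using V assms by (intro exI[of _ "V \<inter> S"]) (auto simp: openin_fsub comp_def)
qed

lemma hol_at_fsub_dom:
  assumes "hol_at X Y x f" "x \<in> S"
  shows "hol_at (fsub X S) Y x f"
  using hol_at_comp[OF hol_at_fsub_incl[OF _ assms(2)] assms(1)] hol_at_pts[OF assms(1)] by (simp add: comp_def)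

text \<open>A function on the subspace is near \<open>f x\<close> the restriction of some
  \<open>g1\<close> on \<open>Y\<close>, and the pullbacks of both agree because \<open>f\<close>
  stays in \<open>S\<close>.\<close>

lemma hol_at_fsub_cod:
  assumes X: "sheafy X" and Y: "sheafy Y" and f: "hol_at X Y x f"
    and N0: "fopen X N0" "x \<in> N0" "\<And>y. y \<in> N0 \<Longrightarrow> f y \<in> S"
  shows "hol_at X (fsub Y S) x f"
  unfolding hol_at_def
proof (intro conjI allI impI; (elim conjE)?)
  show "x \<in> fpts X" "f x \<in> fpts (fsub Y S)" using assms by (auto simp: hol_at_def)
  fix V g assume V: "fopen (fsub Y S) V" "f x \<in> V" "g \<in> fhol (fsub Y S) V"
  obtain N1 g1 where N1: "fopen Y N1" "f x \<in> N1" "g1 \<in> fhol Y N1"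
    "\<And>y. y \<in> N1 \<Longrightarrow> y \<in> V \<Longrightarrow> g y = g1 y" using fhol_fsubE[OF V(3,2)] by blast
  obtain T where T: "fopen Y T" "V = T \<inter> S" using V(1) by (auto simp: openin_fsub)
  have o1: "fopen Y (N1 \<inter> T)" using N1 T by auto
  have g1: "g1 \<in> fhol Y (N1 \<inter> T)" by (rule sheafy_restrict[OF Y N1(3,1) o1]) auto
  have "f x \<in> N1 \<inter> T" using N1 T V by auto
  then obtain N where N: "fopen X N" "x \<in> N" "f ` N \<subseteq> N1 \<inter> T" "g1 \<circ> f \<in> fhol X N"
    using hol_atE[OF f o1 _ g1] by metis
  have o: "fopen X (N \<inter> N0)" using N N0 by auto
  have im: "f y \<in> N1 \<and> f y \<in> V" if "y \<in> N \<inter> N0" for y using N(3) N0(3) T that by auto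
  have "g1 \<circ> f \<in> fhol X (N \<inter> N0)" by (rule sheafy_restrict[OF X N(4,1) o]) auto
  then have "g \<circ> f \<in> fhol X (N \<inter> N0)"
    by (rule sheafy_cong[OF X _ o]) (use im N1(4) in force)
  then show "\<exists>N. fopen X N \<and> x \<in> N \<and> f ` N \<subseteq> V \<and> g \<circ> f \<in> fhol X N"
    using o im N(2) N0(2) by (intro exI[of _ "N \<inter> N0"]) auto
qed

text \<open>The inverse is tested in the structure of the subspace \<open>A\<close> only, since
  \<open>A\<close> need not be open in \<open>M\<close>.\<close>

lemma biholomorphic_onto_fsub:
  assumes X: "sheafy X" and M: "sheafy M" and f: "\<And>x. x \<in> fpts X \<Longrightarrow> hol_at X M x f"
    and inj: "inj_on f (fpts X)" and im: "f ` fpts X = A"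
    and g: "\<And>m. m \<in> A \<Longrightarrow> hol_at (fsub M A) X m (inv_into (fpts X) f)"
  shows "biholomorphic_map X (fsub M A) f"
proof (rule biholomorphic_mapI[OF X sheafy_fsub[OF M]])
  show "hol_at X (fsub M A) x f" if "x \<in> fpts X" for x
    by (rule hol_at_fsub_cod[OF X M f[OF that] openin_topspace that]) (use im in auto)
  show "hol_at (fsub M A) X m (inv_into (fpts X) f)" if "m \<in> fpts (fsub M A)" for m
    using g that by simp
qed (use inj im in \<open>auto intro: f_inv_into_f\<close>)

text \<open>The way holomorphy on a non-open set is obtained below: a local extension
  \<open>F\<close> to the ambient space is exhibited, which has to agree with \<open>f\<close> on
  \<open>S\<close> alone.\<close>

lemma hol_at_fsub_extend:
  assumes X: "sheafy X" and x: "x \<in> S" and F: "hol_at X Y x F"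
    and N: "fopen X N" "x \<in> N" "\<And>y. y \<in> N \<Longrightarrow> y \<in> S \<Longrightarrow> f y = F y"
  shows "hol_at (fsub X S) Y x f"
  by (rule hol_at_cong[OF sheafy_fsub[OF X] hol_at_fsub_dom[OF F x], of "N \<inter> S"])
    (use N x in \<open>auto simp: openin_fsub\<close>)

lemma fhol_fquot: "f \<in> fhol (fquot \<pi> X) U \<longleftrightarrow> f \<circ> \<pi> \<in> fhol X {x \<in> fpts X. \<pi> x \<in> U}"
  by (simp add: fquot_def)

lemma sheafy_fquot:
  assumes X: "sheafy X" shows "sheafy (fquot \<pi> X)"
proof (rule sheafyI)
  fix U assume "fopen (fquot \<pi> X) U"
  then show "(\<lambda>_. 0) \<in> fhol (fquot \<pi> X) U"
    using sheafy_zero[OF X] by (simp add: openin_fquot fhol_fquot comp_def)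
next
  fix U f assume U: "fopen (fquot \<pi> X) U" and
    loc: "\<And>x. x \<in> U \<Longrightarrow> \<exists>N. fopen (fquot \<pi> X) N \<and> x \<in> N \<and> (\<exists>g\<in>fhol (fquot \<pi> X) N. \<forall>y\<in>N \<inter> U. f y = g y)"
  show "f \<in> fhol (fquot \<pi> X) U" unfolding fhol_fquot
  proof (rule sheafy_glue[OF X])
    fix x assume x: "x \<in> {x \<in> fpts X. \<pi> x \<in> U}"
    then obtain N g where "fopen (fquot \<pi> X) N" "\<pi> x \<in> N" "g \<in> fhol (fquot \<pi> X) N" "\<forall>y\<in>N \<inter> U. f y = g y"
      using loc by blast
    then show "\<exists>N. fopen X N \<and> x \<in> N \<and>
        (\<exists>g\<in>fhol X N. \<forall>y\<in>N \<inter> {x \<in> fpts X. \<pi> x \<in> U}. (f \<circ> \<pi>) y = g y)"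
      using x by (intro exI[of _ "{x \<in> fpts X. \<pi> x \<in> N}"] conjI bexI[of _ "g \<circ> \<pi>"])
        (auto simp: openin_fquot fhol_fquot)
  qed (use U in \<open>simp add: openin_fquot\<close>)
qed

lemma hol_at_fquot_proj:
  assumes "x \<in> fpts X" shows "hol_at X (fquot \<pi> X) x \<pi>"
  unfolding hol_at_def
proof (intro conjI allI impI; (elim conjE)?)
  show "x \<in> fpts X" "\<pi> x \<in> fpts (fquot \<pi> X)" using assms by auto
  fix V g assume "fopen (fquot \<pi> X) V" "\<pi> x \<in> V" "g \<in> fhol (fquot \<pi> X) V"
  then show "\<exists>N. fopen X N \<and> x \<in> N \<and> \<pi> ` N \<subseteq> V \<and> g \<circ> \<pi> \<in> fhol X N"
    using assms by (intro exI[of _ "{x \<in> fpts X. \<pi> x \<in> V}"]) (auto simp: openin_fquot fhol_fquot)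
qed

text \<open>Only saturated open sets descend, so \<open>U\<close> is open in the quotient and the
  hypothesis covers all preimages of its points. The set where \<open>f\<close> lands in
  \<open>V\<close> then has a saturated preimage by construction.\<close>

lemma hol_at_fquot_desc:
  assumes X: "sheafy X" and Y: "sheafy Y" and U: "fopen (fquot \<pi> X) U"
    and f: "\<And>x. x \<in> fpts X \<Longrightarrow> \<pi> x \<in> U \<Longrightarrow> hol_at X Y x (f \<circ> \<pi>)" and q: "q \<in> U"
  shows "hol_at (fquot \<pi> X) Y q f"
  unfolding hol_at_def
proof (intro conjI allI impI; (elim conjE)?)
  let ?D = "{x \<in> fpts X. \<pi> x \<in> U}"
  have D: "fopen X ?D" "U \<subseteq> \<pi> ` fpts X" using U by (auto simp: openin_fquot)
  then obtain x where x: "x \<in> fpts X" "q = \<pi> x" using q by auto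
  then show "q \<in> fpts (fquot \<pi> X)" "f q \<in> fpts Y" using f[of x] q by (auto simp: hol_at_def)
  fix V g assume V: "fopen Y V" "f q \<in> V" "g \<in> fhol Y V"
  let ?N = "{r \<in> U. f r \<in> V}"
  have eq: "{x \<in> fpts X. \<pi> x \<in> ?N} = {x \<in> ?D. (f \<circ> \<pi>) x \<in> V}" by auto
  have "fopen (fquot \<pi> X) ?N" unfolding openin_fquot eq
    using D hol_at_openin_vimage[OF D(1) Y _ V(1), of "f \<circ> \<pi>"] f by auto
  moreover have "g \<circ> f \<in> fhol (fquot \<pi> X) ?N"
    using hol_at_fhol_comp[OF X Y D(1) _ V(1,3), of "f \<circ> \<pi>"] f
    by (simp add: fhol_fquot eq comp_assoc)
  ultimately show "\<exists>N. fopen (fquot \<pi> X) N \<and> q \<in> N \<and> f ` N \<subseteq> V \<and> g \<circ> f \<in> fhol (fquot \<pi> X) N"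
    using q V by (intro exI[of _ ?N]) auto
qed

lemma fhol_fsum: "f \<in> fhol (X \<oplus>\<^sub>f Y) U \<longleftrightarrow> f \<circ> Inl \<in> fhol X (Inl -` U) \<and> f \<circ> Inr \<in> fhol Y (Inr -` U)"
  by (simp add: fsum_def)

lemma sheafy_fsum:
  fixes X :: "'a fspace" and Y :: "'b fspace"
  assumes X: "sheafy X" and Y: "sheafy Y" shows "sheafy (X \<oplus>\<^sub>f Y)"
proof (rule sheafyI)
  fix U assume "fopen (X \<oplus>\<^sub>f Y) U"
  then show "(\<lambda>_. 0) \<in> fhol (X \<oplus>\<^sub>f Y) U"
    using sheafy_zero[OF X] sheafy_zero[OF Y] by (simp add: openin_fsum fhol_fsum comp_def)
next
  fix U f assume U: "fopen (X \<oplus>\<^sub>f Y) U" and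
    loc: "\<And>x. x \<in> U \<Longrightarrow> \<exists>N. fopen (X \<oplus>\<^sub>f Y) N \<and> x \<in> N \<and> (\<exists>g\<in>fhol (X \<oplus>\<^sub>f Y) N. \<forall>y\<in>N \<inter> U. f y = g y)"
  have "f \<circ> Inl \<in> fhol X (Inl -` U)"
  proof (rule sheafy_glue[OF X])
    fix x assume "x \<in> (Inl -` U :: 'a set)"
    then obtain N g where "fopen (X \<oplus>\<^sub>f Y) N" "Inl x \<in> N" "g \<in> fhol (X \<oplus>\<^sub>f Y) N" "\<forall>y\<in>N \<inter> U. f y = g y"
      using loc by blast
    then show "\<exists>N. fopen X N \<and> x \<in> N \<and> (\<exists>g\<in>fhol X N. \<forall>y\<in>N \<inter> Inl -` U. (f \<circ> Inl) y = g y)"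
      by (intro exI[of _ "Inl -` N"] conjI bexI[of _ "g \<circ> Inl"]) (auto simp: openin_fsum fhol_fsum)
  qed (use U in \<open>simp add: openin_fsum\<close>)
  moreover have "f \<circ> Inr \<in> fhol Y (Inr -` U)"
  proof (rule sheafy_glue[OF Y])
    fix x assume "x \<in> (Inr -` U :: 'b set)"
    then obtain N g where "fopen (X \<oplus>\<^sub>f Y) N" "Inr x \<in> N" "g \<in> fhol (X \<oplus>\<^sub>f Y) N" "\<forall>y\<in>N \<inter> U. f y = g y"
      using loc by blast
    then show "\<exists>N. fopen Y N \<and> x \<in> N \<and> (\<exists>g\<in>fhol Y N. \<forall>y\<in>N \<inter> Inr -` U. (f \<circ> Inr) y = g y)"
      by (intro exI[of _ "Inr -` N"] conjI bexI[of _ "g \<circ> Inr"]) (auto simp: openin_fsum fhol_fsum)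
  qed (use U in \<open>simp add: openin_fsum\<close>)
  ultimately show "f \<in> fhol (X \<oplus>\<^sub>f Y) U" by (simp add: fhol_fsum)
qed

lemma hol_at_Inl: "x \<in> fpts X \<Longrightarrow> hol_at X (X \<oplus>\<^sub>f Y) x Inl"
  unfolding hol_at_def by (auto simp: openin_fsum fhol_fsum fpts_fsum)

lemma hol_at_Inr: "y \<in> fpts Y \<Longrightarrow> hol_at Y (X \<oplus>\<^sub>f Y) y Inr"
  unfolding hol_at_def by (auto simp: openin_fsum fhol_fsum fpts_fsum)

text \<open>Gluing over the empty set is vacuous. This disposes of the other summand in a disjoint
  sum.\<close>

lemma fhol_empty: "sheafy X \<Longrightarrow> f \<in> fhol X {}"
  by (rule sheafy_local) auto

lemma hol_at_fsum_Inl: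
  fixes X :: "'a fspace" and Y :: "'b fspace"
  assumes Y: "sheafy Y" and f: "hol_at X Z x (f \<circ> Inl)"
  shows "hol_at (X \<oplus>\<^sub>f Y) Z (Inl x) f"
  unfolding hol_at_def
proof (intro conjI allI impI; (elim conjE)?)
  show "Inl x \<in> fpts (X \<oplus>\<^sub>f Y)" "f (Inl x) \<in> fpts Z" using f by (auto simp: hol_at_def fpts_fsum)
  fix V g assume "fopen Z V" "f (Inl x) \<in> V" "g \<in> fhol Z V"
  then obtain N where N: "fopen X N" "x \<in> N" "(f \<circ> Inl) ` N \<subseteq> V" "g \<circ> (f \<circ> Inl) \<in> fhol X N"
    using hol_atE[OF f, of V g] by auto
  have "Inl -` (Inl ` N :: ('a + 'b) set) = N" "Inr -` (Inl ` N :: ('a + 'b) set) = {}" by auto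
  with N show "\<exists>N. fopen (X \<oplus>\<^sub>f Y) N \<and> Inl x \<in> N \<and> f ` N \<subseteq> V \<and> g \<circ> f \<in> fhol (X \<oplus>\<^sub>f Y) N"
    by (intro exI[of _ "Inl ` N"]) (auto simp: openin_fsum fhol_fsum comp_assoc fhol_empty[OF Y])
qed

lemma hol_at_fsum_Inr:
  fixes X :: "'a fspace" and Y :: "'b fspace"
  assumes X: "sheafy X" and f: "hol_at Y Z y (f \<circ> Inr)"
  shows "hol_at (X \<oplus>\<^sub>f Y) Z (Inr y) f"
  unfolding hol_at_def
proof (intro conjI allI impI; (elim conjE)?)
  show "Inr y \<in> fpts (X \<oplus>\<^sub>f Y)" "f (Inr y) \<in> fpts Z" using f by (auto simp: hol_at_def fpts_fsum)
  fix V g assume "fopen Z V" "f (Inr y) \<in> V" "g \<in> fhol Z V"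
  then obtain N where N: "fopen Y N" "y \<in> N" "(f \<circ> Inr) ` N \<subseteq> V" "g \<circ> (f \<circ> Inr) \<in> fhol Y N"
    using hol_atE[OF f, of V g] by auto
  have "Inr -` (Inr ` N :: ('a + 'b) set) = N" "Inl -` (Inr ` N :: ('a + 'b) set) = {}" by auto
  with N show "\<exists>N. fopen (X \<oplus>\<^sub>f Y) N \<and> Inr y \<in> N \<and> f ` N \<subseteq> V \<and> g \<circ> f \<in> fhol (X \<oplus>\<^sub>f Y) N"
    by (intro exI[of _ "Inr ` N"]) (auto simp: openin_fsum fhol_fsum comp_assoc fhol_empty[OF X])
qed

section \<open>Complex differentiability\<close>

definition cdiff :: "(complex ^ 'n \<Rightarrow> complex) \<Rightarrow> complex ^ 'n \<Rightarrow> bool" where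
  "cdiff f x \<longleftrightarrow> (\<exists>D. (f has_derivative D) (at x) \<and> (\<forall>c v. D (c *s v) = c * D v))"

lemma fhol_cspace: "f \<in> fhol cspace U \<longleftrightarrow> (\<forall>x\<in>U. cdiff f x)"
  by (simp add: cspace_def cdiff_def)

lemma ftop_cspace [simp]: "ftop cspace = euclidean"
  by (simp add: cspace_def)

lemma cdiff_const [intro, simp]: "cdiff (\<lambda>_. c) x"
  unfolding cdiff_def by (intro exI[of _ "\<lambda>_. 0"]) auto

lemma cdiff_nth [intro, simp]: "cdiff (\<lambda>t. t $ i) x"
  unfolding cdiff_def
  by (intro exI[of _ "\<lambda>t. t $ i"]) (auto intro: bounded_linear_imp_has_derivative bounded_linear_vec_nth)

lemma cdiff_add [intro]: assumes "cdiff f x" "cdiff g x" shows "cdiff (\<lambda>t. f t + g t) x"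
proof -
  obtain D E where "(f has_derivative D) (at x)" "\<forall>c v. D (c *s v) = c * D v"
    "(g has_derivative E) (at x)" "\<forall>c v. E (c *s v) = c * E v" using assms unfolding cdiff_def by blast
  then show ?thesis unfolding cdiff_def
    by (intro exI[of _ "\<lambda>h. D h + E h"]) (auto intro: has_derivative_add simp: algebra_simps)
qed

lemma cdiff_mult [intro]: assumes "cdiff f x" "cdiff g x" shows "cdiff (\<lambda>t. f t * g t) x"
proof -
  obtain D E where "(f has_derivative D) (at x)" "\<forall>c v. D (c *s v) = c * D v"
    "(g has_derivative E) (at x)" "\<forall>c v. E (c *s v) = c * E v" using assms unfolding cdiff_def by blast
  then show ?thesis unfolding cdiff_def
    by (intro exI[of _ "\<lambda>h. f x * E h + D h * g x"]) (use has_derivative_mult[of f D x UNIV g E] in \<open>auto simp: algebra_simps\<close>)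
qed

lemma cdiff_compose:
  assumes "cdiff f x" "\<phi> field_differentiable at (f x)"
  shows "cdiff (\<lambda>t. \<phi> (f t)) x"
proof -
  obtain D where D: "(f has_derivative D) (at x)" "\<forall>c v. D (c *s v) = c * D v"
    using assms unfolding cdiff_def by blast
  obtain d where "(\<phi> has_field_derivative d) (at (f x))"
    using assms unfolding field_differentiable_def by blast
  then have "((\<lambda>t. \<phi> (f t)) has_derivative (\<lambda>h. d * D h)) (at x)"
    using has_derivative_compose[OF D(1)] by (simp add: has_field_derivative_def)
  with D(2) show ?thesis unfolding cdiff_def by (intro exI[of _ "\<lambda>h. d * D h"]) auto
qed

lemma cdiff_minus [intro]: "cdiff f x \<Longrightarrow> cdiff (\<lambda>t. - f t) x"
  using cdiff_mult[OF cdiff_const[of "-1"]] by fastforce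

lemma cdiff_diff [intro]: "cdiff f x \<Longrightarrow> cdiff g x \<Longrightarrow> cdiff (\<lambda>t. f t - g t) x"
  using cdiff_add[OF _ cdiff_minus] by fastforce

lemma cdiff_power [intro]: "cdiff f x \<Longrightarrow> cdiff (\<lambda>t. f t ^ k) x"
  by (induction k) auto

lemma cdiff_divide [intro]:
  assumes "cdiff f x" "cdiff g x" "g x \<noteq> 0" shows "cdiff (\<lambda>t. f t / g t) x"
proof -
  have "cdiff (\<lambda>t. f t * inverse (g t)) x"
    by (intro cdiff_mult assms cdiff_compose[of g, where \<phi> = inverse])
      (use assms in \<open>auto intro: field_differentiable_inverse\<close>)
  then show ?thesis by (simp add: divide_inverse)
qed

lemma cdiff_csqrt [intro]:
  assumes "cdiff f x" "f x \<notin> \<real>\<^sub>\<le>\<^sub>0" shows "cdiff (\<lambda>t. csqrt (f t)) x"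
  using cdiff_compose[OF assms(1), of csqrt] assms field_differentiable_at_csqrt by blast

lemma cdiff_cong:
  assumes "cdiff f x" "open N" "x \<in> N" "\<And>y. y \<in> N \<Longrightarrow> f y = g y"
  shows "cdiff g x"
  using assms unfolding cdiff_def by (metis has_derivative_transform_within_open)

lemma sheafy_cspace: "sheafy cspace"
proof (rule sheafyI)
  fix U :: "(complex ^ 'n) set"
  show "(\<lambda>_. 0) \<in> fhol cspace U" by (simp add: fhol_cspace)
next
  fix U and f :: "complex ^ 'n \<Rightarrow> complex"
  assume U: "fopen cspace U" and loc: "\<And>x. x \<in> U \<Longrightarrow> \<exists>N. fopen cspace N \<and> x \<in> N \<and>
    (\<exists>g\<in>fhol cspace N. \<forall>y\<in>N \<inter> U. f y = g y)"
  show "f \<in> fhol cspace U" unfolding fhol_cspace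
  proof
    fix x assume x: "x \<in> U"
    from loc[OF x] obtain N g where N: "fopen cspace N" "x \<in> N" "g \<in> fhol cspace N" "\<forall>y\<in>N \<inter> U. f y = g y"
      by (elim exE conjE bexE)
    have "cdiff g x" using N(2,3) unfolding fhol_cspace by (rule bspec[rotated])
    moreover have "open (N \<inter> U)" using N(1) U by (simp add: open_Int)
    ultimately show "cdiff f x" by (rule cdiff_cong) (use x N in simp_all)
  qed
qed

text \<open>In \<open>cspace\<close> and in \<open>cline\<close> alike, holomorphy on a set is a
  pointwise differentiability predicate, so one argument serves all four combinations of source and
  target.\<close>

lemma hol_at_pointwiseI:
  assumes top: "ftop X = euclidean" "ftop Y = euclidean"
    and X: "\<And>U f. f \<in> fhol X U \<longleftrightarrow> (\<forall>x\<in>U. P f x)" and Y: "\<And>V g. g \<in> fhol Y V \<longleftrightarrow> (\<forall>y\<in>V. Q g y)"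
    and N: "open N" "x \<in> N" "\<And>y. y \<in> N \<Longrightarrow> isCont L y"
    and L: "\<And>y g. y \<in> N \<Longrightarrow> Q g (L y) \<Longrightarrow> P (g \<circ> L) y"
  shows "hol_at X Y x L"
  unfolding hol_at_def
proof (intro conjI allI impI; (elim conjE)?)
  show "x \<in> fpts X" "L x \<in> fpts Y" by (simp_all add: top)
  fix V g assume V: "fopen Y V" "L x \<in> V" "g \<in> fhol Y V"
  have "continuous_on N L" using N(3) by (simp add: continuous_at_imp_continuous_on)
  then have "open (N \<inter> L -` V)" using N V(1) top continuous_open_preimage by auto
  with N V L show "\<exists>N. fopen X N \<and> x \<in> N \<and> L ` N \<subseteq> V \<and> g \<circ> L \<in> fhol X N"
    by (intro exI[of _ "N \<inter> L -` V"]) (auto simp: X Y top)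
qed

lemma cdiff_vec_has_derivative:
  fixes L :: "complex ^ 'n \<Rightarrow> complex ^ 'm"
  assumes "\<And>i. cdiff (\<lambda>s. L s $ i) x"
  obtains D where "(L has_derivative D) (at x)" "\<And>c v. D (c *s v) = c *s D v"
proof -
  obtain E where E: "\<And>i. ((\<lambda>s. L s $ i) has_derivative E i) (at x)" "\<And>i c v. E i (c *s v) = c * E i v"
    using assms unfolding cdiff_def by metis
  have "(L has_derivative (\<lambda>h. \<chi> i. E i h)) (at x)"
    unfolding has_derivative_componentwise_within[of L]
  proof
    fix b :: "complex ^ 'm" assume "b \<in> Basis"
    \<comment> \<open>The Euclidean structure is real: its basis vectors are \<open>axis i u\<close>
      with \<open>u\<close> one of \<open>1\<close> and \<open>\<i>\<close>, so a component is
      tested through its inner product with \<open>u\<close>.\<close>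
    then obtain i u where b: "b = axis i u" "u \<in> Basis" by (auto simp: Basis_vec_def)
    have "((\<lambda>s. L s $ i \<bullet> u) has_derivative (\<lambda>h. E i h \<bullet> u)) (at x)"
      by (intro has_derivative_inner_left E)
    then show "((\<lambda>s. L s \<bullet> b) has_derivative (\<lambda>h. (\<chi> i. E i h) \<bullet> b)) (at x)"
      by (simp add: b inner_axis)
  qed
  then show ?thesis by (rule that) (simp add: E vec_eq_iff)
qed

lemma hol_at_cspace_cspaceI:
  fixes L :: "complex ^ 'n \<Rightarrow> complex ^ 'm"
  assumes N: "open N" "x \<in> N" and L: "\<And>y i. y \<in> N \<Longrightarrow> cdiff (\<lambda>s. L s $ i) y"
  shows "hol_at cspace cspace x L"
proof (rule hol_at_pointwiseI[OF ftop_cspace ftop_cspace fhol_cspace fhol_cspace N])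
  fix y assume "y \<in> N"
  then obtain D where D: "(L has_derivative D) (at y)" "\<And>c v. D (c *s v) = c *s D v"
    using cdiff_vec_has_derivative[of L y] L by blast
  then show "isCont L y" by (rule_tac has_derivative_continuous)
  fix g assume "cdiff g (L y)"
  then obtain E where E: "(g has_derivative E) (at (L y))" "\<And>c v. E (c *s v) = c * E v"
    unfolding cdiff_def by blast
  show "cdiff (g \<circ> L) y" unfolding cdiff_def using diff_chain_at[OF D(1) E(1)] D(2) E(2)
    by (intro exI[of _ "E \<circ> D"]) auto
qed

lemmas cdiff_intros = cdiff_const cdiff_nth cdiff_add cdiff_diff cdiff_minus cdiff_mult cdiff_power
  cdiff_divide cdiff_csqrt

lemma hol_at_vec2:
  assumes "open N" "x \<in> N" "\<And>y. y \<in> N \<Longrightarrow> cdiff f1 y" "\<And>y. y \<in> N \<Longrightarrow> cdiff f2 y"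
  shows "hol_at cspace cspace x (\<lambda>t. vector [f1 t, f2 t] :: complex ^ 2)"
proof (rule hol_at_cspace_cspaceI[OF assms(1,2)])
  fix y i assume "y \<in> N"
  then have "\<forall>i::2. cdiff (\<lambda>t. vector [f1 t, f2 t] $ i) y" unfolding forall_2 using assms by simp
  then show "cdiff (\<lambda>t. (vector [f1 t, f2 t] :: complex ^ 2) $ i) y" by blast
qed

lemma hol_at_vec3:
  assumes "open N" "x \<in> N" "\<And>y. y \<in> N \<Longrightarrow> cdiff f1 y" "\<And>y. y \<in> N \<Longrightarrow> cdiff f2 y"
    "\<And>y. y \<in> N \<Longrightarrow> cdiff f3 y"
  shows "hol_at cspace cspace x (\<lambda>t. vector [f1 t, f2 t, f3 t] :: complex ^ 3)"
proof (rule hol_at_cspace_cspaceI[OF assms(1,2)])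
  fix y i assume "y \<in> N"
  then have "\<forall>i::3. cdiff (\<lambda>t. vector [f1 t, f2 t, f3 t] $ i) y" unfolding forall_3 using assms by simp
  then show "cdiff (\<lambda>t. (vector [f1 t, f2 t, f3 t] :: complex ^ 3) $ i) y" by blast
qed

lemma hol_at_vec4:
  assumes "open N" "x \<in> N" "\<And>y. y \<in> N \<Longrightarrow> cdiff f1 y" "\<And>y. y \<in> N \<Longrightarrow> cdiff f2 y"
    "\<And>y. y \<in> N \<Longrightarrow> cdiff f3 y" "\<And>y. y \<in> N \<Longrightarrow> cdiff f4 y"
  shows "hol_at cspace cspace x (\<lambda>t. vector [f1 t, f2 t, f3 t, f4 t] :: complex ^ 4)"
proof (rule hol_at_cspace_cspaceI[OF assms(1,2)])
  fix y i assume "y \<in> N"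
  then have "\<forall>i::4. cdiff (\<lambda>t. vector [f1 t, f2 t, f3 t, f4 t] $ i) y"
    unfolding forall_4 using assms by (simp del: One_nat_def)
  then show "cdiff (\<lambda>t. (vector [f1 t, f2 t, f3 t, f4 t] :: complex ^ 4) $ i) y" by blast
qed

section \<open>The affine line and descent along power maps\<close>

text \<open>One complex variable gets its own space instead of \<open>complex ^ 1\<close>, so that
  \<open>field_differentiable\<close> and the theorem on isolated singularities apply
  directly.\<close>

definition cline :: "complex fspace" where
  "cline = FSpace euclidean (\<lambda>U. {f. \<forall>x\<in>U. f field_differentiable at x})"

lemma fhol_cline: "f \<in> fhol cline U \<longleftrightarrow> (\<forall>x\<in>U. f field_differentiable at x)"
  by (simp add: cline_def)

lemma ftop_cline [simp]: "ftop cline = euclidean"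
  by (simp add: cline_def)

lemma sheafy_cline: "sheafy cline"
proof (rule sheafyI)
  fix U
  show "(\<lambda>_. 0) \<in> fhol cline U" by (simp add: fhol_cline)
next
  fix U f
  assume U: "fopen cline U" and loc: "\<And>x. x \<in> U \<Longrightarrow> \<exists>N. fopen cline N \<and> x \<in> N \<and>
    (\<exists>g\<in>fhol cline N. \<forall>y\<in>N \<inter> U. f y = g y)"
  show "f \<in> fhol cline U" unfolding fhol_cline
  proof
    fix x assume x: "x \<in> U"
    from loc[OF x] obtain N g where N: "fopen cline N" "x \<in> N" "g \<in> fhol cline N" "\<forall>y\<in>N \<inter> U. f y = g y"
      by (elim exE conjE bexE)
    have "g field_differentiable at x" using N(2,3) unfolding fhol_cline by (rule bspec[rotated])
    then obtain d where "(g has_field_derivative d) (at x)" unfolding field_differentiable_def ..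
    moreover have "open (N \<inter> U)" using N(1) U by (simp add: open_Int)
    ultimately have "(f has_field_derivative d) (at x)"
      by (rule has_field_derivative_transform_within_open) (use x N in simp_all)
    then show "f field_differentiable at x" unfolding field_differentiable_def ..
  qed
qed

lemma hol_at_cspace_clineI:
  assumes N: "open N" "x \<in> N" and L: "\<And>y. y \<in> N \<Longrightarrow> cdiff L y"
  shows "hol_at cspace cline x L"
proof (rule hol_at_pointwiseI[OF ftop_cspace ftop_cline fhol_cspace fhol_cline N])
  fix y assume y: "y \<in> N"
  then show "isCont L y" using L unfolding cdiff_def by (blast intro: has_derivative_continuous)
  show "cdiff (g \<circ> L) y" if "g field_differentiable at (L y)" for g
    using cdiff_compose[OF L[OF y] that] by (simp add: comp_def)
qed

lemma hol_at_cline_clineI: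
  assumes N: "open N" "x \<in> N" and L: "\<And>y. y \<in> N \<Longrightarrow> L field_differentiable at y"
  shows "hol_at cline cline x L"
  by (rule hol_at_pointwiseI[OF ftop_cline ftop_cline fhol_cline fhol_cline N])
    (auto intro: L field_differentiable_imp_continuous_at field_differentiable_compose)

lemma hol_at_cline_cspaceI:
  fixes L :: "complex \<Rightarrow> complex ^ 'm"
  assumes N: "open N" "x \<in> N" and L: "\<And>y i. y \<in> N \<Longrightarrow> (\<lambda>s. L s $ i) field_differentiable at y"
  shows "hol_at cline cspace x L"
proof (rule hol_at_pointwiseI[OF ftop_cline ftop_cspace fhol_cline fhol_cspace N])
  fix y assume y: "y \<in> N"
  obtain E where E: "\<And>i. ((\<lambda>s. L s $ i) has_field_derivative E i) (at y)"
    using L[OF y] unfolding field_differentiable_def by metis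
  have D: "(L has_derivative (\<lambda>h. h *s (\<chi> i. E i))) (at y)"
    unfolding has_derivative_componentwise_within[of L]
  proof
    fix b :: "complex ^ 'm" assume "b \<in> Basis"
    then obtain i u where b: "b = axis i u" "u \<in> Basis" by (auto simp: Basis_vec_def)
    have "((\<lambda>s. L s $ i \<bullet> u) has_derivative (\<lambda>h. (E i * h) \<bullet> u)) (at y)"
      by (intro has_derivative_inner_left has_field_derivative_imp_has_derivative E)
    then show "((\<lambda>s. L s \<bullet> b) has_derivative (\<lambda>h. (h *s (\<chi> i. E i)) \<bullet> b)) (at y)"
      by (simp add: b inner_axis mult.commute)
  qed
  then show "isCont L y" by (rule has_derivative_continuous)
  fix g :: "complex ^ 'm \<Rightarrow> complex" assume "cdiff g (L y)"
  then obtain F where F: "(g has_derivative F) (at (L y))" "\<And>c v. F (c *s v) = c * F v"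
    unfolding cdiff_def by blast
  have "(g \<circ> L has_derivative (\<lambda>h. F (\<chi> i. E i) * h)) (at y)"
    using diff_chain_at[OF D F(1)] F(2) by (simp add: comp_def mult.commute)
  then show "(g \<circ> L) field_differentiable at y"
    unfolding field_differentiable_def has_field_derivative_def by blast
qed

section \<open>Roots and descent along power maps\<close>

lemma complex_nth_root_exists:
  fixes s :: complex assumes "k > 0" obtains r where "r ^ k = s"
proof (cases "s = 0")
  case True then show ?thesis using that[of 0] assms by (simp add: power_0_left)
next
  case False
  then have "exp (Ln s / of_nat k) ^ k = s" using assms by (simp flip: exp_of_nat_mult)
  then show ?thesis by (rule that)
qed

text \<open>Dividing by \<open>s\<close> moves the slit of \<open>Ln\<close> away from
  \<open>s\<close>, and the factor \<open>r0\<close> selects the prescribed root.\<close>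

lemma root_branch:
  fixes s :: complex
  assumes "k > 0" "s \<noteq> 0" "r0 ^ k = s"
  obtains \<rho> N where "open N" "s \<in> N" "0 \<notin> N" "\<rho> s = r0"
    "\<And>y. y \<in> N \<Longrightarrow> \<rho> y ^ k = y" "\<And>y. y \<in> N \<Longrightarrow> \<rho> y \<noteq> 0" "\<And>y. y \<in> N \<Longrightarrow> \<rho> field_differentiable at y"
proof -
  define \<rho> where "\<rho> = (\<lambda>y. r0 * exp (Ln (y / s) / of_nat k))"
  define N where "N = (\<lambda>y. y / s) -` (- \<real>\<^sub>\<le>\<^sub>0)"
  have r0: "r0 \<noteq> 0" using assms by (auto simp: power_0_left)
  have oN: "open N" unfolding N_def
    using assms(2) by (intro open_vimage continuous_intros) (auto simp: open_Compl)
  show ?thesis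
  proof
    show "open N" by (fact oN)
    show "s \<in> N" "0 \<notin> N" "\<rho> s = r0" using assms by (auto simp: N_def \<rho>_def)
    fix y assume y: "y \<in> N"
    then have "y / s \<noteq> 0" by (auto simp: N_def)
    then show "\<rho> y ^ k = y" using assms
      by (simp add: \<rho>_def power_mult_distrib flip: exp_of_nat_mult)
    show "\<rho> y \<noteq> 0" using r0 by (simp add: \<rho>_def)
    have "\<rho> holomorphic_on N" unfolding \<rho>_def
      by (intro holomorphic_intros) (use assms in \<open>auto simp: N_def\<close>)
    then show "\<rho> field_differentiable at y"
      using y oN holomorphic_on_imp_differentiable_at by blast
  qed
qed

text \<open>Local form of a disc divided by a finite rotation group, with the power as coordinate.
  Away from \<open>0\<close> a root branch is composed with \<open>h\<close>. At \<open>0\<close>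
  branches fail, but \<open>g \<circ> f\<close> is continuous there, because roots of small numbers
  are small, and so the singularity is removable.\<close>

lemma hol_at_root_desc:
  assumes Y: "sheafy Y" and k: "k > 0" and D: "open D"
    and h: "\<And>x. x ^ k \<in> D \<Longrightarrow> hol_at cline Y x h" and fh: "\<And>x. x ^ k \<in> D \<Longrightarrow> f (x ^ k) = h x"
    and s: "s \<in> D"
  shows "hol_at cline Y s f"
proof -
  have nz: "hol_at cline Y s f" if s: "s \<in> D" "s \<noteq> 0" for s
  proof -
    obtain r0 where "r0 ^ k = s" by (rule complex_nth_root_exists[OF k])
    then obtain \<rho> N where \<rho>: "open N" "s \<in> N"
      "\<And>y. y \<in> N \<Longrightarrow> \<rho> y ^ k = y" "\<And>y. y \<in> N \<Longrightarrow> \<rho> field_differentiable at y"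
      by (rule root_branch[OF k s(2)]) blast
    show ?thesis
    proof (rule hol_at_comp'[OF sheafy_cline])
      show "hol_at cline cline s \<rho>" by (rule hol_at_cline_clineI[of N]) (use \<rho> in auto)
      show "hol_at cline Y (\<rho> s) h" by (rule h) (use \<rho> s in auto)
      show "fopen cline (N \<inter> D)" "s \<in> N \<inter> D" using \<rho> D s by auto
      show "f y = h (\<rho> y)" if "y \<in> N \<inter> D" for y using fh[of "\<rho> y"] \<rho>(3)[of y] that by auto
    qed
  qed
  show ?thesis
  proof (cases "s = 0")
    case False then show ?thesis using nz s by blast
  next
    case s0: True
    show ?thesis unfolding hol_at_def
    proof (intro conjI allI impI; (elim conjE)?)
      have h0: "hol_at cline Y 0 h" "f 0 = h 0" using h[of 0] fh[of 0] s s0 k by (simp_all add: power_0_left)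
      then show "s \<in> fpts cline" "f s \<in> fpts Y" using s0 by (auto simp: hol_at_def)
      fix V g assume V: "fopen Y V" "f s \<in> V" "g \<in> fhol Y V"
      have "h 0 \<in> V" using V(2) s0 h0(2) by simp
      from hol_atE[OF h0(1) V(1) this V(3)] obtain N where N': "fopen cline N" "0 \<in> N"
        "h ` N \<subseteq> V" "g \<circ> h \<in> fhol cline N" .
      then have N: "open N" "0 \<in> N" "h ` N \<subseteq> V" "\<And>x. x \<in> N \<Longrightarrow> (g \<circ> h) field_differentiable at x"
        by (simp_all add: fhol_cline)
      obtain d where d: "d > 0" "ball 0 d \<subseteq> N" using N by (meson open_contains_ball)
      obtain e where e: "e > 0" "ball 0 e \<subseteq> D" using D s s0 by (meson open_contains_ball)
      \<comment> \<open>The radius \<open>d ^ k\<close> forces every \<open>k\<close>-th root of a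
        point of \<open>B\<close> into the ball of radius \<open>d\<close>, hence into
        \<open>N\<close>.\<close>
      define B where "B = ball (0::complex) (min e (d ^ k))"
      have B: "open B" "0 \<in> B" using d e by (auto simp: B_def)
      have root: "x \<in> N \<and> x ^ k \<in> D" if "x ^ k \<in> B" for x
      proof -
        have "norm x ^ k < d ^ k" "x ^ k \<in> D" using that e by (auto simp: B_def norm_power)
        then show ?thesis using d by (auto intro!: subsetD[OF d(2)] dest: power_less_imp_less_base)
      qed
      have im: "f y \<in> V" if "y \<in> B" for y
      proof -
        obtain x where x: "x ^ k = y" by (rule complex_nth_root_exists[OF k])
        with root[of x] that N(3) fh[of x] show ?thesis by auto
      qed
      have BD: "B \<subseteq> D" using e by (auto simp: B_def)
      have fd: "(g \<circ> f) field_differentiable at y" if y: "y \<in> B - {0}" for y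
      proof -
        have "hol_at cline Y y f" "f y \<in> V" using nz im y BD by auto
        from hol_atE[OF this(1) V(1) this(2) V(3)] obtain N where
          "y \<in> N" "g \<circ> f \<in> fhol cline N" .
        then show ?thesis by (simp add: fhol_cline)
      qed
      then have holo: "(g \<circ> f) holomorphic_on (B - {0})"
        by (auto simp: holomorphic_on_def intro: field_differentiable_at_within)
      have "isCont (g \<circ> f) 0" unfolding continuous_at_eps_delta
      proof (intro allI impI)
        fix \<eta> :: real assume "\<eta> > 0"
        moreover have "isCont (g \<circ> h) 0" using N(2,4) field_differentiable_imp_continuous_at by blast
        ultimately obtain \<delta> where \<delta>: "\<delta> > 0" "\<And>x. norm x < \<delta> \<Longrightarrow> dist (g (h x)) (g (h 0)) < \<eta>"
          unfolding continuous_at_eps_delta by (auto simp: dist_norm)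
        obtain b where b: "b > 0" "ball 0 b \<subseteq> B" using B by (meson open_contains_ball)
        have "dist (g (f y)) (g (f 0)) < \<eta>" if y: "norm y < min b (\<delta> ^ k)" for y
        proof -
          obtain x where x: "x ^ k = y" by (rule complex_nth_root_exists[OF k])
          then have "norm x ^ k < \<delta> ^ k" using y by (auto simp: norm_power)
          then have "norm x < \<delta>" using \<delta>(1) by (auto dest: power_less_imp_less_base)
          moreover have "y \<in> B" using b y by auto
          ultimately show ?thesis using \<delta>(2)[of x] root[of x] fh[of x] x h0(2) by auto
        qed
        then show "\<exists>d>0. \<forall>x'. dist x' 0 < d \<longrightarrow> dist ((g \<circ> f) x') ((g \<circ> f) 0) < \<eta>"
          using b \<delta> by (intro exI[of _ "min b (\<delta> ^ k)"]) auto
      qed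
      then have "continuous_on B (g \<circ> f)"
        using fd field_differentiable_imp_continuous_at
        by (intro continuous_at_imp_continuous_on ballI) blast
      then have "(g \<circ> f) holomorphic_on B"
        by (rule no_isolated_singularity[OF _ holo B(1)]) auto
      then have "\<forall>x\<in>B. (g \<circ> f) field_differentiable at x"
        using B(1) holomorphic_on_imp_differentiable_at by blast
      with B im s0 show "\<exists>N. fopen cline N \<and> s \<in> N \<and> f ` N \<subseteq> V \<and> g \<circ> f \<in> fhol cline N"
        by (intro exI[of _ B]) (auto simp: fhol_cline)
    qed
  qed
qed

section \<open>Orbits and the points of the blow-up\<close>

lemma vector_3_eta [simp]: "vector [t $ 1, t $ 2, t $ 3] = (t :: 'a::zero ^ 3)"
  by (simp add: vec_eq_iff forall_3)

lemma vector_4_eta [simp]: "vector [t $ 1, t $ 2, t $ 3, t $ 4] = (t :: 'a::zero ^ 4)"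
  unfolding vec_eq_iff forall_4 by simp

lemma vector_2_eta [simp]: "vector [t $ 1, t $ 2] = (t :: 'a::zero ^ 2)"
  by (simp add: vec_eq_iff forall_2)

lemma vec4_eq_iff: "(s :: 'a ^ 4) = t \<longleftrightarrow> s $ 1 = t $ 1 \<and> s $ 2 = t $ 2 \<and> s $ 3 = t $ 3 \<and> s $ 4 = t $ 4"
  unfolding vec_eq_iff forall_4 ..

lemma vec3_eq_iff: "(s :: 'a ^ 3) = t \<longleftrightarrow> s $ 1 = t $ 1 \<and> s $ 2 = t $ 2 \<and> s $ 3 = t $ 3"
  unfolding vec_eq_iff forall_3 ..

lemma vec2_eq_iff: "(s :: 'a ^ 2) = t \<longleftrightarrow> s $ 1 = t $ 1 \<and> s $ 2 = t $ 2"
  unfolding vec_eq_iff forall_2 ..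

lemma worbit_eq_iff:
  "worbit w x = worbit w y \<longleftrightarrow> (\<exists>c. c \<noteq> 0 \<and> y = (\<chi> i. c ^ (w $ i) * x $ i))"
proof
  assume eq: "worbit w x = worbit w y"
  have "y \<in> worbit w y" unfolding worbit_def by (auto intro: exI[of _ 1] simp: vec_eq_iff)
  then show "\<exists>c. c \<noteq> 0 \<and> y = (\<chi> i. c ^ (w $ i) * x $ i)"
    unfolding eq[symmetric] by (auto simp: worbit_def)
next
  assume "\<exists>c. c \<noteq> 0 \<and> y = (\<chi> i. c ^ (w $ i) * x $ i)"
  then obtain c where c: "c \<noteq> 0" "y = (\<chi> i. c ^ (w $ i) * x $ i)" by blast
  show "worbit w x = worbit w y"
  proof (intro set_eqI iffI)
    fix t assume "t \<in> worbit w x"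
    then obtain d where "d \<noteq> 0" "t = (\<chi> i. d ^ (w $ i) * x $ i)" by (auto simp: worbit_def)
    with c show "t \<in> worbit w y" unfolding worbit_def
      by (auto intro!: exI[of _ "d / c"] simp: vec_eq_iff power_divide)
  next
    fix t assume "t \<in> worbit w y"
    then obtain d where "d \<noteq> 0" "t = (\<chi> i. d ^ (w $ i) * y $ i)" by (auto simp: worbit_def)
    with c show "t \<in> worbit w x" unfolding worbit_def
      by (auto intro!: exI[of _ "d * c"] simp: vec_eq_iff power_mult_distrib)
  qed
qed

lemma pt3245_eq_iff:
  "pt3245 x y z e = pt3245 x' y' z' e' \<longleftrightarrow>
     (\<exists>c. c \<noteq> 0 \<and> x' = c ^ 3 * x \<and> y' = c ^ 2 * y \<and> z' = c ^ 4 * z \<and> e' = c ^ 5 * e)"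
  unfolding pt3245_def worbit_eq_iff vec4_eq_iff by simp

lemma pt645_eq_iff:
  "pt645 x y z = pt645 x' y' z' \<longleftrightarrow>
     (\<exists>c. c \<noteq> 0 \<and> x' = c ^ 6 * x \<and> y' = c ^ 4 * y \<and> z' = c ^ 5 * z)"
  unfolding pt645_def worbit_eq_iff vec3_eq_iff by simp

lemma worbit_pt3245: "worbit w3245 t = pt3245 (t $ 1) (t $ 2) (t $ 3) (t $ 4)"
  by (simp add: pt3245_def)

text \<open>The orbit of \<open>(2, 1, 0, 0)\<close> is the cuspidal curve
  \<open>x^2 = 4 y^3\<close> without its cusp.\<close>

lemma pt3245_eq_p_iff: "pt3245 x y z e = p_pt \<longleftrightarrow> z = 0 \<and> e = 0 \<and> x ^ 2 = 4 * y ^ 3 \<and> y \<noteq> 0"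
proof
  assume "pt3245 x y z e = p_pt"
  then have "p_pt = pt3245 x y z e" ..
  then obtain c where c: "c \<noteq> 0" "x = c ^ 3 * 2" "y = c ^ 2" "z = 0" "e = 0"
    unfolding p_pt_def pt3245_eq_iff by auto
  then show "z = 0 \<and> e = 0 \<and> x ^ 2 = 4 * y ^ 3 \<and> y \<noteq> 0"
    by (simp add: power_mult_distrib flip: power_mult)
next
  assume a: "z = 0 \<and> e = 0 \<and> x ^ 2 = 4 * y ^ 3 \<and> y \<noteq> 0"
  \<comment> \<open>From \<open>x = 2 c^3\<close> and \<open>y = c^2\<close> the scaling factor is
    \<open>x / (2 y)\<close>.\<close>
  define c where "c = x / (2 * y)"
  have x0: "x \<noteq> 0" using a by auto
  have c2: "c ^ 2 = y" using a by (simp add: c_def power_divide power_mult_distrib power3_eq_cube power2_eq_square)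
  have c3: "c ^ 3 * 2 = x" using a c2 by (simp add: power3_eq_cube power2_eq_square c_def)
  have "c \<noteq> 0" using x0 a by (simp add: c_def)
  then have "p_pt = pt3245 x y z e" unfolding p_pt_def pt3245_eq_iff
    using a c2 c3 by (intro exI[of _ c]) auto
  then show "pt3245 x y z e = p_pt" ..
qed

lemma chart1_Inl: "t $ 1 \<noteq> 0 \<Longrightarrow> chart1 t = Inl (pt3245 (2 + t $ 1 ^ 6 + t $ 1 ^ 4 * t $ 2 / 2 - t $ 1 ^ 5 * t $ 3 / 2)
    1 (t $ 1 ^ 4 * t $ 2) (t $ 1 ^ 5 * t $ 3))"
  by (simp add: chart1_def uvw_pt_def Let_def)

lemma chart2_Inl: "t $ 2 \<noteq> 0 \<Longrightarrow> chart2 t = Inl (pt3245 (2 + t $ 2 ^ 6 * t $ 1 + t $ 2 ^ 4 / 2 - t $ 2 ^ 5 * t $ 3 / 2)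
    1 (t $ 2 ^ 4) (t $ 2 ^ 5 * t $ 3))"
  by (simp add: chart2_def uvw_pt_def Let_def)

lemma chart3_Inl: "t $ 3 \<noteq> 0 \<Longrightarrow> chart3 t = Inl (pt3245 (2 + t $ 3 ^ 6 * t $ 1 + t $ 3 ^ 4 * t $ 2 / 2 - t $ 3 ^ 5 / 2)
    1 (t $ 3 ^ 4 * t $ 2) (t $ 3 ^ 5))"
  by (simp add: chart3_def uvw_pt_def Let_def)

lemma chart1_Inr: "t $ 1 = 0 \<Longrightarrow> chart1 t = Inr (pt645 1 (t $ 2) (t $ 3))"
  by (simp add: chart1_def)

lemma chart2_Inr: "t $ 2 = 0 \<Longrightarrow> chart2 t = Inr (pt645 (t $ 1) 1 (t $ 3))"
  by (simp add: chart2_def)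

lemma chart3_Inr: "t $ 3 = 0 \<Longrightarrow> chart3 t = Inr (pt645 (t $ 1) (t $ 2) 1)"
  by (simp add: chart3_def)

text \<open>For \<open>v = w = 0\<close> the equation \<open>(2 + u)^2 = 4\<close> has, besides
  \<open>u = 0\<close>, the root \<open>u = -4\<close>: the points with \<open>X = 2\<close> and
  \<open>X = -2\<close> are the same.\<close>

lemma chart1_eq_p_iff: "chart1 t = Inl p_pt \<longleftrightarrow> t $ 1 ^ 6 = - 4 \<and> t $ 2 = 0 \<and> t $ 3 = 0"
proof (cases "t $ 1 = 0")
  case True then show ?thesis by (simp add: chart1_Inr)
next
  case False
  have "(2 + t $ 1 ^ 6) ^ 2 = 4 \<longleftrightarrow> t $ 1 ^ 6 * (t $ 1 ^ 6 + 4) = 0"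
    by (simp only: eq_iff_diff_eq_0[of _ 4]) (simp add: power2_eq_square algebra_simps)
  then show ?thesis using False
    by (auto simp: chart1_Inl pt3245_eq_p_iff eq_neg_iff_add_eq_0)
qed

lemma chart2_neq_p: "chart2 t \<noteq> Inl p_pt"
  by (cases "t $ 2 = 0") (auto simp: chart2_Inl chart2_Inr pt3245_eq_p_iff)

lemma chart3_neq_p: "chart3 t \<noteq> Inl p_pt"
  by (cases "t $ 3 = 0") (auto simp: chart3_Inl chart3_Inr pt3245_eq_p_iff)

lemma fpts_wproj [simp]: "fpts (wproj w) = worbit w ` (- {0})"
  by (simp add: wproj_def)

lemma image_case_sum_Plus: "case_sum f g ` (Inl ` A \<union> Inr ` B) = f ` A \<union> g ` B"
  by (simp add: image_Un image_image)

lemma fpts_M_I: "fpts M_I = Inl ` (worbit w3245 ` (- {0}) - {p_pt}) \<union> (range chart1 - {Inl p_pt}) \<union>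
    range chart2 \<union> range chart3"
proof -
  have 1: "chart1 ` {t. chart1 t \<noteq> Inl p_pt} = range chart1 - {Inl p_pt}" by auto
  have 3: "{t. chart2 t \<noteq> Inl p_pt} = UNIV" "{t. chart3 t \<noteq> Inl p_pt} = UNIV"
    using chart2_neq_p chart3_neq_p by blast+
  have 2: "A \<inter> - {p_pt} = A - {p_pt}" for A by auto
  show ?thesis
    unfolding M_I_def fpts_fquot fpts_fsum image_case_sum_Plus fpts_fsub fpts_cspace fpts_wproj Int_UNIV_left 1 2 3
    by (simp only: Un_assoc)
qed

lemma chart_in_M_I:
  "chart1 t \<noteq> Inl p_pt \<Longrightarrow> chart1 t \<in> fpts M_I" "chart2 t \<in> fpts M_I" "chart3 t \<in> fpts M_I"
  unfolding fpts_M_I by blast+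

lemma M_I_source_cases:
  assumes "m \<in> fpts M_I"
  obtains t where "t \<noteq> 0" "worbit w3245 t \<noteq> p_pt" "m = Inl (worbit w3245 t)"
  | t where "chart1 t \<noteq> Inl p_pt" "m = chart1 t" | t where "m = chart2 t" | t where "m = chart3 t"
proof -
  have "(\<exists>t. t \<noteq> 0 \<and> worbit w3245 t \<noteq> p_pt \<and> m = Inl (worbit w3245 t)) \<or>
    (\<exists>t. chart1 t \<noteq> Inl p_pt \<and> m = chart1 t) \<or> (\<exists>t. m = chart2 t) \<or> (\<exists>t. m = chart3 t)"
    using assms unfolding fpts_M_I by blast
  with that show ?thesis by blast
qed

text \<open>Serves to exclude the orbit of the zero vector, which is no point of the projective
  space.\<close>

lemma pt3245_zero: "pt3245 x y z e = pt3245 0 0 0 0 \<longleftrightarrow> x = 0 \<and> y = 0 \<and> z = 0 \<and> e = 0"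
  by (auto simp: pt3245_eq_iff)

lemma pt645_zero: "pt645 a b c = pt645 0 0 0 \<longleftrightarrow> a = 0 \<and> b = 0 \<and> c = 0"
  by (auto simp: pt645_eq_iff)

text \<open>The vectors with \<open>z = e = 0\<close> and \<open>x^2 = 4 y^3\<close> are the
  representatives of \<open>p\<close> and the zero vector, so a single condition excludes
  both.\<close>

lemma Inl_in_M_I_iff:
  "Inl (pt3245 x y z e) \<in> fpts M_I \<longleftrightarrow> (z \<noteq> 0 \<or> e \<noteq> 0 \<or> x ^ 2 \<noteq> 4 * y ^ 3)"
proof
  assume "Inl (pt3245 x y z e) \<in> fpts M_I"
  then consider t where "t \<noteq> 0" "worbit w3245 t \<noteq> p_pt" "pt3245 x y z e = worbit w3245 t"
    | t where "chart1 t \<noteq> Inl p_pt" "Inl (pt3245 x y z e) = chart1 t"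
    | t where "Inl (pt3245 x y z e) = chart2 t" | t where "Inl (pt3245 x y z e) = chart3 t"
    by (rule M_I_source_cases) simp_all
  then have "pt3245 x y z e \<noteq> p_pt \<and> pt3245 x y z e \<noteq> pt3245 0 0 0 0"
  proof cases
    case (1 t)
    then show ?thesis unfolding worbit_pt3245 by (metis pt3245_zero vec4_eq_iff zero_index)
  next
    case (2 t)
    then have "t $ 1 \<noteq> 0" using chart1_Inr[of t] by auto
    with 2 show ?thesis using chart1_Inl[of t] by (auto simp: pt3245_zero)
  next
    case (3 t)
    then have "t $ 2 \<noteq> 0" using chart2_Inr[of t] by auto
    with 3 show ?thesis using chart2_Inl[of t] chart2_neq_p[of t] by (auto simp: pt3245_zero)
  next
    case (4 t)
    then have "t $ 3 \<noteq> 0" using chart3_Inr[of t] by auto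
    with 4 show ?thesis using chart3_Inl[of t] chart3_neq_p[of t] by (auto simp: pt3245_zero)
  qed
  then have "pt3245 x y z e \<noteq> p_pt" "(x, y, z, e) \<noteq> (0, 0, 0, 0)" by auto
  then show "z \<noteq> 0 \<or> e \<noteq> 0 \<or> x ^ 2 \<noteq> 4 * y ^ 3" by (auto simp: pt3245_eq_p_iff)
next
  assume a: "z \<noteq> 0 \<or> e \<noteq> 0 \<or> x ^ 2 \<noteq> 4 * y ^ 3"
  have "vector [x, y, z, e] \<noteq> (0 :: complex ^ 4)" "pt3245 x y z e \<noteq> p_pt"
    using a by (auto simp: vec4_eq_iff pt3245_eq_p_iff)
  then show "Inl (pt3245 x y z e) \<in> fpts M_I"
    unfolding fpts_M_I by (simp add: pt3245_def)
qed

text \<open>A nonzero coordinate is normalised to \<open>1\<close> by a root of its inverse, which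
  puts the point into the corresponding chart.\<close>

lemma Inr_in_M_I_iff: "Inr (pt645 a b c) \<in> fpts M_I \<longleftrightarrow> (a, b, c) \<noteq> (0, 0, 0)"
proof
  assume "Inr (pt645 a b c) \<in> fpts M_I"
  then consider t where "Inr (pt645 a b c) = chart1 t"
    | t where "Inr (pt645 a b c) = chart2 t" | t where "Inr (pt645 a b c) = chart3 t"
    by (rule M_I_source_cases) simp_all
  then have "pt645 a b c \<noteq> pt645 0 0 0"
  proof cases
    case (1 t)
    have "t $ 1 = 0" by (rule ccontr) (use 1 chart1_Inl[of t] in simp)
    with 1 show ?thesis using chart1_Inr[of t] by (auto simp: pt645_zero)
  next
    case (2 t)
    have "t $ 2 = 0" by (rule ccontr) (use 2 chart2_Inl[of t] in simp)
    with 2 show ?thesis using chart2_Inr[of t] by (auto simp: pt645_zero)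
  next
    case (3 t)
    have "t $ 3 = 0" by (rule ccontr) (use 3 chart3_Inl[of t] in simp)
    with 3 show ?thesis using chart3_Inr[of t] by (auto simp: pt645_zero)
  qed
  then show "(a, b, c) \<noteq> (0, 0, 0)" by auto
next
  assume "(a, b, c) \<noteq> (0, 0, 0)"
  then consider "a \<noteq> 0" | "b \<noteq> 0" | "c \<noteq> 0" by auto
  then show "Inr (pt645 a b c) \<in> fpts M_I"
  proof cases
    case 1
    obtain r where r: "r ^ 6 = 1 / a" by (rule complex_nth_root_exists[of 6]) auto
    then have "pt645 a b c = pt645 1 (r ^ 4 * b) (r ^ 5 * c)"
      unfolding pt645_eq_iff using 1 by (intro exI[of _ r]) auto
    then have "Inr (pt645 a b c) = chart1 (vector [0, r ^ 4 * b, r ^ 5 * c])" by (simp add: chart1_Inr)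
    then show ?thesis using chart_in_M_I(1)[of "vector [0, r ^ 4 * b, r ^ 5 * c]"]
      by (simp add: chart1_eq_p_iff)
  next
    case 2
    obtain r where r: "r ^ 4 = 1 / b" by (rule complex_nth_root_exists[of 4]) auto
    then have "pt645 a b c = pt645 (r ^ 6 * a) 1 (r ^ 5 * c)"
      unfolding pt645_eq_iff using 2 by (intro exI[of _ r]) auto
    then have "Inr (pt645 a b c) = chart2 (vector [r ^ 6 * a, 0, r ^ 5 * c])" by (simp add: chart2_Inr)
    then show ?thesis using chart_in_M_I(2)[of "vector [r ^ 6 * a, 0, r ^ 5 * c]"] by simp
  next
    case 3
    obtain r where r: "r ^ 5 = 1 / c" by (rule complex_nth_root_exists[of 5]) auto
    then have "pt645 a b c = pt645 (r ^ 6 * a) (r ^ 4 * b) 1"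
      unfolding pt645_eq_iff using 3 by (intro exI[of _ r]) auto
    then have "Inr (pt645 a b c) = chart3 (vector [r ^ 6 * a, r ^ 4 * b, 0])" by (simp add: chart3_Inr)
    then show ?thesis using chart_in_M_I(3)[of "vector [r ^ 6 * a, r ^ 4 * b, 0]"] by simp
  qed
qed

lemma M_I_cases:
  assumes "m \<in> fpts M_I"
  obtains x y z e where "m = Inl (pt3245 x y z e)" "z \<noteq> 0 \<or> e \<noteq> 0 \<or> x ^ 2 \<noteq> 4 * y ^ 3"
  | a b c where "m = Inr (pt645 a b c)" "(a, b, c) \<noteq> (0, 0, 0)"
proof -
  have "(\<exists>x y z e. m = Inl (pt3245 x y z e)) \<or> (\<exists>a b c. m = Inr (pt645 a b c))"
    using assms
  proof (cases rule: M_I_source_cases)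
    case 1 then show ?thesis unfolding worbit_pt3245 by blast
  next
    case (2 t) then show ?thesis using chart1_Inl[of t] chart1_Inr[of t] by (cases "t $ 1 = 0") auto
  next
    case (3 t) then show ?thesis using chart2_Inl[of t] chart2_Inr[of t] by (cases "t $ 2 = 0") auto
  next
    case (4 t) then show ?thesis using chart3_Inl[of t] chart3_Inr[of t] by (cases "t $ 3 = 0") auto
  qed
  then show ?thesis
  proof (elim disjE exE)
    fix x y z e assume "m = Inl (pt3245 x y z e)"
    with assms that(1)[OF this] show ?thesis by (simp add: Inl_in_M_I_iff)
  next
    fix a b c assume "m = Inr (pt645 a b c)"
    with assms that(2)[OF this] show ?thesis by (simp add: Inr_in_M_I_iff)
  qed
qed

section \<open>Open sets of the blow-up, maps into it and maps out of it\<close>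

lemma sheafy_wproj: "sheafy (wproj w)"
  unfolding wproj_def by (intro sheafy_fquot sheafy_fsub sheafy_cspace)

lemma sheafy_M_I: "sheafy M_I"
  unfolding M_I_def by (intro sheafy_fquot sheafy_fsum sheafy_fsub sheafy_cspace sheafy_wproj)

lemma openin_wprojI:
  assumes "U \<subseteq> fpts (wproj w)" "open {t. t \<noteq> 0 \<and> worbit w t \<in> U}"
  shows "fopen (wproj w) U"
  unfolding wproj_def openin_fquot openin_fsub
  using assms by (auto intro!: exI[of _ "{t. t \<noteq> 0 \<and> worbit w t \<in> U}"])

text \<open>As \<open>p\<close> is not a point of the blow-up, the restrictions on the chart domains
  drop out, and openness is tested on four subsets of affine spaces.\<close>

lemma openin_M_I:
  assumes sub: "U \<subseteq> fpts M_I" and C0: "open {t. t \<noteq> 0 \<and> Inl (worbit w3245 t) \<in> U}"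
    and C: "open {t. chart1 t \<in> U}" "open {t. chart2 t \<in> U}" "open {t. chart3 t \<in> U}"
  shows "fopen M_I U"
proof -
  have p: "Inl p_pt \<notin> U" using sub Inl_in_M_I_iff[of 2 1 0 0] by (auto simp: p_pt_def)
  have 0: "fopen (fsub (wproj w3245) (- {p_pt})) {x \<in> fpts (fsub (wproj w3245) (- {p_pt})). Inl x \<in> U}"
    unfolding openin_fsub
  proof (intro exI conjI)
    have "{t. t \<noteq> 0 \<and> worbit w3245 t \<in> {\<xi> \<in> fpts (wproj w3245). Inl \<xi> \<in> U}} =
      {t. t \<noteq> 0 \<and> Inl (worbit w3245 t) \<in> U}" by auto
    then show "fopen (wproj w3245) {\<xi> \<in> fpts (wproj w3245). Inl \<xi> \<in> U}"
      using C0 by (intro openin_wprojI) auto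
  qed auto
  have ch: "fopen (chart_dom ch) {x \<in> fpts (chart_dom ch). ch x \<in> U}"
    if "open {t. ch t \<in> U}" for ch
    unfolding openin_fsub using that p by (intro exI[of _ "{t. ch t \<in> U}"]) auto
  have "U \<subseteq> fpts M_I" by (fact sub)
  then show ?thesis
    unfolding M_I_def openin_fquot fpts_fquot openin_fsum
    using 0 ch[OF C(1)] ch[OF C(2)] ch[OF C(3)] by (simp add: vimage_def fpts_fsum image_iff)
qed

lemma hol_at_wproj_desc:
  assumes "sheafy Y" "fopen (wproj w) U"
    and "\<And>t. t \<noteq> 0 \<Longrightarrow> worbit w t \<in> U \<Longrightarrow> hol_at cspace Y t (\<lambda>t. f (worbit w t))"
    and "q \<in> U"
  shows "hol_at (wproj w) Y q f"
  using assms(2,4) unfolding wproj_def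
  by (intro hol_at_fquot_desc[OF sheafy_fsub[OF sheafy_cspace] assms(1)] hol_at_fsub_dom)
    (auto simp: comp_def intro: assms(3))

lemma hol_at_worbit: "t \<noteq> 0 \<Longrightarrow> hol_at cspace (wproj w) t (worbit w)"
proof -
  assume t: "t \<noteq> 0"
  have "hol_at cspace cspace t (\<lambda>t. t)" by (rule hol_at_cspace_cspaceI[of UNIV]) auto
  then have "hol_at cspace (fsub cspace (- {0})) t (\<lambda>t. t)"
    by (rule hol_at_fsub_cod[OF sheafy_cspace sheafy_cspace, of _ _ "- {0}"]) (use t in \<open>auto simp: open_Compl\<close>)
  from hol_at_comp[OF this hol_at_fquot_proj[of t "fsub cspace (- {0})" "worbit w"]] t
  show ?thesis by (simp add: wproj_def comp_def)
qed

lemma hol_at_ident: "hol_at cspace cspace t (\<lambda>t. t)"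
  by (rule hol_at_cspace_cspaceI[of UNIV]) auto

lemma hol_at_M_I_worbit:
  assumes "t $ 3 \<noteq> 0 \<or> t $ 4 \<noteq> 0 \<or> t $ 1 ^ 2 \<noteq> 4 * t $ 2 ^ 3"
  shows "hol_at cspace M_I t (\<lambda>t. Inl (worbit w3245 t))"
proof -
  let ?N = "{t :: complex ^ 4. t $ 3 \<noteq> 0 \<or> t $ 4 \<noteq> 0 \<or> t $ 1 ^ 2 \<noteq> 4 * t $ 2 ^ 3}"
  have t: "t \<noteq> 0" using assms by auto
  have N: "open ?N" by (intro open_Collect_disj open_Collect_neq continuous_intros)
  have "hol_at cspace (fsub (wproj w3245) (- {p_pt})) t (worbit w3245)"
    by (rule hol_at_fsub_cod[OF sheafy_cspace sheafy_wproj hol_at_worbit[OF t], of ?N])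
      (use N assms in \<open>auto simp: worbit_pt3245 pt3245_eq_p_iff\<close>)
  note h = hol_at_comp[OF this hol_at_Inl[OF hol_at_pts(2)[OF this]]]
  note r = hol_at_comp[OF h hol_at_fquot_proj[OF hol_at_pts(2)[OF h],
    where \<pi> = "case_sum Inl (case_sum chart1 (case_sum chart2 chart3))"]]
  show ?thesis unfolding M_I_def by (rule r[unfolded comp_def, simplified])
qed

lemma hol_at_M_I_Inl:
  assumes "open N" "s \<in> N" "\<And>y. y \<in> N \<Longrightarrow> cdiff a y" "\<And>y. y \<in> N \<Longrightarrow> cdiff b y"
    "\<And>y. y \<in> N \<Longrightarrow> cdiff c y" "\<And>y. y \<in> N \<Longrightarrow> cdiff d y"
    and "c s \<noteq> 0 \<or> d s \<noteq> 0 \<or> a s ^ 2 \<noteq> 4 * b s ^ 3"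
  shows "hol_at cspace M_I s (\<lambda>t. Inl (pt3245 (a t) (b t) (c t) (d t)))"
proof -
  have "hol_at cspace cspace s (\<lambda>t. vector [a t, b t, c t, d t] :: complex ^ 4)"
    by (rule hol_at_vec4[OF assms(1-6)])
  from hol_at_comp[OF this hol_at_M_I_worbit] assms(7)
  show ?thesis by (simp add: comp_def worbit_pt3245)
qed

lemma open_chart1_dom: "open {t. chart1 t \<noteq> Inl p_pt}"
proof -
  have "{t. chart1 t \<noteq> Inl p_pt} = {t. t $ 1 ^ 6 \<noteq> - 4 \<or> t $ 2 \<noteq> 0 \<or> t $ 3 \<noteq> 0}"
    by (auto simp: chart1_eq_p_iff)
  also have "open \<dots>" by (intro open_Collect_disj open_Collect_neq continuous_intros)
  finally show ?thesis .
qed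

lemma hol_at_chart_dom:
  assumes "open {t. ch t \<noteq> Inl p_pt}" "ch t \<noteq> Inl p_pt"
  shows "hol_at cspace (chart_dom ch) t (\<lambda>t. t)"
  by (rule hol_at_fsub_cod[OF sheafy_cspace sheafy_cspace hol_at_ident, of "{t. ch t \<noteq> Inl p_pt}"])
    (use assms in auto)

lemma hol_at_chart1: assumes "chart1 t \<noteq> Inl p_pt" shows "hol_at cspace M_I t chart1"
proof -
  note h1 = hol_at_chart_dom[OF open_chart1_dom assms]
  note h2 = hol_at_comp[OF h1 hol_at_Inl[OF hol_at_pts(2)[OF h1]]]
  note h3 = hol_at_comp[OF h2 hol_at_Inr[OF hol_at_pts(2)[OF h2]]]
  note r = hol_at_comp[OF h3 hol_at_fquot_proj[OF hol_at_pts(2)[OF h3],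
    where \<pi> = "case_sum Inl (case_sum chart1 (case_sum chart2 chart3))"]]
  show ?thesis unfolding M_I_def by (rule r[unfolded comp_def, simplified])
qed

lemma hol_at_chart2: "hol_at cspace M_I t chart2"
proof -
  have "open {t. chart2 t \<noteq> Inl p_pt}" by (simp add: chart2_neq_p)
  note h1 = hol_at_chart_dom[OF this chart2_neq_p]
  note h2 = hol_at_comp[OF h1 hol_at_Inl[OF hol_at_pts(2)[OF h1]]]
  note h3 = hol_at_comp[OF h2 hol_at_Inr[OF hol_at_pts(2)[OF h2]]]
  note h4 = hol_at_comp[OF h3 hol_at_Inr[OF hol_at_pts(2)[OF h3]]]
  note r = hol_at_comp[OF h4 hol_at_fquot_proj[OF hol_at_pts(2)[OF h4],
    where \<pi> = "case_sum Inl (case_sum chart1 (case_sum chart2 chart3))"]]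
  show ?thesis unfolding M_I_def by (rule r[unfolded comp_def, simplified])
qed

lemma hol_at_chart3: "hol_at cspace M_I t chart3"
proof -
  have "open {t. chart3 t \<noteq> Inl p_pt}" by (simp add: chart3_neq_p)
  note h1 = hol_at_chart_dom[OF this chart3_neq_p]
  note h2 = hol_at_comp[OF h1 hol_at_Inr[OF hol_at_pts(2)[OF h1]]]
  note h3 = hol_at_comp[OF h2 hol_at_Inr[OF hol_at_pts(2)[OF h2]]]
  note h4 = hol_at_comp[OF h3 hol_at_Inr[OF hol_at_pts(2)[OF h3]]]
  note r = hol_at_comp[OF h4 hol_at_fquot_proj[OF hol_at_pts(2)[OF h4],
    where \<pi> = "case_sum Inl (case_sum chart1 (case_sum chart2 chart3))"]]
  show ?thesis unfolding M_I_def by (rule r[unfolded comp_def, simplified])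
qed

text \<open>Away from the exceptional divisor the charts factor through the projective space, so only
  their points on the divisor have to be checked.\<close>

lemma hol_at_M_I_desc:
  assumes Y: "sheafy Y" and U: "fopen M_I U"
    and C0: "\<And>t. t \<noteq> 0 \<Longrightarrow> Inl (worbit w3245 t) \<in> U \<Longrightarrow> hol_at cspace Y t (\<lambda>t. f (Inl (worbit w3245 t)))"
    and C1: "\<And>t. chart1 t \<in> U \<Longrightarrow> t $ 1 = 0 \<Longrightarrow> hol_at cspace Y t (\<lambda>t. f (chart1 t))"
    and C2: "\<And>t. chart2 t \<in> U \<Longrightarrow> t $ 2 = 0 \<Longrightarrow> hol_at cspace Y t (\<lambda>t. f (chart2 t))"
    and C3: "\<And>t. chart3 t \<in> U \<Longrightarrow> t $ 3 = 0 \<Longrightarrow> hol_at cspace Y t (\<lambda>t. f (chart3 t))"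
    and m: "m \<in> U"
  shows "hol_at M_I Y m f"
proof -
  have sub: "U \<subseteq> fpts M_I" by (rule openin_subset[OF U])
  \<comment> \<open>Off the exceptional divisor a chart is \<open>worbit\<close> after a polynomial
    map \<open>P\<close>, so \<open>C0\<close> can be pulled back along \<open>P\<close>.\<close>
  have red: "hol_at cspace Y t (\<lambda>t. f (ch t))"
    if N: "open N" "t \<in> N" and P: "hol_at cspace cspace t P" and eq: "\<And>s. s \<in> N \<Longrightarrow> ch s = Inl (worbit w3245 (P s))"
      and chU: "ch t \<in> U" and P0: "P t \<noteq> 0" for ch P N and t :: "complex ^ 3"
    by (rule hol_at_comp'[OF sheafy_cspace P, of _ "\<lambda>t. f (Inl (worbit w3245 t))" N])
      (use C0[of "P t"] chU P0 N eq in auto)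
  have c1: "hol_at cspace Y t (\<lambda>t. f (chart1 t))" if t: "chart1 t \<in> U" for t
  proof (cases "t $ 1 = 0")
    case False
    let ?P = "\<lambda>t :: complex ^ 3. vector [2 + t $ 1 ^ 6 + t $ 1 ^ 4 * t $ 2 / 2 - t $ 1 ^ 5 * t $ 3 / 2,
      1, t $ 1 ^ 4 * t $ 2, t $ 1 ^ 5 * t $ 3] :: complex ^ 4"
    show ?thesis
    proof (rule red[where N = "{s. s $ 1 \<noteq> 0}" and P = ?P])
      show "hol_at cspace cspace t ?P" by (rule hol_at_vec4[of UNIV]; (intro cdiff_intros)?) auto
    qed (use False t in \<open>auto simp: chart1_Inl worbit_pt3245 vec4_eq_iff intro!: open_Collect_neq continuous_intros\<close>)
  qed (use C1 t in auto)
  have c2: "hol_at cspace Y t (\<lambda>t. f (chart2 t))" if t: "chart2 t \<in> U" for t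
  proof (cases "t $ 2 = 0")
    case False
    let ?P = "\<lambda>t :: complex ^ 3. vector [2 + t $ 2 ^ 6 * t $ 1 + t $ 2 ^ 4 / 2 - t $ 2 ^ 5 * t $ 3 / 2,
      1, t $ 2 ^ 4, t $ 2 ^ 5 * t $ 3] :: complex ^ 4"
    show ?thesis
    proof (rule red[where N = "{s. s $ 2 \<noteq> 0}" and P = ?P])
      show "hol_at cspace cspace t ?P" by (rule hol_at_vec4[of UNIV]; (intro cdiff_intros)?) auto
    qed (use False t in \<open>auto simp: chart2_Inl worbit_pt3245 vec4_eq_iff intro!: open_Collect_neq continuous_intros\<close>)
  qed (use C2 t in auto)
  have c3: "hol_at cspace Y t (\<lambda>t. f (chart3 t))" if t: "chart3 t \<in> U" for t
  proof (cases "t $ 3 = 0")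
    case False
    let ?P = "\<lambda>t :: complex ^ 3. vector [2 + t $ 3 ^ 6 * t $ 1 + t $ 3 ^ 4 * t $ 2 / 2 - t $ 3 ^ 5 / 2,
      1, t $ 3 ^ 4 * t $ 2, t $ 3 ^ 5] :: complex ^ 4"
    show ?thesis
    proof (rule red[where N = "{s. s $ 3 \<noteq> 0}" and P = ?P])
      show "hol_at cspace cspace t ?P" by (rule hol_at_vec4[of UNIV]; (intro cdiff_intros)?) auto
    qed (use False t in \<open>auto simp: chart3_Inl worbit_pt3245 vec4_eq_iff intro!: open_Collect_neq continuous_intros\<close>)
  qed (use C3 t in auto)
  let ?p = "case_sum Inl (case_sum chart1 (case_sum chart2 chart3)) :: _ \<Rightarrow> mpoint"
  let ?W = "fsub (wproj w3245) (- {p_pt})"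
  let ?R3 = "chart_dom chart2 \<oplus>\<^sub>f chart_dom chart3"
  let ?R2 = "chart_dom chart1 \<oplus>\<^sub>f ?R3"
  note sh = sheafy_fsum sheafy_fsub sheafy_cspace sheafy_wproj
  have main: "hol_at (?W \<oplus>\<^sub>f ?R2) Y x (f \<circ> ?p)" if x: "x \<in> fpts (?W \<oplus>\<^sub>f ?R2)" and pU: "?p x \<in> U" for x
  proof -
    consider (0) \<xi> where "x = Inl \<xi>" "\<xi> \<in> fpts ?W" | (1) t where "x = Inr (Inl t)"
      | (2) t where "x = Inr (Inr (Inl t))" | (3) t where "x = Inr (Inr (Inr t))"
      using x unfolding fpts_fsum by blast
    then show ?thesis
    proof cases
      case 0
      have p: "Inl p_pt \<notin> U" using sub Inl_in_M_I_iff[of 2 1 0 0] by (auto simp: p_pt_def)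
      have "fopen ?W {\<xi> \<in> fpts ?W. Inl \<xi> \<in> U}"
        using U unfolding M_I_def openin_fquot openin_fsum by (simp add: vimage_def fpts_fsum image_iff)
      then obtain T where T: "fopen (wproj w3245) T" "{\<xi> \<in> fpts ?W. Inl \<xi> \<in> U} = T \<inter> - {p_pt}"
        unfolding openin_fsub by blast
      \<comment> \<open>The point \<open>p\<close> is closed. Hence \<open>T\<close> without
        \<open>p\<close> is open in the projective space itself, which is what
        \<open>hol_at_wproj_desc\<close> asks for.\<close>
      have "fopen (wproj w3245) (fpts (wproj w3245) - {p_pt})"
      proof (rule openin_wprojI)
        have "{t. t \<noteq> 0 \<and> worbit w3245 t \<in> fpts (wproj w3245) - {p_pt}} = {t. t \<noteq> 0 \<and> worbit w3245 t \<noteq> p_pt}"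
          by auto
        also have "\<dots> = {t. t $ 3 \<noteq> 0 \<or> t $ 4 \<noteq> 0 \<or> t $ 1 ^ 2 \<noteq> 4 * t $ 2 ^ 3}"
          unfolding worbit_pt3245 pt3245_eq_p_iff vec4_eq_iff zero_index by (intro Collect_cong) auto
        also have "open \<dots>" by (intro open_Collect_disj open_Collect_neq continuous_intros)
        finally show "open {t. t \<noteq> 0 \<and> worbit w3245 t \<in> fpts (wproj w3245) - {p_pt}}" .
      qed auto
      with T(1) have "fopen (wproj w3245) (T \<inter> (fpts (wproj w3245) - {p_pt}))" by (rule openin_Int)
      also have "T \<inter> (fpts (wproj w3245) - {p_pt}) = T \<inter> - {p_pt}"
        using openin_subset[OF T(1)] by blast
      finally have o: "fopen (wproj w3245) {\<xi> \<in> fpts ?W. Inl \<xi> \<in> U}" unfolding T(2) .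
      have "hol_at (wproj w3245) Y \<xi> (\<lambda>\<xi>. f (Inl \<xi>))"
        by (rule hol_at_wproj_desc[OF Y o]) (use C0 0 pU in auto)
      then show ?thesis unfolding 0
        by (intro hol_at_fsum_Inl hol_at_fsub_dom sh) (use 0 in \<open>auto simp: comp_def\<close>)
    next
      case (1 t)
      show ?thesis unfolding 1
        by (intro hol_at_fsum_Inr hol_at_fsum_Inl hol_at_fsub_dom sh)
          (use c1[of t] pU x 1 in \<open>auto simp: comp_def fpts_fsum\<close>)
    next
      case (2 t)
      show ?thesis unfolding 2
        by (intro hol_at_fsum_Inr hol_at_fsum_Inl hol_at_fsub_dom sh)
          (use c2[of t] pU x 2 in \<open>auto simp: comp_def fpts_fsum\<close>)
    next
      case (3 t)
      show ?thesis unfolding 3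
        by (intro hol_at_fsum_Inr hol_at_fsum_Inl hol_at_fsub_dom sh)
          (use c3[of t] pU x 3 in \<open>auto simp: comp_def fpts_fsum\<close>)
    qed
  qed
  have "sheafy (?W \<oplus>\<^sub>f ?R2)" by (intro sh)
  then show ?thesis
    using hol_at_fquot_desc[OF _ Y, of "?W \<oplus>\<^sub>f ?R2" ?p U f m] U m main unfolding M_I_def by blast
qed

section \<open>The three pieces\<close>

definition painleve_part :: "mpoint set" where
  "painleve_part = {Inl (pt3245 x y z 1) | x y z. True} \<union> {Inr (pt645 a b 1) | a b. True}"

text \<open>In the first chart the line is \<open>v1 = w1 = 0\<close>, so \<open>q\<close> is the
  point in which its strict transform meets the exceptional divisor.\<close>

definition line_part :: "mpoint set" where
  "line_part = {Inl (pt3245 x y 0 0) | x y. x ^ 2 \<noteq> 4 * y ^ 3} \<union> {q_pt}"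

lemma q_pt_eq: "q_pt = Inr (pt645 1 0 0)"
  by (simp add: q_pt_def chart1_Inr)

lemma Inl_in_painleve_part: "Inl (pt3245 x y z e) \<in> painleve_part \<longleftrightarrow> e \<noteq> 0"
proof
  assume "Inl (pt3245 x y z e) \<in> painleve_part"
  then obtain x' y' z' where "pt3245 x y z e = pt3245 x' y' z' 1" by (auto simp: painleve_part_def)
  then show "e \<noteq> 0" unfolding pt3245_eq_iff by auto
next
  assume e: "e \<noteq> 0"
  obtain r where r: "r ^ 5 = 1 / e" by (rule complex_nth_root_exists[of 5]) auto
  then have "pt3245 x y z e = pt3245 (r ^ 3 * x) (r ^ 2 * y) (r ^ 4 * z) 1"
    unfolding pt3245_eq_iff using e by (intro exI[of _ r]) auto
  then show "Inl (pt3245 x y z e) \<in> painleve_part" unfolding painleve_part_def by blast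
qed

lemma Inr_in_painleve_part: "Inr (pt645 a b c) \<in> painleve_part \<longleftrightarrow> c \<noteq> 0"
proof
  assume "Inr (pt645 a b c) \<in> painleve_part"
  then obtain a' b' where "pt645 a b c = pt645 a' b' 1" by (auto simp: painleve_part_def)
  then show "c \<noteq> 0" unfolding pt645_eq_iff by auto
next
  assume c: "c \<noteq> 0"
  obtain r where r: "r ^ 5 = 1 / c" by (rule complex_nth_root_exists[of 5]) auto
  then have "pt645 a b c = pt645 (r ^ 6 * a) (r ^ 4 * b) 1"
    unfolding pt645_eq_iff using c by (intro exI[of _ r]) auto
  then show "Inr (pt645 a b c) \<in> painleve_part" unfolding painleve_part_def by blast
qed

text \<open>The vectors with \<open>b = c = 0\<close> form a single orbit, that of
  \<open>(1, 0, 0)\<close>, by a sixth root of \<open>1 / a\<close>; this orbit is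
  \<open>q\<close>.\<close>

lemma Inr_in_ell_base: "Inr (pt645 a b c) \<in> ell_base \<longleftrightarrow> b \<noteq> 0 \<and> c = 0"
proof
  assume *: "Inr (pt645 a b c) \<in> ell_base"
  then obtain a' b' where "pt645 a b c = pt645 a' b' 0" "(a', b') \<noteq> (0, 0)"
    unfolding ell_base_def CP1_64_def by auto
  then have c: "c = 0" "a \<noteq> 0 \<or> b \<noteq> 0" unfolding pt645_eq_iff by auto
  have "b \<noteq> 0"
  proof
    assume b: "b = 0"
    with c have a: "a \<noteq> 0" by simp
    obtain r where r: "r ^ 6 = 1 / a" by (rule complex_nth_root_exists[of 6]) auto
    then have "pt645 a b c = pt645 1 0 0"
      unfolding pt645_eq_iff using a b c by (intro exI[of _ r]) auto
    with * show False by (simp add: ell_base_def q_pt_eq)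
  qed
  with c show "b \<noteq> 0 \<and> c = 0" by simp
next
  assume a: "b \<noteq> 0 \<and> c = 0"
  then have "pt645 a b c \<noteq> pt645 1 0 0" unfolding pt645_eq_iff by auto
  with a show "Inr (pt645 a b c) \<in> ell_base" unfolding ell_base_def CP1_64_def q_pt_eq by auto
qed

lemma Inl_notin_ell_base: "Inl \<xi> \<notin> ell_base"
  by (auto simp: ell_base_def CP1_64_def)

lemma Inr_in_ell_total: "Inr (pt645 a b c) \<in> ell_total \<longleftrightarrow> b \<noteq> 0 \<and> c = 0"
  using Inr_in_ell_base[of a b c] by (auto simp: ell_total_def)

lemma Inl_in_ell_total: "Inl (pt3245 x y z e) \<in> ell_total \<longleftrightarrow> z \<noteq> 0 \<and> e = 0"
proof
  assume "Inl (pt3245 x y z e) \<in> ell_total"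
  then obtain x' y' where "pt3245 x y z e = pt3245 x' y' 1 0"
    using Inl_notin_ell_base by (auto simp: ell_total_def)
  then show "z \<noteq> 0 \<and> e = 0" unfolding pt3245_eq_iff by auto
next
  assume z: "z \<noteq> 0 \<and> e = 0"
  obtain r where r: "r ^ 4 = 1 / z" by (rule complex_nth_root_exists[of 4]) auto
  then have "pt3245 x y z e = pt3245 (r ^ 3 * x) (r ^ 2 * y) 1 0"
    unfolding pt3245_eq_iff using z by (intro exI[of _ r]) auto
  then show "Inl (pt3245 x y z e) \<in> ell_total" unfolding ell_total_def by blast
qed

text \<open>The inequality is well defined on orbits because \<open>x^2\<close> and
  \<open>y^3\<close> both have weight \<open>6\<close>.\<close>

lemma Inl_in_line_part: "Inl (pt3245 x y z e) \<in> line_part \<longleftrightarrow> z = 0 \<and> e = 0 \<and> x ^ 2 \<noteq> 4 * y ^ 3"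
proof
  assume "Inl (pt3245 x y z e) \<in> line_part"
  then obtain x' y' where "x' ^ 2 \<noteq> 4 * y' ^ 3" "pt3245 x y z e = pt3245 x' y' 0 0"
    by (auto simp: line_part_def q_pt_eq)
  then show "z = 0 \<and> e = 0 \<and> x ^ 2 \<noteq> 4 * y ^ 3"
    unfolding pt3245_eq_iff by (auto simp: power_mult_distrib simp flip: power_mult)
qed (auto simp: line_part_def)

lemma Inr_in_line_part: "Inr (pt645 a b c) \<in> line_part \<longleftrightarrow> a \<noteq> 0 \<and> b = 0 \<and> c = 0"
proof
  assume "Inr (pt645 a b c) \<in> line_part"
  then have "pt645 a b c = pt645 1 0 0" by (auto simp: line_part_def q_pt_eq)
  then show "a \<noteq> 0 \<and> b = 0 \<and> c = 0" unfolding pt645_eq_iff by auto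
next
  assume a: "a \<noteq> 0 \<and> b = 0 \<and> c = 0"
  obtain r where r: "r ^ 6 = 1 / a" by (rule complex_nth_root_exists[of 6]) auto
  then have "pt645 a b c = pt645 1 0 0"
    unfolding pt645_eq_iff using a by (intro exI[of _ r]) auto
  then show "Inr (pt645 a b c) \<in> line_part" by (simp add: line_part_def q_pt_eq)
qed

lemmas part_iffs = Inl_in_painleve_part Inr_in_painleve_part Inl_in_ell_total Inr_in_ell_total
  Inl_in_line_part Inr_in_line_part

lemma parts_subset: "painleve_part \<subseteq> fpts M_I" "ell_total \<subseteq> fpts M_I" "line_part \<subseteq> fpts M_I"
proof -
  show "painleve_part \<subseteq> fpts M_I" by (auto simp: painleve_part_def Inl_in_M_I_iff Inr_in_M_I_iff)
  show "ell_total \<subseteq> fpts M_I"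
    by (auto simp: ell_total_def ell_base_def CP1_64_def Inl_in_M_I_iff Inr_in_M_I_iff)
  show "line_part \<subseteq> fpts M_I" by (auto simp: line_part_def q_pt_eq Inl_in_M_I_iff Inr_in_M_I_iff)
qed

lemma M_I_decomposition:
  "fpts M_I = painleve_part \<union> ell_total \<union> line_part"
  "painleve_part \<inter> ell_total = {}" "painleve_part \<inter> line_part = {}" "ell_total \<inter> line_part = {}"
proof -
  have *: "(m \<in> painleve_part \<or> m \<in> ell_total \<or> m \<in> line_part) \<and> \<not> (m \<in> painleve_part \<and> m \<in> ell_total) \<and>
    \<not> (m \<in> painleve_part \<and> m \<in> line_part) \<and> \<not> (m \<in> ell_total \<and> m \<in> line_part)" if "m \<in> fpts M_I" for m
    using that by (cases rule: M_I_cases) (auto simp: part_iffs)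
  show "fpts M_I = painleve_part \<union> ell_total \<union> line_part" using * parts_subset by blast
  show "painleve_part \<inter> ell_total = {}" "painleve_part \<inter> line_part = {}" "ell_total \<inter> line_part = {}"
    using * parts_subset by blast+
qed

text \<open>In the first two charts \<open>\<epsilon>\<close> is the third coordinate times a power
  that is nonzero off the divisor, and on the divisor the condition is again on the third
  coordinate. So the preimages are complements of hyperplanes.\<close>

lemma openin_painleve_part: "fopen M_I painleve_part"
proof (rule openin_M_I[OF parts_subset(1)])
  have 0: "{t. t \<noteq> 0 \<and> Inl (worbit w3245 t) \<in> painleve_part} = {t. t $ 4 \<noteq> 0}"
    unfolding worbit_pt3245 part_iffs by auto
  have 1: "{t. chart1 t \<in> painleve_part} = {t. t $ 3 \<noteq> 0}"
  proof (intro Collect_cong)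
    fix t show "chart1 t \<in> painleve_part \<longleftrightarrow> t $ 3 \<noteq> 0"
      by (cases "t $ 1 = 0") (simp_all add: chart1_Inl chart1_Inr part_iffs)
  qed
  have 2: "{t. chart2 t \<in> painleve_part} = {t. t $ 3 \<noteq> 0}"
  proof (intro Collect_cong)
    fix t show "chart2 t \<in> painleve_part \<longleftrightarrow> t $ 3 \<noteq> 0"
      by (cases "t $ 2 = 0") (simp_all add: chart2_Inl chart2_Inr part_iffs)
  qed
  have 3: "{t. chart3 t \<in> painleve_part} = UNIV"
  proof (intro set_eqI iffI UNIV_I CollectI)
    fix t show "chart3 t \<in> painleve_part"
      by (cases "t $ 3 = 0") (simp_all add: chart3_Inl chart3_Inr part_iffs)
  qed
  show "open {t. t \<noteq> 0 \<and> Inl (worbit w3245 t) \<in> painleve_part}" "open {t. chart1 t \<in> painleve_part}"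
    "open {t. chart2 t \<in> painleve_part}" "open {t. chart3 t \<in> painleve_part}"
    unfolding 0 1 2 3 by (intro open_Collect_neq continuous_intros open_UNIV)+
qed

text \<open>Indexing an orbit by all \<open>k\<close>-th roots of unity replaces the iterates of the
  generator by a group, in which one can divide.\<close>

lemma cyc_orbit_roots_unity:
  assumes "k > 0" "\<And>n. (s ^^ n) x = h (cis (2 * pi / real k) ^ n)"
  shows "cyc_orbit s x = h ` {c. c ^ k = 1}"
proof -
  have "c ^ k = 1 \<longleftrightarrow> (\<exists>n. c = cis (2 * pi / real k) ^ n)" for c
  proof
    assume "c ^ k = 1"
    then have "c \<in> (\<lambda>j. cis (2 * pi * real j / real k)) ` {..<k}"
      using Complex.bij_betw_roots_unity[OF assms(1)] by (simp add: bij_betw_def)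
    then obtain j where "c = cis (2 * pi * real j / real k)" by blast
    moreover have "real j * (2 * pi / real k) = 2 * pi * real j / real k" by simp
    ultimately have "c = cis (2 * pi / real k) ^ j" by (simp only: Complex.DeMoivre)
    then show "\<exists>n. c = cis (2 * pi / real k) ^ n" by blast
  next
    assume "\<exists>n. c = cis (2 * pi / real k) ^ n"
    then obtain n where "c = cis (2 * pi / real k) ^ n" by blast
    then have "c ^ k = (cis (2 * pi / real k) ^ k) ^ n" by (simp add: mult.commute flip: power_mult)
    also have "cis (2 * pi / real k) ^ k = 1" using assms(1) by (simp add: Complex.DeMoivre)
    finally show "c ^ k = 1" by simp
  qed
  then show ?thesis unfolding cyc_orbit_def assms(2) by auto
qed

section \<open>The fiber space of the first Painleve equation\<close>

text \<open>The value at \<open>W = 0\<close> is forced by continuity: there the third chart has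
  \<open>w = 0\<close> and \<open>u = U / 4\<close>.\<close>

definition E_pt :: "complex \<Rightarrow> complex ^ 2 + complex ^ 3 \<Rightarrow> mpoint" where
  "E_pt z a = (case a of Inl t \<Rightarrow> Inl (pt3245 (t $ 1) (t $ 2) z 1)
     | Inr t \<Rightarrow> if t $ 3 = 0 then Inr (pt645 (t $ 1 / 4) z 1)
                else Inl (pt3245 (t $ 2 / t $ 3 ^ 2 - t $ 3 / 2) (1 / t $ 3) z 1))"

text \<open>The action behind \<open>z5_act\<close> for an arbitrary root \<open>c\<close>. When
  \<open>c ^ 5 = 1\<close>, the exponents \<open>4\<close> and \<open>3\<close> stand for
  \<open>-1\<close> and \<open>-2\<close>.\<close>

definition E_rot :: "complex \<Rightarrow> complex ^ 2 + complex ^ 3 \<Rightarrow> complex ^ 2 + complex ^ 3" where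
  "E_rot c = map_sum (\<lambda>t. vector [c ^ 3 * t $ 1, c ^ 2 * t $ 2])
     (\<lambda>t. vector [c * t $ 1, c ^ 4 * t $ 2, c ^ 3 * t $ 3])"

lemma E_rot_simps:
  "E_rot c (Inl s) = Inl (vector [c ^ 3 * s $ 1, c ^ 2 * s $ 2])"
  "E_rot c (Inr t) = Inr (vector [c * t $ 1, c ^ 4 * t $ 2, c ^ 3 * t $ 3])"
  by (simp_all add: E_rot_def)

lemma E_rot_E_rot: "E_rot c (E_rot d a) = E_rot (c * d) a"
  by (cases a) (simp_all add: E_rot_simps power_mult_distrib mult.assoc)

lemma E_rot_1: "E_rot 1 a = a"
  by (cases a) (simp_all add: E_rot_simps)

lemma E_pt_glue: "E_glue z a b \<Longrightarrow> E_pt z a = E_pt z b"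
  by (auto simp: E_glue_def E_pt_def)

lemma E_pt_class: "b \<in> E_class z a \<Longrightarrow> E_pt z b = E_pt z a"
proof -
  assume "b \<in> E_class z a"
  then have "equivclp (E_glue z) a b" by (simp add: E_class_def)
  then show ?thesis by (induction rule: equivclp_induct) (auto dest: E_pt_glue)
qed

lemma E_class_self: "a \<in> E_class z a"
  using equivclp_refl[of "E_glue z" a] by (simp add: E_class_def)

lemma E_class_glue: "E_glue z a b \<Longrightarrow> E_class z a = E_class z b"
proof -
  assume "E_glue z a b"
  then have "equivclp (E_glue z) a b" by (rule r_into_equivclp)
  then show ?thesis unfolding E_class_def
    using equivclp_trans[of "E_glue z"] equivclp_sym[of "E_glue z"] by blast
qed

lemma fifth_root_powers:
  fixes c :: complex assumes "c ^ 5 = 1"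
  shows "c \<noteq> 0" "c ^ (5 + n) = c ^ n"
  using assms by (auto simp: power_add power_0_left)

lemma M_fib_iff: "vector [U, V, W] \<in> M_fib z \<longleftrightarrow> V ^ 2 = U * W ^ 4 + 2 * z * W ^ 3 + 4 * W"
  by (simp add: M_fib_def)

text \<open>All terms have weight \<open>3\<close> modulo \<open>5\<close>: \<open>V^2\<close> has
  \<open>8\<close>, \<open>U W^4\<close> and \<open>z W^3\<close> have \<open>13\<close>, and
  \<open>W\<close> has \<open>3\<close>.\<close>

lemma M_fib_rot:
  assumes c: "c ^ 5 = 1"
  shows "vector [c * U, c ^ 4 * V, c ^ 3 * W] \<in> M_fib (c ^ 4 * z) \<longleftrightarrow> vector [U, V, W] \<in> M_fib z"
proof -
  note red = fifth_root_powers(2)[OF c]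
  have "c ^ 8 = c ^ 3" "c ^ 13 = c ^ 3" using red[of 3] red[of 8] by simp_all
  then have e1: "(c ^ 4 * V) ^ 2 = c ^ 3 * V ^ 2" 
    and e2: "c * U * (c ^ 3 * W) ^ 4 + 2 * (c ^ 4 * z) * (c ^ 3 * W) ^ 3 + 4 * (c ^ 3 * W) =
      c ^ 3 * (U * W ^ 4 + 2 * z * W ^ 3 + 4 * W)"
    by (simp_all add: power_mult_distrib algebra_simps flip: power_mult power_Suc power_add)
  show ?thesis unfolding M_fib_iff e1 e2 using fifth_root_powers(1)[OF c] by simp
qed

text \<open>The gluing is equivariant: \<open>V / W^2\<close> has weight \<open>4 - 6\<close>, which
  is \<open>3\<close> modulo \<open>5\<close> like that of \<open>W\<close>, and
  \<open>1 / W\<close> has weight \<open>-3\<close>, which is \<open>2\<close>.\<close>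

lemma E_rot_coordinates:
  fixes V W :: complex
  assumes c: "c ^ 5 = 1" and W: "W \<noteq> 0"
  shows "c ^ 4 * V / (c ^ 3 * W) ^ 2 - c ^ 3 * W / 2 = c ^ 3 * (V / W ^ 2 - W / 2)"
    "1 / (c ^ 3 * W) = c ^ 2 * (1 / W)"
proof -
  have c0: "c \<noteq> 0" by (rule fifth_root_powers(1)[OF c])
  have c4: "c ^ 4 = c ^ 3 * c ^ 6" "1 = c ^ 3 * c ^ 2" using fifth_root_powers(2)[OF c, of 4] c
    by (simp_all flip: power_add)
  show "c ^ 4 * V / (c ^ 3 * W) ^ 2 - c ^ 3 * W / 2 = c ^ 3 * (V / W ^ 2 - W / 2)"
    using c0 W by (subst c4(1)) (simp add: field_simps power_mult_distrib flip: power_mult)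
  show "1 / (c ^ 3 * W) = c ^ 2 * (1 / W)"
    using c0 W by (subst c4(2)) (simp add: field_simps)
qed

lemma E_pt_rot: assumes c: "c ^ 5 = 1" shows "E_pt (c ^ 4 * z) (E_rot c a) = E_pt z a"
proof (cases a)
  case (Inl t)
  have "pt3245 (t $ 1) (t $ 2) z 1 = pt3245 (c ^ 3 * t $ 1) (c ^ 2 * t $ 2) (c ^ 4 * z) 1"
    unfolding pt3245_eq_iff using c fifth_root_powers(1)[OF c] by (intro exI[of _ c]) auto
  then show ?thesis by (simp add: Inl E_rot_simps E_pt_def)
next
  case (Inr t)
  have c0: "c \<noteq> 0" by (rule fifth_root_powers(1)[OF c])
  have c6: "c ^ 6 = c" using fifth_root_powers(2)[OF c, of 1] by simp
  show ?thesis
  proof (cases "t $ 3 = 0")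
    case True
    have "pt645 (t $ 1 / 4) z 1 = pt645 (c * t $ 1 / 4) (c ^ 4 * z) 1"
      unfolding pt645_eq_iff using c c0 c6 by (intro exI[of _ c]) auto
    then show ?thesis using True by (simp add: Inr E_rot_simps E_pt_def)
  next
    case False
    have "pt3245 (t $ 2 / t $ 3 ^ 2 - t $ 3 / 2) (1 / t $ 3) z 1 =
      pt3245 (c ^ 4 * t $ 2 / (c ^ 3 * t $ 3) ^ 2 - c ^ 3 * t $ 3 / 2) (1 / (c ^ 3 * t $ 3)) (c ^ 4 * z) 1"
      unfolding pt3245_eq_iff using c c0 E_rot_coordinates[OF c False] by (intro exI[of _ c]) auto
    then show ?thesis using False c0 by (simp add: Inr E_rot_simps E_pt_def)
  qed
qed

lemma E_glue_rot:
  assumes c: "c ^ 5 = 1" and g: "E_glue z a b"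
  shows "E_glue (c ^ 4 * z) (E_rot c a) (E_rot c b)"
proof -
  obtain U V W where W: "W \<noteq> 0" "vector [U, V, W] \<in> M_fib z"
    and ab: "a = Inl (vector [V / W ^ 2 - W / 2, 1 / W])" "b = Inr (vector [U, V, W])"
    using g by (auto simp: E_glue_def)
  have c0: "c \<noteq> 0" by (rule fifth_root_powers(1)[OF c])
  show ?thesis unfolding E_glue_def ab E_rot_simps
    using W c0 M_fib_rot[OF c, of U V W z] E_rot_coordinates[OF c W(1)]
    by (intro exI[of _ "c * U"] exI[of _ "c ^ 4 * V"] exI[of _ "c ^ 3 * W"]) simp
qed

lemma E_class_rot_subset:
  assumes c: "c ^ 5 = 1"
  shows "E_rot c ` E_class z a \<subseteq> E_class (c ^ 4 * z) (E_rot c a)"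
proof
  fix b' assume "b' \<in> E_rot c ` E_class z a"
  then obtain b where b: "b' = E_rot c b" "equivclp (E_glue z) a b" by (auto simp: E_class_def)
  from b(2) have "equivclp (E_glue (c ^ 4 * z)) (E_rot c a) (E_rot c b)"
  proof (induction rule: equivclp_induct)
    case base show ?case by (rule equivclp_refl)
  next
    case (step x y)
    then have "equivclp (E_glue (c ^ 4 * z)) (E_rot c x) (E_rot c y)"
      using E_glue_rot[OF c] r_into_equivclp converse_r_into_equivclp by blast
    with step.IH show ?case by (rule equivclp_trans)
  qed
  then show "b' \<in> E_class (c ^ 4 * z) (E_rot c a)" by (simp add: b E_class_def)
qed

text \<open>The converse inclusion is the same inclusion for the inverse root
  \<open>1 / c\<close>.\<close>

lemma E_class_rot:
  assumes c: "c ^ 5 = 1"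
  shows "E_class (c ^ 4 * z) (E_rot c a) = E_rot c ` E_class z a"
proof
  show "E_rot c ` E_class z a \<subseteq> E_class (c ^ 4 * z) (E_rot c a)" by (rule E_class_rot_subset[OF c])
  have c0: "c \<noteq> 0" by (rule fifth_root_powers(1)[OF c])
  have d: "(1 / c) ^ 5 = 1" using c by (simp add: power_divide)
  show "E_class (c ^ 4 * z) (E_rot c a) \<subseteq> E_rot c ` E_class z a"
  proof
    fix b assume "b \<in> E_class (c ^ 4 * z) (E_rot c a)"
    then have "E_rot (1 / c) b \<in> E_class ((1 / c) ^ 4 * (c ^ 4 * z)) (E_rot (1 / c) (E_rot c a))"
      using E_class_rot_subset[OF d] by blast
    also have "\<dots> = E_class z a" using c0 by (simp add: E_rot_E_rot E_rot_1 power_divide)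
    finally have "E_rot c (E_rot (1 / c) b) \<in> E_rot c ` E_class z a" by blast
    then show "b \<in> E_rot c ` E_class z a" using c0 by (simp add: E_rot_E_rot E_rot_1)
  qed
qed

definition P_cls :: "complex \<Rightarrow> complex ^ 2 + complex ^ 3 \<Rightarrow> ppoint set" where
  "P_cls z a = cyc_orbit z5_act (E_class z a, z)"

lemma P_cls_eq: "P_cls z a = (\<lambda>c. (E_class (c ^ 4 * z) (E_rot c a), c ^ 4 * z)) ` {c. c ^ 5 = 1}"
proof -
  let ?h = "\<lambda>c. (E_rot c ` E_class z a, c ^ 4 * z)"
  have "(z5_act ^^ n) (E_class z a, z) = ?h (cis (2 * pi / real 5) ^ n)" for n
  proof (induction n)
    case 0 then show ?case by (simp add: E_rot_1)
  next
    case (Suc n)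
    have "E_rot (cis (2 * pi / 5)) ` E_rot d ` S = E_rot (cis (2 * pi / 5) * d) ` S" for d S
      by (simp add: image_image E_rot_E_rot)
    with Suc show ?case by (simp add: z5_act_def Let_def power_mult_distrib flip: E_rot_def)
  qed
  then have "P_cls z a = ?h ` {c. c ^ 5 = 1}" unfolding P_cls_def by (rule cyc_orbit_roots_unity[rotated]) simp
  also have "\<dots> = (\<lambda>c. (E_class (c ^ 4 * z) (E_rot c a), c ^ 4 * z)) ` {c. c ^ 5 = 1}"
    by (intro image_cong refl) (simp add: E_class_rot)
  finally show ?thesis .
qed

lemma P_cls_rot: assumes d: "d ^ 5 = 1" shows "P_cls (d ^ 4 * z) (E_rot d a) = P_cls z a"
proof -
  have im: "{c. c ^ 5 = 1} = (\<lambda>c. c * d) ` {c :: complex. c ^ 5 = 1}"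
  proof (intro set_eqI iffI)
    fix c :: complex assume "c \<in> {c. c ^ 5 = 1}"
    then show "c \<in> (\<lambda>c. c * d) ` {c. c ^ 5 = 1}"
      using d fifth_root_powers(1)[OF d] by (intro image_eqI[of _ _ "c / d"]) (auto simp: power_divide)
  qed (use d in \<open>auto simp: power_mult_distrib\<close>)
  show ?thesis unfolding P_cls_eq[of z a] by (subst im, subst P_cls_eq)
    (simp add: image_image E_rot_E_rot power_mult_distrib mult.assoc)
qed

text \<open>\<open>E_pt\<close> is constant along \<open>q\<close>, so the union is a singleton.\<close>

definition P_map :: "ppoint set \<Rightarrow> mpoint" where
  "P_map q = the_elem (\<Union>(\<xi>, z)\<in>q. E_pt z ` \<xi>)"

lemma P_map_cls: "P_map (P_cls z a) = E_pt z a"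
proof -
  have *: "E_pt (c ^ 4 * z) ` E_class (c ^ 4 * z) (E_rot c a) = {E_pt z a}" if "c ^ 5 = 1" for c
    using E_pt_class[of _ "c ^ 4 * z" "E_rot c a"] E_class_self[of "E_rot c a" "c ^ 4 * z"] E_pt_rot[OF that] by auto
  have "(\<Union>(\<xi>, z)\<in>P_cls z a. E_pt z ` \<xi>) = (\<Union>c\<in>{c :: complex. c ^ 5 = 1}. {E_pt z a})"
    unfolding P_cls_eq image_image by (intro SUP_cong refl) (use * in auto)
  also have "\<dots> = {E_pt z a}" by (auto intro: exI[of _ 1])
  finally show ?thesis by (simp add: P_map_def)
qed

text \<open>The gluing moves every point with \<open>W \<noteq> 0\<close> into the plane. What
  remains is \<open>W = 0\<close>, where the equation of \<open>M(z)\<close> forces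
  \<open>V = 0\<close>.\<close>

lemma P_cls_normal_form:
  assumes "a \<in> range Inl \<union> Inr ` M_fib z"
  obtains t where "E_class z a = E_class z (Inl t)" "E_pt z a = Inl (pt3245 (t $ 1) (t $ 2) z 1)"
  | t where "a = Inr t" "t $ 2 = 0" "t $ 3 = 0"
proof (cases a)
  case (Inl t) then show ?thesis using that(1)[of t] by (simp add: E_pt_def)
next
  case (Inr t)
  then have t: "vector [t $ 1, t $ 2, t $ 3] \<in> M_fib z" using assms by auto
  show ?thesis
  proof (cases "t $ 3 = 0")
    case True
    then have "t $ 2 = 0" using t unfolding M_fib_iff by simp
    with True Inr that(2) show ?thesis by blast
  next
    case False
    let ?s = "vector [t $ 2 / t $ 3 ^ 2 - t $ 3 / 2, 1 / t $ 3] :: complex ^ 2"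
    have "E_glue z (Inl ?s) a" unfolding E_glue_def
      using False t Inr by (intro exI[of _ "t $ 1"] exI[of _ "t $ 2"] exI[of _ "t $ 3"]) simp
    from that(1)[OF E_class_glue[OF this, symmetric]] show ?thesis using False by (simp add: Inr E_pt_def)
  qed
qed

text \<open>A scaling between two points with last coordinate \<open>1\<close> is by a fifth root of
  unity, hence comes from the group. On the divisor, weight \<open>6\<close> of the first coordinate
  agrees with weight \<open>1\<close> of \<open>U\<close>, since \<open>c ^ 6 = c\<close>.\<close>

lemma P_cls_inject:
  assumes a: "a \<in> range Inl \<union> Inr ` M_fib z" and b: "b \<in> range Inl \<union> Inr ` M_fib z'"
    and eq: "E_pt z a = E_pt z' b"
  shows "P_cls z a = P_cls z' b"
  using a
proof (cases rule: P_cls_normal_form)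
  case (1 t)
  note t = this
  show ?thesis using b
  proof (cases rule: P_cls_normal_form)
    case (1 s)
    from eq have "pt3245 (t $ 1) (t $ 2) z 1 = pt3245 (s $ 1) (s $ 2) z' 1" unfolding t 1 by simp
    then obtain c where c: "s $ 1 = c ^ 3 * t $ 1" "s $ 2 = c ^ 2 * t $ 2" "z' = c ^ 4 * z" "c ^ 5 = 1"
      unfolding pt3245_eq_iff by auto
    then have "Inl s = E_rot c (Inl t)" by (simp add: E_rot_simps vec2_eq_iff)
    then have "P_cls z' (Inl s) = P_cls z (Inl t)" using P_cls_rot[OF c(4), of z "Inl t"] c(3) by simp
    then show ?thesis by (simp add: P_cls_def t 1)
  next
    case (2 s) then show ?thesis using eq unfolding t by (simp add: E_pt_def)
  qed
next
  case (2 t)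
  note t = this
  show ?thesis using b
  proof (cases rule: P_cls_normal_form)
    case (1 s) then show ?thesis using eq t by (simp add: E_pt_def)
  next
    case (2 s)
    with eq t have "pt645 (t $ 1 / 4) z 1 = pt645 (s $ 1 / 4) z' 1" by (simp add: E_pt_def)
    then obtain c where c: "s $ 1 = c ^ 6 * t $ 1" "z' = c ^ 4 * z" "c ^ 5 = 1"
      unfolding pt645_eq_iff by auto
    have "c ^ 6 = c" using fifth_root_powers(2)[OF c(3), of 1] by simp
    then have "Inr s = E_rot c (Inr t)" using c 2 t by (simp add: E_rot_simps vec3_eq_iff)
    then show ?thesis using P_cls_rot[OF c(3), of z "Inr t"] c(2) t 2 by simp
  qed
qed

section \<open>Maps into and out of the quotient of the fiber space\<close>

definition UVWz_set :: "(complex ^ 4) set" where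
  "UVWz_set = {t. vector [t $ 1, t $ 2, t $ 3] \<in> M_fib (t $ 4)}"

abbreviation P_quot :: "ppoint set fspace" where
  "P_quot \<equiv> cyc_quot z5_act P_space"

lemma sheafy_P_space: "sheafy P_space"
  unfolding P_space_def by (intro sheafy_fquot sheafy_fsum sheafy_fsub sheafy_cspace)

lemma sheafy_cyc_quot: "sheafy X \<Longrightarrow> sheafy (cyc_quot s X)"
  unfolding cyc_quot_def by (rule sheafy_fquot)

lemma fpts_cyc_quot: "fpts (cyc_quot s X) = cyc_orbit s ` fpts X"
  by (simp add: cyc_quot_def)

lemma fpts_P_quot: "fpts P_quot = {P_cls z a | z a. a \<in> range Inl \<union> Inr ` M_fib z}"
  unfolding fpts_cyc_quot fpts_P_space E_fib_def P_cls_def by blast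

lemma hol_at_P_cls_Inl:
  fixes t :: "complex ^ 3"
  shows "hol_at cspace P_quot t (\<lambda>t. P_cls (t $ 3) (Inl (vector [t $ 1, t $ 2])))"
proof -
  have "t \<in> fpts (cspace :: (complex ^ 3) fspace)" by simp
  note h1 = hol_at_Inl[OF this]
  note h2 = hol_at_comp[OF h1 hol_at_fquot_proj[OF hol_at_pts(2)[OF h1], where \<pi> = "case_sum P_xyz P_UVWz"]]
  note h3 = hol_at_comp[OF h2 hol_at_fquot_proj[OF hol_at_pts(2)[OF h2], where \<pi> = "cyc_orbit z5_act"]]
  have "hol_at cspace P_quot t (\<lambda>t. cyc_orbit z5_act (P_xyz t))"
    unfolding cyc_quot_def P_space_def by (rule h3[unfolded comp_def, simplified])
  then show ?thesis by (simp add: P_cls_def P_xyz_def)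
qed

lemma hol_at_P_cls_Inr:
  assumes "t \<in> UVWz_set"
  shows "hol_at (fsub cspace UVWz_set) P_quot t (\<lambda>t. P_cls (t $ 4) (Inr (vector [t $ 1, t $ 2, t $ 3])))"
proof -
  have "t \<in> fpts (fsub cspace UVWz_set)" using assms by simp
  note h1 = hol_at_Inr[OF this]
  note h2 = hol_at_comp[OF h1 hol_at_fquot_proj[OF hol_at_pts(2)[OF h1], where \<pi> = "case_sum P_xyz P_UVWz"]]
  note h3 = hol_at_comp[OF h2 hol_at_fquot_proj[OF hol_at_pts(2)[OF h2], where \<pi> = "cyc_orbit z5_act"]]
  have "hol_at (fsub cspace UVWz_set) P_quot t (\<lambda>t. cyc_orbit z5_act (P_UVWz t))"
    unfolding cyc_quot_def P_space_def UVWz_set_def[symmetric] by (rule h3[unfolded comp_def, simplified])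
  then show ?thesis by (simp add: P_cls_def P_UVWz_def)
qed

lemma hol_at_fquot_desc_all:
  assumes "sheafy X" "sheafy Y" "\<And>x. x \<in> fpts X \<Longrightarrow> hol_at X Y x (f \<circ> \<pi>)" "q \<in> fpts (fquot \<pi> X)"
  shows "hol_at (fquot \<pi> X) Y q f"
  by (rule hol_at_fquot_desc[OF assms(1,2) openin_topspace]) (use assms(3,4) in auto)

text \<open>Two quotient maps are descended through in turn: the gluing of the two charts and the
  cyclic action.\<close>

lemma hol_at_P_quot_desc:
  assumes Y: "sheafy Y"
    and f1: "\<And>t :: complex ^ 3. hol_at cspace Y t (\<lambda>t. f (P_cls (t $ 3) (Inl (vector [t $ 1, t $ 2]))))"
    and f2: "\<And>t. t \<in> UVWz_set \<Longrightarrow>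
      hol_at (fsub cspace UVWz_set) Y t (\<lambda>t. f (P_cls (t $ 4) (Inr (vector [t $ 1, t $ 2, t $ 3]))))"
    and q: "q \<in> fpts P_quot"
  shows "hol_at P_quot Y q f"
  unfolding cyc_quot_def
proof (rule hol_at_fquot_desc_all[OF sheafy_P_space Y])
  show "q \<in> fpts (fquot (cyc_orbit z5_act) P_space)" using q by (simp add: cyc_quot_def)
  fix x assume "x \<in> fpts P_space"
  then show "hol_at P_space Y x (f \<circ> cyc_orbit z5_act)"
    unfolding P_space_def UVWz_set_def[symmetric]
  proof (rule hol_at_fquot_desc_all[rotated 3])
    show "sheafy ((cspace :: (complex ^ 3) fspace) \<oplus>\<^sub>f fsub cspace UVWz_set)" by (intro sheafy_fsum sheafy_fsub sheafy_cspace)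
    show "sheafy Y" by (rule Y)
    fix s assume "s \<in> fpts ((cspace :: (complex ^ 3) fspace) \<oplus>\<^sub>f fsub cspace UVWz_set)"
    then consider (1) t where "s = Inl t" | (2) t where "s = Inr t" "t \<in> UVWz_set"
      unfolding fpts_fsum by auto
    then show "hol_at ((cspace :: (complex ^ 3) fspace) \<oplus>\<^sub>f fsub cspace UVWz_set) Y s (f \<circ> cyc_orbit z5_act \<circ> case_sum P_xyz P_UVWz)"
    proof cases
      case 1
      show ?thesis unfolding 1
        by (rule hol_at_fsum_Inl[OF sheafy_fsub[OF sheafy_cspace]])
          (use f1[of t] in \<open>simp add: comp_def P_cls_def P_xyz_def\<close>)
    next
      case 2
      show ?thesis unfolding 2
        by (rule hol_at_fsum_Inr[OF sheafy_cspace])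
          (use f2[OF 2(2)] in \<open>simp add: comp_def P_cls_def P_UVWz_def\<close>)
    qed
  qed
qed

text \<open>With \<open>N\<close> a square \<open>w\<^sup>2\<close> this solves \<open>h\<^sup>2 = 4 + 2 z N\<^sup>2 + U N\<^sup>3\<close> for \<open>h = 2 + w\<^sup>6 u + w\<^sup>4 z / 2\<close>,
  with \<open>u\<close> visibly holomorphic at \<open>N = 0\<close>.\<close>

lemma sqrt_expansion:
  fixes r :: complex
  assumes r: "r ^ 2 = 1 + (z * N ^ 2 / 2 + U * N ^ 3 / 4)" "1 + r \<noteq> 0"
    and u: "u = U / 4 - N * (z / 2 + U * N / 4) ^ 2 / (1 + r) ^ 2"
  shows "2 * r = 2 + N ^ 3 * u + N ^ 2 * z / 2"
proof -
  define s where "s = z * N ^ 2 / 2 + U * N ^ 3 / 4"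
  have r2: "r ^ 2 = 1 + s" using r(1) by (simp add: s_def)
  then have "s = (r - 1) * (1 + r)" by (simp add: algebra_simps power2_eq_square)
  then have q: "s / (1 + r) = r - 1" using r(2) by simp
  have "s = N ^ 2 * (z / 2 + U * N / 4)"
    by (simp add: s_def algebra_simps power2_eq_square power3_eq_cube)
  \<comment> \<open>As \<open>r - 1 = s / (1 + r)\<close> and \<open>s\<close> contains
    \<open>N^2\<close>, the square of \<open>r - 1\<close> contains \<open>N^4\<close>; this is why
    its quotient by \<open>N^3\<close> is holomorphic at \<open>N = 0\<close>.\<close>
  then have "N ^ 3 * (N * (z / 2 + U * N / 4) ^ 2 / (1 + r) ^ 2) = (s / (1 + r)) ^ 2"
    by (simp add: power_divide power_mult_distrib power2_eq_square power3_eq_cube)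
  then have "N ^ 3 * u = N ^ 3 * U / 4 - (r - 1) ^ 2"
    unfolding u q by (simp add: algebra_simps)
  \<comment> \<open>Here \<open>r^2 = 1 + s\<close> is used in the form
    \<open>2 r = 2 + s - (r - 1)^2\<close>.\<close>
  then show ?thesis using r2 unfolding s_def by (simp add: algebra_simps power2_eq_square)
qed

text \<open>The principal root has nonnegative real part, so it is never \<open>-1\<close>.\<close>

lemma csqrt_neq: "1 + csqrt s \<noteq> 0"
proof
  assume "1 + csqrt s = 0"
  then have "csqrt s = - 1" by (simp add: add_eq_0_iff)
  with csqrt_principal[of s] show False by simp
qed

text \<open>The equation of \<open>M(z)\<close> reads \<open>V^2 = W (2 r)^2\<close>, so
  \<open>w = V / (2 r)\<close> is a square root of \<open>W\<close>. Then \<open>2 r\<close> is the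
  \<open>h\<close> of the expansion, and scaling \<open>[x : y : z : 1]\<close> by \<open>w\<close>
  makes the second coordinate \<open>1\<close>.\<close>

lemma E_pt_chart3:
  assumes V: "V ^ 2 = U * W ^ 4 + 2 * z * W ^ 3 + 4 * W"
    and r: "r ^ 2 = 1 + (z * W ^ 2 / 2 + U * W ^ 3 / 4)" "1 + r \<noteq> 0" "r \<noteq> 0"
  shows "E_pt z (Inr (vector [U, V, W])) =
    chart3 (vector [U / 4 - W * (z / 2 + U * W / 4) ^ 2 / (1 + r) ^ 2, z, V / (2 * r)])"
proof (cases "W = 0")
  case True
  with V have "V = 0" by simp
  with True show ?thesis by (simp add: E_pt_def chart3_Inr)
next
  case False
  define u where "u = U / 4 - W * (z / 2 + U * W / 4) ^ 2 / (1 + r) ^ 2"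
  define w where "w = V / (2 * r)"
  have "V ^ 2 = W * (4 * r ^ 2)" unfolding V r(1)
    by (simp add: algebra_simps power2_eq_square power3_eq_cube power4_eq_xxxx)
  then have w2: "w ^ 2 = W" using r(3) by (simp add: w_def power_divide power_mult_distrib)
  then have w0: "w \<noteq> 0" using False by auto
  have h: "2 * r = 2 + w ^ 6 * u + w ^ 4 * z / 2"
    using sqrt_expansion[OF r(1,2) u_def] unfolding w2[symmetric] by (simp flip: power_mult)
  have "V = 2 * r * w" using r(3) by (simp add: w_def)
  then have x: "w ^ 3 * (V / W ^ 2 - W / 2) = 2 * r - w ^ 5 / 2"
    unfolding w2[symmetric] using w0 by (simp add: field_simps eval_nat_numeral)
  have "pt3245 (V / W ^ 2 - W / 2) (1 / W) z 1 = pt3245 (2 + w ^ 6 * u + w ^ 4 * z / 2 - w ^ 5 / 2) 1 (w ^ 4 * z) (w ^ 5)"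
    unfolding pt3245_eq_iff x[unfolded h, symmetric] using w0 w2 False by (intro exI[of _ w]) auto
  then show ?thesis using False w0 by (simp add: E_pt_def chart3_Inl flip: u_def w_def)
qed

text \<open>The third chart of the blow-up in the coordinates of \<open>M(z)\<close>; it is a double cover branched along \<open>W = 0\<close>.\<close>

definition UVWz_of :: "complex ^ 3 \<Rightarrow> complex ^ 4" where
  "UVWz_of t = vector [4 * t $ 1 + (t $ 3 ^ 3 * t $ 1 + t $ 3 * t $ 2 / 2) ^ 2,
    2 * t $ 3 + t $ 3 ^ 7 * t $ 1 + t $ 3 ^ 5 * t $ 2 / 2, t $ 3 ^ 2, t $ 2]"

text \<open>The entries of \<open>UVWz_of\<close> come from solving for \<open>V\<close> and
  \<open>U\<close>: \<open>V = w h\<close>, and \<open>h^2 = 4 + 2 v w^4 + U w^6\<close> with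
  \<open>h = 2 + w^6 u + w^4 v / 2\<close> gives \<open>U\<close> after cancelling
  \<open>w^6\<close>.\<close>

lemma chart3_E_pt:
  shows "UVWz_of t \<in> UVWz_set" "chart3 t = E_pt (UVWz_of t $ 4) (Inr (vector [UVWz_of t $ 1, UVWz_of t $ 2, UVWz_of t $ 3]))"
proof -
  define u v w where "u = t $ 1" and "v = t $ 2" and "w = t $ 3"
  have L: "UVWz_of t = vector [4 * u + (w ^ 3 * u + w * v / 2) ^ 2, 2 * w + w ^ 7 * u + w ^ 5 * v / 2, w ^ 2, v]"
    by (simp add: UVWz_of_def u_def v_def w_def)
  show "UVWz_of t \<in> UVWz_set"
    unfolding UVWz_set_def mem_Collect_eq M_fib_iff L vector_4
    by (simp add: field_simps eval_nat_numeral)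
  show "chart3 t = E_pt (UVWz_of t $ 4) (Inr (vector [UVWz_of t $ 1, UVWz_of t $ 2, UVWz_of t $ 3]))"
  proof (cases "w = 0")
    case True
    then show ?thesis unfolding L vector_4 by (simp add: E_pt_def chart3_Inr flip: u_def v_def w_def)
  next
    case False
    have x: "w ^ 3 * ((2 * w + w ^ 7 * u + w ^ 5 * v / 2) / (w ^ 2) ^ 2 - w ^ 2 / 2) =
      2 + w ^ 6 * u + w ^ 4 * v / 2 - w ^ 5 / 2"
      using False by (simp add: field_simps eval_nat_numeral)
    have "pt3245 ((2 * w + w ^ 7 * u + w ^ 5 * v / 2) / (w ^ 2) ^ 2 - w ^ 2 / 2) (1 / w ^ 2) v 1 =
      pt3245 (2 + w ^ 6 * u + w ^ 4 * v / 2 - w ^ 5 / 2) 1 (w ^ 4 * v) (w ^ 5)"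
      unfolding pt3245_eq_iff x[symmetric] using False by (intro exI[of _ w]) auto
    then show ?thesis unfolding L vector_4 using False
      by (simp add: E_pt_def chart3_Inl flip: u_def v_def w_def)
  qed
qed

lemma open_slit_vimage:
  fixes f :: "'a::topological_space \<Rightarrow> complex"
  assumes "continuous_on UNIV f" shows "open {t. f t \<notin> \<real>\<^sub>\<le>\<^sub>0}"
proof -
  have "open (f -` (- \<real>\<^sub>\<le>\<^sub>0))" by (rule open_vimage[OF _ assms]) (simp add: open_Compl)
  then show ?thesis by (simp add: vimage_def)
qed

text \<open>Near \<open>W = 0\<close> the radicand \<open>1 + s\<close> is close to
  \<open>1\<close>, off the slit of \<open>csqrt\<close>; the composition with \<open>chart3\<close>
  makes sense also off the surface and is the required extension. Elsewhere the gluing formula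
  serves.\<close>

lemma hol_at_E_pt_Inr:
  assumes t: "t \<in> UVWz_set"
  shows "hol_at (fsub cspace UVWz_set) M_I t (\<lambda>t. E_pt (t $ 4) (Inr (vector [t $ 1, t $ 2, t $ 3])))"
proof (cases "t $ 3 = 0")
  case False
  let ?N = "{t :: complex ^ 4. t $ 3 \<noteq> 0}"
  have N: "open ?N" by (intro open_Collect_neq continuous_intros)
  show ?thesis
  proof (rule hol_at_fsub_extend[OF sheafy_cspace t, of _ _ ?N])
    show "hol_at cspace M_I t (\<lambda>t. Inl (pt3245 (t $ 2 / t $ 3 ^ 2 - t $ 3 / 2) (1 / t $ 3) (t $ 4) 1))"
      by (rule hol_at_M_I_Inl[of ?N]) (use N False in \<open>auto intro!: cdiff_intros\<close>)
  qed (use N False in \<open>auto simp: E_pt_def\<close>)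
next
  case True
  define s where "s = (\<lambda>t :: complex ^ 4. t $ 4 * t $ 3 ^ 2 / 2 + t $ 1 * t $ 3 ^ 3 / 4)"
  let ?N = "{t. 1 + s t \<notin> \<real>\<^sub>\<le>\<^sub>0}"
  have N: "open ?N" unfolding s_def by (intro open_slit_vimage continuous_intros) auto
  have tN: "t \<in> ?N" using True by (simp add: s_def)
  let ?L = "\<lambda>t. vector [t $ 1 / 4 - t $ 3 * (t $ 4 / 2 + t $ 1 * t $ 3 / 4) ^ 2 / (1 + csqrt (1 + s t)) ^ 2,
    t $ 4, t $ 2 / (2 * csqrt (1 + s t))] :: complex ^ 3"
  have nz: "csqrt (1 + s y) \<noteq> 0" "1 + csqrt (1 + s y) \<noteq> 0" if "y \<in> ?N" for y
    using that csqrt_neq by auto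
  have cs: "cdiff (\<lambda>t. csqrt (1 + s t)) y" if "y \<in> ?N" for y
    unfolding s_def using that by (intro cdiff_intros) (auto simp: s_def)
  have "hol_at cspace cspace t ?L"
    by (rule hol_at_vec3[OF N tN]; intro cdiff_intros cs) (use nz in auto)
  from hol_at_comp[OF this hol_at_chart3]
  have F: "hol_at cspace M_I t (\<lambda>t. chart3 (?L t))" by (simp add: comp_def)
  show ?thesis
  proof (rule hol_at_fsub_extend[OF sheafy_cspace t F, of ?N])
    fix y assume y: "y \<in> ?N" "y \<in> UVWz_set"
    then have "y $ 2 ^ 2 = y $ 1 * y $ 3 ^ 4 + 2 * y $ 4 * y $ 3 ^ 3 + 4 * y $ 3"
      by (simp only: UVWz_set_def mem_Collect_eq M_fib_iff)
    then show "E_pt (y $ 4) (Inr (vector [y $ 1, y $ 2, y $ 3])) = chart3 (?L y)"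
      by (rule E_pt_chart3) (use nz[OF y(1)] in \<open>auto simp: s_def\<close>)
  qed (use N tN in auto)
qed

lemma P_map_hol: "q \<in> fpts P_quot \<Longrightarrow> hol_at P_quot M_I q P_map"
proof (rule hol_at_P_quot_desc[OF sheafy_M_I]; (unfold P_map_cls)?)
  fix t :: "complex ^ 3"
  show "hol_at cspace M_I t (\<lambda>t. E_pt (t $ 3) (Inl (vector [t $ 1, t $ 2])))"
    unfolding E_pt_def by simp (rule hol_at_M_I_Inl[of UNIV]; auto)
qed (rule hol_at_E_pt_Inr)

lemma P_map_image: "P_map ` fpts P_quot = painleve_part"
proof
  show "P_map ` fpts P_quot \<subseteq> painleve_part"
    unfolding fpts_P_quot by (auto simp: P_map_cls E_pt_def part_iffs)
  show "painleve_part \<subseteq> P_map ` fpts P_quot"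
  proof
    fix m assume "m \<in> painleve_part"
    then consider x y z where "m = Inl (pt3245 x y z 1)" | a b where "m = Inr (pt645 a b 1)"
      by (auto simp: painleve_part_def)
    then obtain z a where "a \<in> range Inl \<union> Inr ` M_fib z" "m = E_pt z a"
    proof cases
      case (1 x y z) then show ?thesis using that[of "Inl (vector [x, y])" z] by (simp add: E_pt_def)
    next
      case (2 a b)
      have "vector [4 * a, 0, 0] \<in> M_fib b" by (simp add: M_fib_iff)
      with 2 show ?thesis using that[of "Inr (vector [4 * a, 0, 0])" b] by (simp add: E_pt_def)
    qed
    then show "m \<in> P_map ` fpts P_quot"
      unfolding fpts_P_quot by (intro image_eqI[of _ _ "P_cls z a"]) (auto simp: P_map_cls)
  qed
qed

lemma P_map_inj: "inj_on P_map (fpts P_quot)"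
proof (rule inj_onI)
  fix p q assume "p \<in> fpts P_quot" "q \<in> fpts P_quot" and eq: "P_map p = P_map q"
  then obtain z a z' b where "p = P_cls z a" "a \<in> range Inl \<union> Inr ` M_fib z"
    "q = P_cls z' b" "b \<in> range Inl \<union> Inr ` M_fib z'" unfolding fpts_P_quot by blast
  with eq show "p = q" using P_cls_inject[of a z b z'] by (simp only: P_map_cls)
qed

section \<open>The inverse on the Painleve piece\<close>

definition P_inv :: "mpoint \<Rightarrow> ppoint set" where
  "P_inv = inv_into (fpts P_quot) P_map"

lemma P_inv_E_pt: "a \<in> range Inl \<union> Inr ` M_fib z \<Longrightarrow> P_inv (E_pt z a) = P_cls z a"
  unfolding P_inv_def P_map_cls[symmetric]
  by (rule inv_into_f_f[OF P_map_inj]) (auto simp: fpts_P_quot)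

text \<open>\<open>P_inv\<close> after \<open>chart3\<close> is the class of the polynomial map
  \<open>UVWz_of\<close>, so this direction involves no root and no case distinction at
  \<open>w = 0\<close>.\<close>

lemma P_inv_chart3_hol: "hol_at cspace P_quot t (\<lambda>t. P_inv (chart3 t))"
proof -
  note cL = chart3_E_pt
  have "hol_at cspace cspace t UVWz_of"
    unfolding UVWz_of_def by (rule hol_at_vec4[of UNIV]; (intro cdiff_intros)?) auto
  then have L: "hol_at cspace (fsub cspace UVWz_set) t UVWz_of"
    by (rule hol_at_fsub_cod[OF sheafy_cspace sheafy_cspace, of _ _ UNIV]) (auto simp: cL(1))
  have eq: "P_inv (chart3 y) = P_cls (UVWz_of y $ 4) (Inr (vector [UVWz_of y $ 1, UVWz_of y $ 2, UVWz_of y $ 3]))" for y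
  proof -
    have "vector [UVWz_of y $ 1, UVWz_of y $ 2, UVWz_of y $ 3] \<in> M_fib (UVWz_of y $ 4)"
      using cL(1)[of y] by (simp only: UVWz_set_def mem_Collect_eq)
    then show ?thesis unfolding cL(2) by (rule P_inv_E_pt[OF UnI2[OF imageI]])
  qed
  show ?thesis unfolding eq
    using hol_at_comp[OF L hol_at_P_cls_Inr[OF cL(1)]] by (simp only: comp_def)
qed

text \<open>A fifth root \<open>k\<close> of the third coordinate normalises that coordinate to
  \<open>1\<close>; the scale \<open>u\<close> of the first chart becomes the scale
  \<open>u k\<close> of the third.\<close>

lemma chart1_chart3:
  assumes "k \<noteq> 0" "k ^ 5 = w"
  shows "chart1 (vector [u, v, w]) = chart3 (vector [1 / k ^ 6, v / k ^ 4, u * k])"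
proof (cases "u = 0")
  case True
  have "pt645 1 v w = pt645 (1 / k ^ 6) (v / k ^ 4) 1"
    unfolding pt645_eq_iff using assms by (intro exI[of _ "1 / k"]) (auto simp: power_divide)
  with True show ?thesis by (simp add: chart1_Inr chart3_Inr)
next
  case False
  with assms show ?thesis by (auto simp: chart1_Inl chart3_Inl power_mult_distrib)
qed

lemma chart2_chart3:
  assumes "k \<noteq> 0" "k ^ 5 = w"
  shows "chart2 (vector [u, v, w]) = chart3 (vector [u / k ^ 6, 1 / k ^ 4, v * k])"
proof (cases "v = 0")
  case True
  have "pt645 u 1 w = pt645 (u / k ^ 6) (1 / k ^ 4) 1"
    unfolding pt645_eq_iff using assms by (intro exI[of _ "1 / k"]) (auto simp: power_divide)
  with True show ?thesis by (simp add: chart2_Inr chart3_Inr)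
next
  case False
  with assms show ?thesis by (auto simp: chart2_Inl chart3_Inl power_mult_distrib)
qed

lemma root_branch_coordinate:
  fixes t :: "complex ^ 'n"
  assumes "k > 0" "t $ i \<noteq> 0"
  obtains \<rho> N where "open N" "t \<in> N" "\<And>y. y \<in> N \<Longrightarrow> \<rho> y \<noteq> 0" "\<And>y. y \<in> N \<Longrightarrow> \<rho> y ^ k = y $ i"
    "\<And>y. y \<in> N \<Longrightarrow> cdiff \<rho> y"
proof -
  obtain r where "r ^ k = t $ i" by (rule complex_nth_root_exists[OF assms(1)])
  then obtain \<rho> N where *: "open N" "t $ i \<in> N" "\<And>y. y \<in> N \<Longrightarrow> \<rho> y ^ k = y" "\<And>y. y \<in> N \<Longrightarrow> \<rho> y \<noteq> 0"
    "\<And>y. y \<in> N \<Longrightarrow> \<rho> field_differentiable at y" by (rule root_branch[OF assms]) blast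
  show ?thesis
  proof (rule that[of "(\<lambda>t. t $ i) -` N" "\<lambda>t. \<rho> (t $ i)"])
    show "open ((\<lambda>t :: complex ^ 'n. t $ i) -` N)" by (intro open_vimage continuous_intros *)
  qed (use * in \<open>auto intro: cdiff_compose\<close>)
qed

text \<open>The lift \<open>L\<close> depends on a root of \<open>t $ i\<close>. As
  \<open>eq\<close> holds for every root, any local branch proves the claim, and branches never have
  to be compared.\<close>

lemma hol_at_root_reparam:
  fixes t :: "complex ^ 'n"
  assumes k: "k > 0" "t $ i \<noteq> 0"
    and L: "\<And>\<rho> N. open N \<Longrightarrow> t \<in> N \<Longrightarrow> (\<And>y. y \<in> N \<Longrightarrow> \<rho> y \<noteq> 0) \<Longrightarrow> (\<And>y. y \<in> N \<Longrightarrow> cdiff \<rho> y) \<Longrightarrow>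
      hol_at cspace Z t (\<lambda>y. L (\<rho> y) y)"
    and g: "\<And>c. hol_at Z Y (L c t) g"
    and eq: "\<And>c y. c \<noteq> 0 \<Longrightarrow> c ^ k = y $ i \<Longrightarrow> f y = g (L c y)"
  shows "hol_at cspace Y t f"
proof -
  obtain \<rho> N where \<rho>: "open N" "t \<in> N" "\<And>y. y \<in> N \<Longrightarrow> \<rho> y \<noteq> 0" "\<And>y. y \<in> N \<Longrightarrow> \<rho> y ^ k = y $ i"
    "\<And>y. y \<in> N \<Longrightarrow> cdiff \<rho> y" by (rule root_branch_coordinate[OF k]) blast
  have h: "hol_at cspace Z t (\<lambda>y. L (\<rho> y) y)" by (rule L[OF \<rho>(1,2,3,5)])
  show ?thesis
    by (rule hol_at_comp'[OF sheafy_cspace h g, of N]) (use \<rho> eq in auto)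
qed

text \<open>The piece is open, so descent applies directly. A fifth root of the nonzero last
  coordinate reduces the projective space to last coordinate \<open>1\<close>, and the first two
  charts to the third.\<close>

lemma P_inv_hol:
  assumes "m \<in> painleve_part" shows "hol_at M_I P_quot m P_inv"
proof (rule hol_at_M_I_desc[OF sheafy_cyc_quot[OF sheafy_P_space] openin_painleve_part _ _ _ _ assms])
  fix t :: "complex ^ 4"
  let ?L = "\<lambda>c t :: complex ^ 4. vector [t $ 1 / c ^ 3, t $ 2 / c ^ 2, t $ 3 / c ^ 4] :: complex ^ 3"
  assume "Inl (worbit w3245 t) \<in> painleve_part"
  then have t: "t $ 4 \<noteq> 0" by (simp add: worbit_pt3245 part_iffs)
  show "hol_at cspace P_quot t (\<lambda>t. P_inv (Inl (worbit w3245 t)))"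
  proof (rule hol_at_root_reparam[where k = 5 and L = ?L, OF _ t _ hol_at_P_cls_Inl])
    fix c and y :: "complex ^ 4" assume c: "c \<noteq> 0" "c ^ 5 = y $ 4"
    have "worbit w3245 y = pt3245 (?L c y $ 1) (?L c y $ 2) (?L c y $ 3) 1"
      unfolding worbit_pt3245 pt3245_eq_iff using c
      by (intro exI[of _ "1 / c"]) (auto simp: power_divide)
    then have "Inl (worbit w3245 y) = E_pt (?L c y $ 3) (Inl (vector [?L c y $ 1, ?L c y $ 2]))"
      by (simp add: E_pt_def)
    then show "P_inv (Inl (worbit w3245 y)) = P_cls (?L c y $ 3) (Inl (vector [?L c y $ 1, ?L c y $ 2]))"
      by (simp only: P_inv_E_pt UnI1 rangeI)
  next
    show "hol_at cspace cspace t (\<lambda>y. ?L (\<rho> y) y)"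
      if "open N" "t \<in> N" "\<And>y. y \<in> N \<Longrightarrow> \<rho> y \<noteq> 0" "\<And>y. y \<in> N \<Longrightarrow> cdiff \<rho> y" for \<rho> N
      using that by (intro hol_at_vec3[of N] cdiff_intros) auto
  qed simp
next
  fix t :: "complex ^ 3"
  let ?L = "\<lambda>c t :: complex ^ 3. vector [1 / c ^ 6, t $ 2 / c ^ 4, t $ 1 * c] :: complex ^ 3"
  assume "chart1 t \<in> painleve_part" "t $ 1 = 0"
  then have t: "t $ 3 \<noteq> 0" by (simp add: chart1_Inr part_iffs)
  show "hol_at cspace P_quot t (\<lambda>t. P_inv (chart1 t))"
  proof (rule hol_at_root_reparam[where k = 5 and L = ?L, OF _ t _ P_inv_chart3_hol])
    fix c and y :: "complex ^ 3" assume c: "c \<noteq> 0" "c ^ 5 = y $ 3"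
    show "P_inv (chart1 y) = P_inv (chart3 (?L c y))" using chart1_chart3[OF c, of "y $ 1" "y $ 2"] by simp
  next
    show "hol_at cspace cspace t (\<lambda>y. ?L (\<rho> y) y)"
      if "open N" "t \<in> N" "\<And>y. y \<in> N \<Longrightarrow> \<rho> y \<noteq> 0" "\<And>y. y \<in> N \<Longrightarrow> cdiff \<rho> y" for \<rho> N
      using that by (intro hol_at_vec3[of N] cdiff_intros) auto
  qed simp
next
  fix t :: "complex ^ 3"
  let ?L = "\<lambda>c t :: complex ^ 3. vector [t $ 1 / c ^ 6, 1 / c ^ 4, t $ 2 * c] :: complex ^ 3"
  assume "chart2 t \<in> painleve_part" "t $ 2 = 0"
  then have t: "t $ 3 \<noteq> 0" by (simp add: chart2_Inr part_iffs)
  show "hol_at cspace P_quot t (\<lambda>t. P_inv (chart2 t))"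
  proof (rule hol_at_root_reparam[where k = 5 and L = ?L, OF _ t _ P_inv_chart3_hol])
    fix c and y :: "complex ^ 3" assume c: "c \<noteq> 0" "c ^ 5 = y $ 3"
    show "P_inv (chart2 y) = P_inv (chart3 (?L c y))" using chart2_chart3[OF c, of "y $ 1" "y $ 2"] by simp
  next
    show "hol_at cspace cspace t (\<lambda>y. ?L (\<rho> y) y)"
      if "open N" "t \<in> N" "\<And>y. y \<in> N \<Longrightarrow> \<rho> y \<noteq> 0" "\<And>y. y \<in> N \<Longrightarrow> cdiff \<rho> y" for \<rho> N
      using that by (intro hol_at_vec3[of N] cdiff_intros) auto
  qed simp
next
  fix t :: "complex ^ 3"
  show "hol_at cspace P_quot t (\<lambda>t. P_inv (chart3 t))" by (rule P_inv_chart3_hol)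
qed

lemma P_map_biholomorphic: "biholomorphic_map P_quot (fsub M_I painleve_part) P_map"
  by (rule biholomorphic_onto_fsub[OF sheafy_cyc_quot[OF sheafy_P_space] sheafy_M_I P_map_hol P_map_inj P_map_image])
    (auto simp flip: P_inv_def intro: hol_at_fsub_dom P_inv_hol)

lemma P_map_P_xyz: "P_map (cyc_orbit z5_act (P_xyz (vector [x, y, z]))) = Inl (pt3245 x y z 1)"
  using P_map_cls[of z "Inl (vector [x, y])"] by (simp add: P_cls_def P_xyz_def E_pt_def)

section \<open>The elliptic fibration\<close>

definition W_set :: "(complex ^ 4) set" where
  "W_set = {t. vector [t $ 1, t $ 2, t $ 3] \<in> wcubic (-2) (t $ 4) - {0}}"

abbreviation W_quot :: "wpoint set fspace" where
  "W_quot \<equiv> cyc_quot z4_act W_space"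

abbreviation orb111 :: "complex ^ 3 \<Rightarrow> (complex ^ 3) set" where
  "orb111 \<equiv> worbit (vector [1, 1, 1])"

definition W_cls :: "complex ^ 3 \<Rightarrow> complex \<Rightarrow> wpoint set" where
  "W_cls t g = cyc_orbit z4_act (orb111 t, g)"

text \<open>The point at infinity is sent to the base through \<open>chart2\<close>, whose points
  already identify \<open>g\<close> with \<open>- g\<close>.\<close>

definition W_pt :: "complex ^ 3 \<Rightarrow> complex \<Rightarrow> mpoint" where
  "W_pt t g = (if t $ 3 = 0 then chart2 (vector [g / 4, 0, 0])
     else Inl (pt3245 (t $ 1 / t $ 3) (t $ 2 / t $ 3) 1 0))"

text \<open>For \<open>c = \<i>\<close> this is the generator of the action; rotation by
  \<open>c\<close> goes with \<open>g\<close> multiplied by \<open>c^2\<close>.\<close>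

definition W_rot :: "complex \<Rightarrow> complex ^ 3 \<Rightarrow> complex ^ 3" where
  "W_rot c t = vector [c * t $ 1, c ^ 2 * t $ 2, t $ 3]"

lemma wcubic_iff: "vector [X, Y, T] \<in> wcubic (-2) g \<longleftrightarrow> X ^ 2 * T = 4 * Y ^ 3 + 2 * Y * T ^ 2 - g * T ^ 3"
  by (simp add: wcubic_def)

text \<open>At infinity the cubic reduces to \<open>4 Y^3 = 0\<close>.\<close>

lemma wcubic_infinity:
  assumes "t \<in> wcubic (-2) g - {0}" "t $ 3 = 0"
  shows "t $ 2 = 0" "t $ 1 \<noteq> 0"
proof -
  have "vector [t $ 1, t $ 2, t $ 3] \<in> wcubic (-2) g" using assms(1) unfolding vector_3_eta by blast
  then show "t $ 2 = 0" unfolding wcubic_iff using assms(2) by simp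
  with assms show "t $ 1 \<noteq> 0" by (auto simp: vec3_eq_iff)
qed

lemma orb111_eq_iff: "orb111 s = orb111 t \<longleftrightarrow> (\<exists>c. c \<noteq> 0 \<and> t = vector [c * s $ 1, c * s $ 2, c * s $ 3])"
  unfolding worbit_eq_iff vec3_eq_iff by simp

lemma orb111_iff: "s \<in> orb111 t \<longleftrightarrow> (\<exists>c. c \<noteq> 0 \<and> s = vector [c * t $ 1, c * t $ 2, c * t $ 3])"
  unfolding worbit_def vec3_eq_iff mem_Collect_eq vec_lambda_beta vector_3 power_one_right
  by (intro ex_cong1 iffI conjI; elim conjE; assumption)

lemma worbit_self: "t \<in> worbit w t"
  unfolding worbit_def by (auto intro!: exI[of _ 1] simp: vec_eq_iff)

lemma orb111_W_rot: "orb111 (W_rot c t) = W_rot c ` orb111 t"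
proof (intro set_eqI iffI)
  fix s assume "s \<in> orb111 (W_rot c t)"
  then obtain d where "d \<noteq> 0" "s = vector [d * (c * t $ 1), d * (c ^ 2 * t $ 2), d * t $ 3]"
    unfolding orb111_iff by (auto simp: W_rot_def)
  then have d: "d \<noteq> 0" and s: "s = W_rot c (vector [d * t $ 1, d * t $ 2, d * t $ 3])"
    by (simp_all add: W_rot_def mult.left_commute)
  have "vector [d * t $ 1, d * t $ 2, d * t $ 3] \<in> orb111 t"
    unfolding orb111_iff by (intro exI[of _ d] conjI refl d)
  with s show "s \<in> W_rot c ` orb111 t" by (rule image_eqI)
next
  fix s assume "s \<in> W_rot c ` orb111 t"
  then obtain r where "r \<in> orb111 t" "s = W_rot c r" by blast
  then obtain d where "d \<noteq> 0" "s = W_rot c (vector [d * t $ 1, d * t $ 2, d * t $ 3])"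
    unfolding orb111_iff by blast
  then show "s \<in> orb111 (W_rot c t)"
    unfolding orb111_iff by (intro exI[of _ d]) (simp add: W_rot_def mult.left_commute)
qed

lemma W_rot_W_rot: "W_rot c (W_rot d t) = W_rot (c * d) t"
  by (simp add: W_rot_def power_mult_distrib mult.assoc)

lemma W_rot_1: "W_rot 1 t = t"
  by (simp add: W_rot_def)

lemma W_cls_eq: "W_cls t g = (\<lambda>c. (orb111 (W_rot c t), c ^ 2 * g)) ` {c. c ^ 4 = 1}"
proof -
  let ?h = "\<lambda>c. (W_rot c ` orb111 t, c ^ 2 * g)"
  have i: "cis (2 * pi / real 4) = \<i>" by simp
  have "(z4_act ^^ n) (orb111 t, g) = ?h (cis (2 * pi / real 4) ^ n)" for n
    unfolding i
  proof (induction n)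
    case 0 then show ?case by (simp add: W_rot_1)
  next
    case (Suc n)
    have z4: "z4_act (\<xi>, h) = (W_rot \<i> ` \<xi>, - h)" for \<xi> h by (simp add: z4_act_def W_rot_def)
    have "W_rot \<i> ` W_rot d ` S = W_rot (\<i> * d) ` S" for d S
      by (simp add: image_image W_rot_W_rot)
    with Suc show ?case by (simp add: z4 power_mult_distrib)
  qed
  then have "W_cls t g = ?h ` {c. c ^ 4 = 1}" unfolding W_cls_def by (rule cyc_orbit_roots_unity[rotated]) simp
  then show ?thesis by (simp only: orb111_W_rot)
qed

lemma W_cls_cong: "orb111 s = orb111 t \<Longrightarrow> W_cls s g = W_cls t g"
  by (simp add: W_cls_def)

lemma W_cls_rot: assumes d: "d ^ 4 = 1" shows "W_cls (W_rot d t) (d ^ 2 * g) = W_cls t g"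
proof -
  have d0: "d \<noteq> 0" using d by auto
  have im: "{c. c ^ 4 = 1} = (\<lambda>c. c * d) ` {c :: complex. c ^ 4 = 1}"
  proof (intro set_eqI iffI)
    fix c :: complex assume "c \<in> {c. c ^ 4 = 1}"
    then show "c \<in> (\<lambda>c. c * d) ` {c. c ^ 4 = 1}"
      using d d0 by (intro image_eqI[of _ _ "c / d"]) (auto simp: power_divide)
  qed (use d in \<open>auto simp: power_mult_distrib\<close>)
  show ?thesis unfolding W_cls_eq[of t g] by (subst im, subst W_cls_eq)
    (simp add: image_image W_rot_W_rot power_mult_distrib mult.assoc)
qed

lemma fourth_root_square:
  fixes c :: complex assumes "c ^ 4 = 1" shows "c ^ 2 = 1 \<or> c ^ 2 = - 1"
proof -
  have "(c ^ 2 - 1) * (c ^ 2 + 1) = 0" using assms by (simp add: algebra_simps flip: power_add)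
  then show ?thesis by (auto simp: add_eq_0_iff2)
qed

text \<open>Scalings that keep the second coordinate \<open>1\<close> have \<open>c^4 = 1\<close>,
  so \<open>c^6 = c^2\<close> is a sign: the residual action on \<open>u2\<close>.\<close>

lemma chart2_base_eq_iff:
  "chart2 (vector [a, 0, 0]) = chart2 (vector [b, 0, 0]) \<longleftrightarrow> b = a \<or> b = - a"
proof
  assume "chart2 (vector [a, 0, 0]) = chart2 (vector [b, 0, 0])"
  then obtain c where c: "c ^ 4 = 1" "b = c ^ 6 * a" by (auto simp: chart2_Inr pt645_eq_iff)
  have "c ^ 6 = c ^ 4 * c ^ 2" by (simp flip: power_add)
  then show "b = a \<or> b = - a" using c fourth_root_square[OF c(1)] by auto
next
  assume "b = a \<or> b = - a"
  then show "chart2 (vector [a, 0, 0]) = chart2 (vector [b, 0, 0])"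
  proof
    assume "b = - a"
    have "\<i> ^ 4 = 1" "\<i> ^ 6 = - 1" by (simp_all add: eval_nat_numeral)
    then have "pt645 a 1 0 = pt645 b 1 0" unfolding pt645_eq_iff
      using \<open>b = - a\<close> by (intro exI[of _ \<i>]) auto
    then show ?thesis by (simp add: chart2_Inr)
  qed simp
qed

lemma W_pt_scale: "c \<noteq> 0 \<Longrightarrow> W_pt (vector [c * t $ 1, c * t $ 2, c * t $ 3]) g = W_pt t g"
  by (simp add: W_pt_def)

lemma W_pt_rot: assumes c: "c ^ 4 = 1" shows "W_pt (W_rot c t) (c ^ 2 * g) = W_pt t g"
proof (cases "t $ 3 = 0")
  case True
  then show ?thesis using fourth_root_square[OF c] by (auto simp: W_pt_def W_rot_def chart2_base_eq_iff)
next
  case False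
  have c0: "c \<noteq> 0" using c by auto
  have "c ^ 9 = c ^ 4 * c ^ 4 * c" "c ^ 6 = c ^ 4 * c ^ 2" "c ^ 12 = c ^ 4 * c ^ 4 * c ^ 4"
    by (simp_all add: eval_nat_numeral)
  with c have "c ^ 9 = c" "c ^ 6 = c ^ 2" "c ^ 12 = 1" by simp_all
  \<comment> \<open>Scaling by \<open>c ^ 3\<close> has exponents \<open>9\<close>,
    \<open>6\<close>, \<open>12\<close>, which modulo \<open>4\<close> are the \<open>1\<close>,
    \<open>2\<close>, \<open>0\<close> of the rotation.\<close>
  then have "pt3245 (t $ 1 / t $ 3) (t $ 2 / t $ 3) 1 0 = pt3245 (c * t $ 1 / t $ 3) (c ^ 2 * t $ 2 / t $ 3) 1 0"
    unfolding pt3245_eq_iff using c0 by (intro exI[of _ "c ^ 3"]) (auto simp flip: power_mult)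
  with False show ?thesis by (simp add: W_pt_def W_rot_def)
qed

definition W_map :: "wpoint set \<Rightarrow> mpoint" where
  "W_map q = the_elem (\<Union>(\<xi>, g)\<in>q. (\<lambda>t. W_pt t g) ` \<xi>)"

lemma W_map_cls: "W_map (W_cls t g) = W_pt t g"
proof -
  have *: "(\<lambda>t. W_pt t (c ^ 2 * g)) ` orb111 (W_rot c t) = {W_pt t g}" if c: "c ^ 4 = 1" for c
  proof -
    have "W_pt s (c ^ 2 * g) = W_pt t g" if "s \<in> orb111 (W_rot c t)" for s
      using that W_pt_scale[of _ "W_rot c t"] W_pt_rot[OF c] unfolding orb111_iff by auto
    then show ?thesis using worbit_self[of "W_rot c t"] by auto
  qed
  have "(\<Union>(\<xi>, g)\<in>W_cls t g. (\<lambda>t. W_pt t g) ` \<xi>) = (\<Union>c\<in>{c :: complex. c ^ 4 = 1}. {W_pt t g})"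
    unfolding W_cls_eq image_image by (intro SUP_cong refl) (use * in auto)
  also have "\<dots> = {W_pt t g}" by (auto intro: exI[of _ 1])
  finally show ?thesis by (simp add: W_map_def)
qed

lemma wcubic_affine:
  assumes "t \<in> wcubic (-2) g" "t $ 3 \<noteq> 0"
  shows "g = 4 * (t $ 2 / t $ 3) ^ 3 + 2 * (t $ 2 / t $ 3) - (t $ 1 / t $ 3) ^ 2"
    "orb111 t = orb111 (vector [t $ 1 / t $ 3, t $ 2 / t $ 3, 1])"
proof -
  have "vector [t $ 1, t $ 2, t $ 3] \<in> wcubic (-2) g" using assms by simp
  then have "t $ 1 ^ 2 * t $ 3 = 4 * t $ 2 ^ 3 + 2 * t $ 2 * t $ 3 ^ 2 - g * t $ 3 ^ 3" unfolding wcubic_iff .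
  then have "g * t $ 3 ^ 3 = 4 * t $ 2 ^ 3 + 2 * t $ 2 * t $ 3 ^ 2 - t $ 1 ^ 2 * t $ 3"
    by (simp add: algebra_simps)
  then have "g = (4 * t $ 2 ^ 3 + 2 * t $ 2 * t $ 3 ^ 2 - t $ 1 ^ 2 * t $ 3) / t $ 3 ^ 3"
    using assms(2) by (simp add: field_simps)
  also have "\<dots> = 4 * (t $ 2 / t $ 3) ^ 3 + 2 * (t $ 2 / t $ 3) - (t $ 1 / t $ 3) ^ 2"
    using assms(2) by (simp add: power_divide diff_divide_distrib add_divide_distrib power2_eq_square power3_eq_cube)
  finally show "g = \<dots>" .
  show "orb111 t = orb111 (vector [t $ 1 / t $ 3, t $ 2 / t $ 3, 1])"
    unfolding orb111_eq_iff using assms(2) by (intro exI[of _ "1 / t $ 3"]) simp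
qed

text \<open>A scaling between points with third coordinate \<open>1\<close> has
  \<open>c^4 = 1\<close>, hence is a rotation, and \<open>g\<close> is determined by the affine
  point. At infinity the base point gives \<open>g\<close> up to sign, and the group realises the
  sign.\<close>

lemma W_cls_inject:
  assumes t: "t \<in> wcubic (-2) g - {0}" and s: "s \<in> wcubic (-2) h - {0}" and eq: "W_pt t g = W_pt s h"
  shows "W_cls t g = W_cls s h"
proof (cases "t $ 3 = 0")
  case t3: True
  show ?thesis
  proof (cases "s $ 3 = 0")
    case s3: True
    with t3 eq have "chart2 (vector [g / 4, 0, 0]) = chart2 (vector [h / 4, 0, 0])" by (simp add: W_pt_def)
    then have "h = g \<or> h = - g" unfolding chart2_base_eq_iff by auto
    then obtain c where c: "c ^ 4 = 1" "h = c ^ 2 * g"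
    proof
      assume "h = g" then show ?thesis using that[of 1] by simp
    next
      assume "h = - g" then show ?thesis using that[of \<i>] by (simp add: eval_nat_numeral)
    qed
    have c0: "c \<noteq> 0" using c by auto
    have "orb111 (W_rot c t) = orb111 s"
      unfolding orb111_eq_iff using wcubic_infinity[OF t t3] wcubic_infinity[OF s s3] t3 s3 c0
      by (intro exI[of _ "s $ 1 / (c * t $ 1)"]) (simp add: W_rot_def vec3_eq_iff)
    then have "W_cls s h = W_cls (W_rot c t) (c ^ 2 * g)" unfolding c(2) using W_cls_cong by metis
    then show ?thesis using W_cls_rot[OF c(1)] by simp
  next
    case False
    with t3 eq show ?thesis by (simp add: W_pt_def chart2_Inr)
  qed
next
  case t3: False
  show ?thesis
  proof (cases "s $ 3 = 0")
    case True
    with t3 eq show ?thesis by (simp add: W_pt_def chart2_Inr)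
  next
    case s3: False
    define X Y X' Y' where "X = t $ 1 / t $ 3" "Y = t $ 2 / t $ 3" "X' = s $ 1 / s $ 3" "Y' = s $ 2 / s $ 3"
    note d = this
    from eq t3 s3 have "pt3245 X Y 1 0 = pt3245 X' Y' 1 0" by (simp add: W_pt_def d)
    then obtain c where c: "c \<noteq> 0" "X' = c ^ 3 * X" "Y' = c ^ 2 * Y" "c ^ 4 = 1"
      unfolding pt3245_eq_iff by auto
    have "c ^ 6 = c ^ 4 * c ^ 2" by (simp flip: power_add)
    then have c6: "c ^ 6 = c ^ 2" using c by simp
    have tg: "g = 4 * Y ^ 3 + 2 * Y - X ^ 2" "orb111 t = orb111 (vector [X, Y, 1])"
      using wcubic_affine[of t g] t t3 by (simp_all add: d)
    have sh: "h = 4 * Y' ^ 3 + 2 * Y' - X' ^ 2" "orb111 s = orb111 (vector [X', Y', 1])"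
      using wcubic_affine[of s h] s s3 by (simp_all add: d)
    \<comment> \<open>The projective scaling by \<open>c\<close> is the rotation by
      \<open>c ^ 3\<close>, which multiplies the parameter by \<open>c ^ 6\<close>.\<close>
    have h: "h = (c ^ 3) ^ 2 * g" unfolding sh(1) tg(1) c(2,3)
      by (simp add: power_mult_distrib c6 algebra_simps flip: power_mult)
    have "(c ^ 3) ^ 4 = (c ^ 4) ^ 3" by (simp flip: power_mult)
    then have "(c ^ 3) ^ 4 = 1" using c(4) by simp
    note rot = W_cls_rot[OF this, of "vector [X, Y, 1]" g]
    have "W_rot (c ^ 3) (vector [X, Y, 1]) = vector [X', Y', 1]"
      using c6 by (simp add: W_rot_def c(2,3) flip: power_mult)
    with rot have "W_cls (vector [X', Y', 1]) h = W_cls (vector [X, Y, 1]) g" by (simp add: h)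
    then show ?thesis using W_cls_cong[OF tg(2)] W_cls_cong[OF sh(2)] by simp
  qed
qed

section \<open>Maps into and out of the quotient of the Weierstrass family\<close>

lemma sheafy_W_space: "sheafy W_space"
  unfolding W_space_def by (intro sheafy_fquot sheafy_fsub sheafy_cspace)

lemma fpts_W_quot: "fpts W_quot = {W_cls t g | t g. t \<in> wcubic (-2) g - {0}}"
  unfolding fpts_cyc_quot fpts_W_space wcurve_def W_cls_def by blast

lemma hol_at_W_cls:
  assumes "t \<in> W_set"
  shows "hol_at (fsub cspace W_set) W_quot t (\<lambda>t. W_cls (vector [t $ 1, t $ 2, t $ 3]) (t $ 4))"
proof -
  have "t \<in> fpts (fsub cspace W_set)" using assms by simp
  note h1 = hol_at_fquot_proj[OF this, of W_hom]
  note h2 = hol_at_comp[OF h1 hol_at_fquot_proj[OF hol_at_pts(2)[OF h1], where \<pi> = "cyc_orbit z4_act"]]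
  have "hol_at (fsub cspace W_set) W_quot t (\<lambda>t. cyc_orbit z4_act (W_hom t))"
    unfolding cyc_quot_def W_space_def W_set_def[symmetric] by (rule h2[unfolded comp_def])
  then show ?thesis by (simp add: W_cls_def W_hom_def)
qed

lemma hol_at_W_quot_desc:
  assumes Y: "sheafy Y"
    and f: "\<And>t. t \<in> W_set \<Longrightarrow>
      hol_at (fsub cspace W_set) Y t (\<lambda>t. f (W_cls (vector [t $ 1, t $ 2, t $ 3]) (t $ 4)))"
    and q: "q \<in> fpts W_quot"
  shows "hol_at W_quot Y q f"
  unfolding cyc_quot_def
proof (rule hol_at_fquot_desc_all[OF sheafy_W_space Y])
  show "q \<in> fpts (fquot (cyc_orbit z4_act) W_space)" using q by (simp add: cyc_quot_def)
  fix x assume "x \<in> fpts W_space"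
  then show "hol_at W_space Y x (f \<circ> cyc_orbit z4_act)"
    unfolding W_space_def W_set_def[symmetric]
  proof (rule hol_at_fquot_desc_all[OF sheafy_fsub[OF sheafy_cspace] Y, rotated])
    fix t assume "t \<in> fpts (fsub cspace W_set)"
    then have "t \<in> W_set" by simp
    from f[OF this] show "hol_at (fsub cspace W_set) Y t (f \<circ> cyc_orbit z4_act \<circ> W_hom)"
      by (simp add: comp_def W_cls_def W_hom_def)
  qed
qed

text \<open>\<open>N\<close> is \<open>v\<^sub>2\<^sup>2 = T / Y\<close>, rewritten by means of the cubic so as to be defined at infinity.\<close>

lemma W_pt_chart2:
  assumes C: "X ^ 2 * T = 4 * Y ^ 3 + 2 * Y * T ^ 2 - g * T ^ 3" and X: "X \<noteq> 0"
    and D: "X ^ 2 - 2 * Y * T + g * T ^ 2 \<noteq> 0" and N: "N = 4 * Y ^ 2 / (X ^ 2 - 2 * Y * T + g * T ^ 2)"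
    and r: "r ^ 2 = 1 + (1 * N ^ 2 / 2 + (- g) * N ^ 3 / 4)" "1 + r \<noteq> 0" "r \<noteq> 0"
  shows "W_pt (vector [X, Y, T]) g =
    chart2 (vector [(- g) / 4 - N * (1 / 2 + (- g) * N / 4) ^ 2 / (1 + r) ^ 2, 2 * r * Y / X, 0])"
proof (cases "T = 0")
  case True
  with C have "Y = 0" by simp
  with True N show ?thesis by (simp add: W_pt_def chart2_base_eq_iff)
next
  case False
  define u where "u = (- g) / 4 - N * (1 / 2 + (- g) * N / 4) ^ 2 / (1 + r) ^ 2"
  define v where "v = 2 * r * Y / X"
  \<comment> \<open>The cubic with the factor \<open>T\<close> split off; it turns the quotient
    \<open>N\<close> into \<open>T / Y\<close>.\<close>
  have TD: "T * (X ^ 2 - 2 * Y * T + g * T ^ 2) = 4 * Y ^ 3"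
    using C by (simp add: algebra_simps power2_eq_square power3_eq_cube)
  with D False have Y: "Y \<noteq> 0" by auto
  have NT: "N = T / Y" unfolding N using TD D Y by (simp add: frac_eq_eq power2_eq_square power3_eq_cube algebra_simps)
  \<comment> \<open>Divided by \<open>Y^3\<close>, the cubic says
    \<open>X^2 T / Y^3 = 4 r^2\<close>, so \<open>v = 2 r Y / X\<close> is a square root of
    \<open>T / Y\<close>.\<close>
  have "v ^ 2 * X ^ 2 * Y = (4 * r ^ 2) * Y ^ 3" using X by (simp add: v_def power2_eq_square power3_eq_cube)
  also have "\<dots> = 4 * Y ^ 3 + 2 * Y * T ^ 2 - g * T ^ 3"
    unfolding r(1) NT using Y by (simp add: field_simps power2_eq_square power3_eq_cube)
  also have "\<dots> = X ^ 2 * T" using C by simp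
  finally have v2: "v ^ 2 = N" using X Y unfolding NT by (simp add: field_simps)
  have h: "2 * r = 2 + v ^ 6 * u + v ^ 4 / 2"
    using sqrt_expansion[OF r(1,2) u_def] unfolding v2[symmetric] by (simp flip: power_mult)
  have v0: "v \<noteq> 0" using r(3) X Y by (simp add: v_def)
  have "v ^ 3 * (X / T) = v ^ 2 * v * (X / T)" by (simp add: power2_eq_square power3_eq_cube)
  also have "\<dots> = N * v * (X / T)" by (simp only: v2)
  also have "\<dots> = 2 * r" unfolding NT v_def using X Y False by simp
  finally have x: "2 + v ^ 6 * u + v ^ 4 / 2 = v ^ 3 * (X / T)" using h by simp
  have y: "1 = v ^ 2 * (Y / T)" unfolding v2 NT using Y False by simp
  have "pt3245 (X / T) (Y / T) 1 0 = pt3245 (2 + v ^ 6 * u + v ^ 4 / 2) 1 (v ^ 4) 0"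
    unfolding pt3245_eq_iff x using v0 y by (intro exI[of _ v]) auto
  moreover have "chart2 (vector [u, v, 0]) = Inl (pt3245 (2 + v ^ 6 * u + v ^ 4 / 2) 1 (v ^ 4) 0)"
    using v0 by (simp add: chart2_Inl)
  moreover have "W_pt (vector [X, Y, T]) g = Inl (pt3245 (X / T) (Y / T) 1 0)"
    using False by (simp add: W_pt_def)
  ultimately show ?thesis unfolding u_def[symmetric] v_def[symmetric] by simp
qed

text \<open>At infinity \<open>T = Y = 0\<close> and \<open>X \<noteq> 0\<close>, so
  \<open>D\<close> equals \<open>X^2\<close> and both \<open>n\<close> and \<open>s\<close> vanish.
  Near such a point the formula is holomorphic in all four variables, also off the cubic.\<close>

lemma hol_at_W_pt:
  assumes t: "t \<in> W_set"
  shows "hol_at (fsub cspace W_set) M_I t (\<lambda>t. W_pt (vector [t $ 1, t $ 2, t $ 3]) (t $ 4))"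
proof (cases "t $ 3 = 0")
  case False
  let ?N = "{t :: complex ^ 4. t $ 3 \<noteq> 0}"
  have N: "open ?N" by (intro open_Collect_neq continuous_intros)
  show ?thesis
  proof (rule hol_at_fsub_extend[OF sheafy_cspace t, of _ _ ?N])
    show "hol_at cspace M_I t (\<lambda>t. Inl (pt3245 (t $ 1 / t $ 3) (t $ 2 / t $ 3) 1 0))"
      by (rule hol_at_M_I_Inl[of ?N]) (use N False in \<open>auto intro!: cdiff_intros\<close>)
  qed (use N False in \<open>auto simp: W_pt_def\<close>)
next
  case True
  have t': "vector [t $ 1, t $ 2, t $ 3] \<in> wcubic (-2) (t $ 4) - {0}" using t by (simp add: W_set_def)
  have t12: "t $ 2 = 0" "t $ 1 \<noteq> 0" using wcubic_infinity[OF t'] True by simp_all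
  define D where "D = (\<lambda>t :: complex ^ 4. t $ 1 ^ 2 - 2 * t $ 2 * t $ 3 + t $ 4 * t $ 3 ^ 2)"
  define n where "n = (\<lambda>t. 4 * t $ 2 ^ 2 / D t)"
  define s where "s = (\<lambda>t. 1 * n t ^ 2 / 2 + (- t $ 4) * n t ^ 3 / 4)"
  define S where "S = {t :: complex ^ 4. t $ 1 \<noteq> 0} \<inter> {t. D t \<noteq> 0}"
  have S: "open S" unfolding S_def D_def by (intro open_Int open_Collect_neq continuous_intros)
  have cD: "cdiff D y" for y unfolding D_def by (intro cdiff_intros)
  have cn: "cdiff n y" if "y \<in> S" for y
    unfolding n_def using that by (intro cdiff_intros cD) (auto simp: S_def)
  have cs: "cdiff s y" if "y \<in> S" for y
    unfolding s_def by (intro cdiff_intros cn that) auto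
  have "continuous_on S s"
  proof (rule continuous_at_imp_continuous_on, intro ballI)
    fix y assume "y \<in> S"
    from cs[OF this] show "isCont s y" unfolding cdiff_def using has_derivative_continuous by blast
  qed
  then have N: "open (S \<inter> s -` {x. 1 + x \<notin> \<real>\<^sub>\<le>\<^sub>0})"
    by (rule continuous_open_preimage[OF _ S]) (intro open_slit_vimage continuous_intros)
  let ?N = "S \<inter> s -` {x. 1 + x \<notin> \<real>\<^sub>\<le>\<^sub>0}"
  have tN: "t \<in> ?N" using True t12 by (simp add: s_def S_def D_def n_def)
  let ?L = "\<lambda>t. vector [(- t $ 4) / 4 - n t * (1 / 2 + (- t $ 4) * n t / 4) ^ 2 / (1 + csqrt (1 + s t)) ^ 2,
    2 * csqrt (1 + s t) * t $ 2 / t $ 1, 0] :: complex ^ 3"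
  have nz: "csqrt (1 + s y) \<noteq> 0" "1 + csqrt (1 + s y) \<noteq> 0" if "y \<in> ?N" for y
    using that csqrt_neq by auto
  have cq: "cdiff (\<lambda>t. csqrt (1 + s t)) y" if "y \<in> ?N" for y
    using that by (intro cdiff_intros cs) auto
  have "hol_at cspace cspace t ?L"
    by (rule hol_at_vec3[OF N tN]; intro cdiff_intros cq cn) (use nz in \<open>auto simp: S_def\<close>)
  from hol_at_comp[OF this hol_at_chart2]
  have F: "hol_at cspace M_I t (\<lambda>t. chart2 (?L t))" by (simp add: comp_def)
  show ?thesis
  proof (rule hol_at_fsub_extend[OF sheafy_cspace t F, of ?N])
    fix y assume y: "y \<in> ?N" "y \<in> W_set"
    then have "y $ 1 ^ 2 * y $ 3 = 4 * y $ 2 ^ 3 + 2 * y $ 2 * y $ 3 ^ 2 - y $ 4 * y $ 3 ^ 3"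
      by (simp only: W_set_def mem_Collect_eq Diff_iff wcubic_iff)
    then show "W_pt (vector [y $ 1, y $ 2, y $ 3]) (y $ 4) = chart2 (?L y)"
      by (rule W_pt_chart2) (use y(1) nz[OF y(1)] in \<open>auto simp: s_def S_def D_def n_def\<close>)
  qed (use N tN in auto)
qed

text \<open>With \<open>h = 2 + v^6 u + v^4 / 2\<close> the first three entries
  \<open>[h : v : v^3]\<close> represent \<open>(X, Y) = (h / v^3, 1 / v^2)\<close> and do not
  vanish together at \<open>v = 0\<close>. The last entry is minus the \<open>U\<close> of
  \<open>UVWz_of\<close> for \<open>z = 1\<close>.\<close>

definition W_of :: "complex ^ 3 \<Rightarrow> complex ^ 4" where
  "W_of t = vector [2 + t $ 2 ^ 6 * t $ 1 + t $ 2 ^ 4 / 2, t $ 2, t $ 2 ^ 3,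
    - 4 * t $ 1 - (t $ 2 ^ 3 * t $ 1 + t $ 2 / 2) ^ 2]"

lemma chart2_W_pt:
  shows "W_of t \<in> W_set"
    "chart2 (vector [t $ 1, t $ 2, 0]) = W_pt (vector [W_of t $ 1, W_of t $ 2, W_of t $ 3]) (W_of t $ 4)"
proof -
  define u v where "u = t $ 1" and "v = t $ 2"
  have L: "W_of t = vector [2 + v ^ 6 * u + v ^ 4 / 2, v, v ^ 3, - 4 * u - (v ^ 3 * u + v / 2) ^ 2]"
    by (simp add: W_of_def u_def v_def)
  have "vector [2 + v ^ 6 * u + v ^ 4 / 2, v, v ^ 3] \<noteq> (0 :: complex ^ 3)"
    by (cases "v = 0") (auto simp: vec3_eq_iff)
  then show "W_of t \<in> W_set"
    unfolding W_set_def mem_Collect_eq Diff_iff wcubic_iff L vector_4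
    by (simp add: field_simps eval_nat_numeral)
  show "chart2 (vector [t $ 1, t $ 2, 0]) = W_pt (vector [W_of t $ 1, W_of t $ 2, W_of t $ 3]) (W_of t $ 4)"
  proof (cases "v = 0")
    case True
    then show ?thesis unfolding L vector_4 by (simp add: W_pt_def chart2_base_eq_iff flip: u_def v_def)
  next
    case False
    have "pt3245 ((2 + v ^ 6 * u + v ^ 4 / 2) / v ^ 3) (v / v ^ 3) 1 0 = pt3245 (2 + v ^ 6 * u + v ^ 4 / 2) 1 (v ^ 4) 0"
      unfolding pt3245_eq_iff using False by (intro exI[of _ v]) (auto simp: power2_eq_square power3_eq_cube)
    then show ?thesis unfolding L vector_4 using False
      by (simp add: W_pt_def chart2_Inl flip: u_def v_def)
  qed
qed

lemma W_map_hol: "q \<in> fpts W_quot \<Longrightarrow> hol_at W_quot M_I q W_map"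
  by (rule hol_at_W_quot_desc[OF sheafy_M_I]; (unfold W_map_cls)?) (rule hol_at_W_pt)

lemma W_map_image: "W_map ` fpts W_quot = ell_total"
proof
  show "W_map ` fpts W_quot \<subseteq> ell_total"
    unfolding fpts_W_quot by (auto simp: W_map_cls W_pt_def chart2_Inr part_iffs)
  show "ell_total \<subseteq> W_map ` fpts W_quot"
  proof
    fix m assume m: "m \<in> ell_total"
    then have "m \<in> fpts M_I" using parts_subset by blast
    then obtain t g where "t \<in> wcubic (-2) g - {0}" "m = W_pt t g"
    proof (cases rule: M_I_cases)
      case (1 x y z e)
      with m have z: "z \<noteq> 0" "e = 0" by (auto simp: part_iffs)
      obtain r where r: "r ^ 4 = 1 / z" by (rule complex_nth_root_exists[of 4]) auto
      define X Y where "X = r ^ 3 * x" "Y = r ^ 2 * y"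
      have "pt3245 x y z e = pt3245 X Y 1 0" unfolding pt3245_eq_iff X_Y_def
        using r z by (intro exI[of _ r]) auto
      then have "m = W_pt (vector [X, Y, 1]) (4 * Y ^ 3 + 2 * Y - X ^ 2)" by (simp add: 1 W_pt_def)
      moreover have "vector [X, Y, 1] \<in> wcubic (-2) (4 * Y ^ 3 + 2 * Y - X ^ 2) - {0}"
        by (simp add: wcubic_iff vec3_eq_iff)
      ultimately show ?thesis using that by blast
    next
      case (2 a b c)
      with m have z: "b \<noteq> 0" "c = 0" by (auto simp: part_iffs)
      obtain r where r: "r ^ 4 = 1 / b" by (rule complex_nth_root_exists[of 4]) auto
      have "pt645 a b c = pt645 (r ^ 6 * a) 1 0" unfolding pt645_eq_iff
        using r z by (intro exI[of _ r]) auto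
      then have "m = W_pt (vector [1, 0, 0]) (4 * (r ^ 6 * a))" by (simp add: 2 W_pt_def chart2_Inr)
      moreover have "vector [1, 0, 0] \<in> wcubic (-2) (4 * (r ^ 6 * a)) - {0}"
        by (simp add: wcubic_iff vec3_eq_iff)
      ultimately show ?thesis using that by blast
    qed
    then show "m \<in> W_map ` fpts W_quot"
      unfolding fpts_W_quot by (intro image_eqI[of _ _ "W_cls t g"]) (auto simp: W_map_cls)
  qed
qed

lemma W_map_inj: "inj_on W_map (fpts W_quot)"
proof (rule inj_onI)
  fix p q assume "p \<in> fpts W_quot" "q \<in> fpts W_quot" and eq: "W_map p = W_map q"
  then obtain t g s h where "p = W_cls t g" "t \<in> wcubic (-2) g - {0}"
    "q = W_cls s h" "s \<in> wcubic (-2) h - {0}" unfolding fpts_W_quot by blast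
  with eq show "p = q" using W_cls_inject[of t g s h] by (simp only: W_map_cls)
qed

section \<open>The inverse on the elliptic piece\<close>

definition W_inv :: "mpoint \<Rightarrow> wpoint set" where
  "W_inv = inv_into (fpts W_quot) W_map"

lemma W_inv_W_pt: "t \<in> wcubic (-2) g - {0} \<Longrightarrow> W_inv (W_pt t g) = W_cls t g"
  unfolding W_inv_def W_map_cls[symmetric]
  by (rule inv_into_f_f[OF W_map_inj]) (auto simp: fpts_W_quot)

lemma W_inv_W_set:
  "t \<in> W_set \<Longrightarrow> W_inv (W_pt (vector [t $ 1, t $ 2, t $ 3]) (t $ 4)) = W_cls (vector [t $ 1, t $ 2, t $ 3]) (t $ 4)"
  by (rule W_inv_W_pt) (simp only: W_set_def mem_Collect_eq)

lemma W_inv_chart2_hol: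
  fixes t :: "complex ^ 3"
  shows "hol_at cspace W_quot t (\<lambda>t. W_inv (chart2 (vector [t $ 1, t $ 2, 0])))"
proof -
  have "hol_at cspace cspace t W_of"
    unfolding W_of_def by (rule hol_at_vec4[of UNIV]; (intro cdiff_intros)?) auto
  then have L: "hol_at cspace (fsub cspace W_set) t W_of"
    by (rule hol_at_fsub_cod[OF sheafy_cspace sheafy_cspace, of _ _ UNIV]) (auto simp: chart2_W_pt(1))
  show ?thesis unfolding chart2_W_pt(2) W_inv_W_set[OF chart2_W_pt(1)]
    using hol_at_comp[OF L hol_at_W_cls[OF chart2_W_pt(1)]] by (simp only: comp_def)
qed

text \<open>A fourth root normalises the third coordinate to \<open>1\<close>; the last entry of
  \<open>L\<close> is the parameter of the curve through the resulting point.\<close>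

lemma W_inv_Inl_hol:
  fixes t :: "complex ^ 3"
  assumes "t $ 3 \<noteq> 0"
  shows "hol_at cspace W_quot t (\<lambda>t. W_inv (Inl (pt3245 (t $ 1) (t $ 2) (t $ 3) 0)))"
proof -
  define L where "L = (\<lambda>c t :: complex ^ 3. vector [t $ 1 / c ^ 3, t $ 2 / c ^ 2, 1,
    4 * (t $ 2 / c ^ 2) ^ 3 + 2 * (t $ 2 / c ^ 2) - (t $ 1 / c ^ 3) ^ 2] :: complex ^ 4)"
  have LW: "L c y \<in> W_set" for c y
    unfolding W_set_def mem_Collect_eq Diff_iff L_def vector_4 wcubic_iff by (simp add: vec3_eq_iff)
  show ?thesis
  proof (rule hol_at_root_reparam[where k = 4 and L = L, OF _ assms _ hol_at_W_cls[OF LW]])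
    fix \<rho> N assume "open N" "t \<in> N" "\<And>y. y \<in> N \<Longrightarrow> \<rho> y \<noteq> 0" "\<And>y. y \<in> N \<Longrightarrow> cdiff \<rho> y"
    then have "hol_at cspace cspace t (\<lambda>y. L (\<rho> y) y)"
      unfolding L_def by (intro hol_at_vec4[of N] cdiff_intros) auto
    then show "hol_at cspace (fsub cspace W_set) t (\<lambda>y. L (\<rho> y) y)"
      by (rule hol_at_fsub_cod[OF sheafy_cspace sheafy_cspace, of _ _ UNIV]) (auto simp: LW)
  next
    fix c and y :: "complex ^ 3" assume c: "c \<noteq> 0" "c ^ 4 = y $ 3"
    have "pt3245 (y $ 1) (y $ 2) (y $ 3) 0 = pt3245 (y $ 1 / c ^ 3) (y $ 2 / c ^ 2) 1 0"
      unfolding pt3245_eq_iff using c by (intro exI[of _ "1 / c"]) (auto simp: power_divide)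
    then have "Inl (pt3245 (y $ 1) (y $ 2) (y $ 3) 0) = W_pt (vector [L c y $ 1, L c y $ 2, L c y $ 3]) (L c y $ 4)"
      unfolding L_def by (simp add: W_pt_def)
    then show "W_inv (Inl (pt3245 (y $ 1) (y $ 2) (y $ 3) 0)) = W_cls (vector [L c y $ 1, L c y $ 2, L c y $ 3]) (L c y $ 4)"
      by (simp only: W_inv_W_set[OF LW])
  qed simp
qed

text \<open>An equivariant map carries orbits onto orbits, which makes the retractions below well
  defined.\<close>

lemma image_worbit:
  assumes "\<And>c. c \<noteq> 0 \<Longrightarrow> F (\<chi> i. c ^ (w $ i) * x $ i) = (\<chi> i. c ^ (w' $ i) * F x $ i)"
  shows "F ` worbit w x = worbit w' (F x)"
proof (intro set_eqI iffI)
  fix y assume "y \<in> F ` worbit w x"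
  then obtain c where "c \<noteq> 0" "y = F (\<chi> i. c ^ (w $ i) * x $ i)" unfolding worbit_def by blast
  then show "y \<in> worbit w' (F x)" unfolding worbit_def by (auto simp: assms)
next
  fix y assume "y \<in> worbit w' (F x)"
  then obtain c where c: "c \<noteq> 0" "y = (\<chi> i. c ^ (w' $ i) * F x $ i)" unfolding worbit_def by blast
  then have "y = F (\<chi> i. c ^ (w $ i) * x $ i)" by (simp add: assms)
  moreover have "(\<chi> i. c ^ (w $ i) * x $ i) \<in> worbit w x" unfolding worbit_def using c(1) by blast
  ultimately show "y \<in> F ` worbit w x" by (rule image_eqI)
qed

text \<open>The strict transform of \<open>\<epsilon> = 0\<close> is not open, so functions on it have to be extended to the
  blow-up.  Two local retractions are used: \<open>(X\<^sub>3, Y\<^sub>3, \<epsilon>\<^sub>3) \<mapsto> (X\<^sub>3, Y\<^sub>3, 0)\<close>, and near the exceptional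
  divisor \<open>(u, v, w) \<mapsto> (u, v, 0)\<close>, whose shift \<open>w / 2\<close> in \<open>X\<^sub>2\<close> comes from the definition of \<open>u\<close>.\<close>

definition retr_affine :: "mpoint \<Rightarrow> mpoint" where
  "retr_affine m = (case m of Inl \<xi> \<Rightarrow> Inl ((\<lambda>t. vector [t $ 1, t $ 2, t $ 3, 0]) ` \<xi>) | Inr \<eta> \<Rightarrow> Inr \<eta>)"

definition retr_exc :: "mpoint \<Rightarrow> mpoint" where
  "retr_exc m = (case m of
     Inl \<xi> \<Rightarrow> Inl ((\<lambda>t. vector [t $ 1 + t $ 4 / (2 * t $ 2), t $ 2, t $ 3, 0]) ` \<xi>)
   | Inr \<eta> \<Rightarrow> Inr ((\<lambda>t. vector [t $ 1, t $ 2, 0]) ` \<eta>))"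

lemma retr_affine_Inl: "retr_affine (Inl (pt3245 x y z e)) = Inl (pt3245 x y z 0)"
proof -
  have "(\<lambda>t. vector [t $ 1, t $ 2, t $ 3, 0]) ` pt3245 x y z e = pt3245 x y z 0"
    unfolding pt3245_def by (subst image_worbit[where w' = w3245]) (simp_all add: vec4_eq_iff)
  then show ?thesis by (simp add: retr_affine_def)
qed

lemma retr_exc_Inl: "retr_exc (Inl (pt3245 x y z e)) = Inl (pt3245 (x + e / (2 * y)) y z 0)"
proof -
  \<comment> \<open>The shift \<open>e / (2 y)\<close> has weight \<open>5 - 2 = 3\<close>, the
    weight of \<open>x\<close>.\<close>
  have "c ^ 5 * e / (2 * (c ^ 2 * y)) = c ^ 3 * (e / (2 * y))" if "c \<noteq> 0" for c
    using that by (simp add: eval_nat_numeral)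
  then have "(\<lambda>t. vector [t $ 1 + t $ 4 / (2 * t $ 2), t $ 2, t $ 3, 0]) ` pt3245 x y z e = pt3245 (x + e / (2 * y)) y z 0"
    unfolding pt3245_def by (subst image_worbit[where w' = w3245]) (simp_all add: vec4_eq_iff distrib_left)
  then show ?thesis by (simp add: retr_exc_def)
qed

lemma retr_exc_Inr: "retr_exc (Inr (pt645 a b c)) = Inr (pt645 a b 0)"
proof -
  have "(\<lambda>t. vector [t $ 1, t $ 2, 0]) ` pt645 a b c = pt645 a b 0"
    unfolding pt645_def by (subst image_worbit[where w' = w645]) (simp_all add: vec3_eq_iff)
  then show ?thesis by (simp add: retr_exc_def)
qed

text \<open>Once \<open>w = 0\<close>, the change from the first chart to the second is a fourth
  root of \<open>v1\<close>.\<close>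

lemma retr_exc_chart1:
  assumes "k \<noteq> 0" "k ^ 4 = t $ 2"
  shows "retr_exc (chart1 t) = chart2 (vector [1 / k ^ 6, t $ 1 * k, 0])"
proof (cases "t $ 1 = 0")
  case True
  have "pt645 1 (t $ 2) 0 = pt645 (1 / k ^ 6) 1 0"
    unfolding pt645_eq_iff using assms by (intro exI[of _ "1 / k"]) (auto simp: power_divide)
  with True show ?thesis by (simp add: chart1_Inr chart2_Inr retr_exc_Inr)
next
  case False
  with assms(1) show ?thesis
    by (simp add: chart1_Inl chart2_Inl retr_exc_Inl power_mult_distrib flip: assms(2))
qed

lemma retr_exc_chart2: "retr_exc (chart2 t) = chart2 (vector [t $ 1, t $ 2, 0])"
  by (cases "t $ 2 = 0") (simp_all add: chart2_Inl chart2_Inr retr_exc_Inl retr_exc_Inr)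

lemma retr_exc_chart3:
  assumes "k \<noteq> 0" "k ^ 4 = t $ 2"
  shows "retr_exc (chart3 t) = chart2 (vector [t $ 1 / k ^ 6, t $ 3 * k, 0])"
proof (cases "t $ 3 = 0")
  case True
  have "pt645 (t $ 1) (t $ 2) 0 = pt645 (t $ 1 / k ^ 6) 1 0"
    unfolding pt645_eq_iff using assms by (intro exI[of _ "1 / k"]) (auto simp: power_divide)
  with True show ?thesis by (simp add: chart3_Inr chart2_Inr retr_exc_Inr)
next
  case False
  with assms(1) show ?thesis
    by (simp add: chart3_Inl chart2_Inl retr_exc_Inl power_mult_distrib flip: assms(2))
qed

text \<open>The set \<open>z \<noteq> 0\<close> is open and misses the exceptional divisor.
  \<open>W_inv\<close> after \<open>retr_affine\<close> is defined on all of it and extends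
  \<open>W_inv\<close>, because the retraction fixes the points with
  \<open>\<epsilon> = 0\<close>.\<close>

lemma W_inv_hol_affine:
  assumes z: "z \<noteq> 0"
  shows "hol_at (fsub M_I ell_total) W_quot (Inl (pt3245 x y z 0)) W_inv"
proof -
  define U :: "mpoint set" where "U = {Inl (pt3245 x y z e) | x y z e. z \<noteq> 0}"
  have iff: "Inl (pt3245 x y z e) \<in> U \<longleftrightarrow> z \<noteq> 0" for x y z e
  proof
    assume "Inl (pt3245 x y z e) \<in> U"
    then obtain x' y' z' e' where "z' \<noteq> 0" "pt3245 x y z e = pt3245 x' y' z' e'" unfolding U_def by auto
    then show "z \<noteq> 0" unfolding pt3245_eq_iff by auto
  qed (auto simp: U_def)
  have Inr: "Inr \<eta> \<notin> U" for \<eta> by (simp add: U_def)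
  have U: "fopen M_I U"
  proof (rule openin_M_I)
    show "U \<subseteq> fpts M_I" unfolding U_def by (auto simp: Inl_in_M_I_iff)
    have 0: "{t. t \<noteq> 0 \<and> Inl (worbit w3245 t) \<in> U} = {t. t $ 3 \<noteq> 0}"
      unfolding worbit_pt3245 iff by auto
    have 1: "chart1 t \<in> U \<longleftrightarrow> t $ 1 \<noteq> 0 \<and> t $ 2 \<noteq> 0" for t
      by (cases "t $ 1 = 0") (simp_all add: chart1_Inl chart1_Inr iff Inr)
    have 2: "chart2 t \<in> U \<longleftrightarrow> t $ 2 \<noteq> 0" for t
      by (cases "t $ 2 = 0") (simp_all add: chart2_Inl chart2_Inr iff Inr)
    have 3: "chart3 t \<in> U \<longleftrightarrow> t $ 3 \<noteq> 0 \<and> t $ 2 \<noteq> 0" for t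
      by (cases "t $ 3 = 0") (simp_all add: chart3_Inl chart3_Inr iff Inr)
    show "open {t. t \<noteq> 0 \<and> Inl (worbit w3245 t) \<in> U}" "open {t. chart1 t \<in> U}"
      "open {t. chart2 t \<in> U}" "open {t. chart3 t \<in> U}"
      unfolding 0 1 2 3 by (intro open_Collect_conj open_Collect_neq continuous_intros)+
  qed
  have mU: "Inl (pt3245 x y z 0) \<in> U" using z by (simp add: iff)
  have F: "hol_at M_I W_quot (Inl (pt3245 x y z 0)) (\<lambda>m. W_inv (retr_affine m))"
  proof (rule hol_at_M_I_desc[OF sheafy_cyc_quot[OF sheafy_W_space] U _ _ _ _ mU])
    fix t :: "complex ^ 4" assume "Inl (worbit w3245 t) \<in> U"
    then have t: "t $ 3 \<noteq> 0" by (simp add: worbit_pt3245 iff)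
    have L: "hol_at cspace cspace t (\<lambda>t. vector [t $ 1, t $ 2, t $ 3] :: complex ^ 3)"
      by (rule hol_at_vec3[of UNIV]) auto
    show "hol_at cspace W_quot t (\<lambda>t. W_inv (retr_affine (Inl (worbit w3245 t))))"
      unfolding worbit_pt3245 retr_affine_Inl
      using hol_at_comp[OF L W_inv_Inl_hol] t by (simp add: comp_def)
  qed (simp_all add: chart1_Inr chart2_Inr chart3_Inr Inr)
  show ?thesis
  proof (rule hol_at_fsub_extend[OF sheafy_M_I _ F U mU])
    show "Inl (pt3245 x y z 0) \<in> ell_total" using z by (simp add: part_iffs)
    fix m assume m: "m \<in> U" "m \<in> ell_total"
    then obtain x' y' z' e' where "m = Inl (pt3245 x' y' z' e')" unfolding U_def by blast
    with m show "W_inv m = W_inv (retr_affine m)" by (simp add: part_iffs retr_affine_Inl)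
  qed
qed

text \<open>\<open>U\<close> asks for \<open>y \<noteq> 0\<close> because the shift divides by
  \<open>y\<close>, and for \<open>z \<noteq> 0\<close> or \<open>b \<noteq> 0\<close> so that the
  retraction ends in \<open>ell_total\<close>, where \<open>W_inv\<close> is known.\<close>

lemma W_inv_hol_exc:
  assumes b: "b \<noteq> 0"
  shows "hol_at (fsub M_I ell_total) W_quot (Inr (pt645 a b 0)) W_inv"
proof -
  define U :: "mpoint set" where "U = {Inl (pt3245 x y z e) | x y z e. y \<noteq> 0 \<and> z \<noteq> 0} \<union>
    {Inr (pt645 a b c) | a b c. b \<noteq> 0}"
  have iff1: "Inl (pt3245 x y z e) \<in> U \<longleftrightarrow> y \<noteq> 0 \<and> z \<noteq> 0" for x y z e
  proof
    assume "Inl (pt3245 x y z e) \<in> U"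
    then obtain x' y' z' e' where "y' \<noteq> 0" "z' \<noteq> 0" "pt3245 x y z e = pt3245 x' y' z' e'" unfolding U_def by auto
    then show "y \<noteq> 0 \<and> z \<noteq> 0" unfolding pt3245_eq_iff by auto
  qed (auto simp: U_def)
  have iff2: "Inr (pt645 a b c) \<in> U \<longleftrightarrow> b \<noteq> 0" for a b c
  proof
    assume "Inr (pt645 a b c) \<in> U"
    then obtain a' b' c' where "b' \<noteq> 0" "pt645 a b c = pt645 a' b' c'" unfolding U_def by auto
    then show "b \<noteq> 0" unfolding pt645_eq_iff by auto
  qed (auto simp: U_def)
  have 1: "chart1 t \<in> U \<longleftrightarrow> t $ 2 \<noteq> 0" for t
    by (cases "t $ 1 = 0") (simp_all add: chart1_Inl chart1_Inr iff1 iff2)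
  have 2: "chart2 t \<in> U \<longleftrightarrow> True" for t
    by (cases "t $ 2 = 0") (simp_all add: chart2_Inl chart2_Inr iff1 iff2)
  have 3: "chart3 t \<in> U \<longleftrightarrow> t $ 2 \<noteq> 0" for t
    by (cases "t $ 3 = 0") (simp_all add: chart3_Inl chart3_Inr iff1 iff2)
  have U: "fopen M_I U"
  proof (rule openin_M_I)
    show "U \<subseteq> fpts M_I" unfolding U_def by (auto simp: Inl_in_M_I_iff Inr_in_M_I_iff)
    have 0: "{t. t \<noteq> 0 \<and> Inl (worbit w3245 t) \<in> U} = {t. t $ 2 \<noteq> 0 \<and> t $ 3 \<noteq> 0}"
      unfolding worbit_pt3245 iff1 by auto
    show "open {t. t \<noteq> 0 \<and> Inl (worbit w3245 t) \<in> U}" "open {t. chart1 t \<in> U}"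
      "open {t. chart2 t \<in> U}" "open {t. chart3 t \<in> U}"
      unfolding 0 1 2 3 by (intro open_Collect_conj open_Collect_neq open_Collect_const continuous_intros)+
  qed
  have mU: "Inr (pt645 a b 0) \<in> U" using b by (simp add: iff2)
  have F: "hol_at M_I W_quot (Inr (pt645 a b 0)) (\<lambda>m. W_inv (retr_exc m))"
  proof (rule hol_at_M_I_desc[OF sheafy_cyc_quot[OF sheafy_W_space] U _ _ _ _ mU])
    fix t :: "complex ^ 4" assume "Inl (worbit w3245 t) \<in> U"
    then have t: "t $ 2 \<noteq> 0" "t $ 3 \<noteq> 0" by (simp_all add: worbit_pt3245 iff1)
    have "open {t :: complex ^ 4. t $ 2 \<noteq> 0}" by (intro open_Collect_neq continuous_intros)
    then have L: "hol_at cspace cspace t (\<lambda>t. vector [t $ 1 + t $ 4 / (2 * t $ 2), t $ 2, t $ 3] :: complex ^ 3)"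
      by (rule hol_at_vec3) (use t in \<open>auto intro!: cdiff_intros\<close>)
    show "hol_at cspace W_quot t (\<lambda>t. W_inv (retr_exc (Inl (worbit w3245 t))))"
      unfolding worbit_pt3245 retr_exc_Inl
      using hol_at_comp[OF L W_inv_Inl_hol] t by (simp add: comp_def)
  next
    fix t :: "complex ^ 3"
    let ?L = "\<lambda>c t :: complex ^ 3. vector [1 / c ^ 6, t $ 1 * c, 0] :: complex ^ 3"
    assume "chart1 t \<in> U"
    then have t: "t $ 2 \<noteq> 0" by (simp add: 1)
    show "hol_at cspace W_quot t (\<lambda>t. W_inv (retr_exc (chart1 t)))"
    proof (rule hol_at_root_reparam[where k = 4 and L = ?L, OF _ t _ W_inv_chart2_hol])
      fix c and y :: "complex ^ 3" assume c: "c \<noteq> 0" "c ^ 4 = y $ 2"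
      show "W_inv (retr_exc (chart1 y)) = W_inv (chart2 (vector [?L c y $ 1, ?L c y $ 2, 0]))"
        using retr_exc_chart1[OF c] by simp
    next
    show "hol_at cspace cspace t (\<lambda>y. ?L (\<rho> y) y)"
      if "open N" "t \<in> N" "\<And>y. y \<in> N \<Longrightarrow> \<rho> y \<noteq> 0" "\<And>y. y \<in> N \<Longrightarrow> cdiff \<rho> y" for \<rho> N
      using that by (intro hol_at_vec3[of N] cdiff_intros) auto
  qed simp
  next
    fix t :: "complex ^ 3"
    show "hol_at cspace W_quot t (\<lambda>t. W_inv (retr_exc (chart2 t)))"
      unfolding retr_exc_chart2 by (rule W_inv_chart2_hol)
  next
    fix t :: "complex ^ 3"
    let ?L = "\<lambda>c t :: complex ^ 3. vector [t $ 1 / c ^ 6, t $ 3 * c, 0] :: complex ^ 3"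
    assume "chart3 t \<in> U"
    then have t: "t $ 2 \<noteq> 0" by (simp add: 3)
    show "hol_at cspace W_quot t (\<lambda>t. W_inv (retr_exc (chart3 t)))"
    proof (rule hol_at_root_reparam[where k = 4 and L = ?L, OF _ t _ W_inv_chart2_hol])
      fix c and y :: "complex ^ 3" assume c: "c \<noteq> 0" "c ^ 4 = y $ 2"
      show "W_inv (retr_exc (chart3 y)) = W_inv (chart2 (vector [?L c y $ 1, ?L c y $ 2, 0]))"
        using retr_exc_chart3[OF c] by simp
    next
    show "hol_at cspace cspace t (\<lambda>y. ?L (\<rho> y) y)"
      if "open N" "t \<in> N" "\<And>y. y \<in> N \<Longrightarrow> \<rho> y \<noteq> 0" "\<And>y. y \<in> N \<Longrightarrow> cdiff \<rho> y" for \<rho> N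
      using that by (intro hol_at_vec3[of N] cdiff_intros) auto
  qed simp
  qed
  show ?thesis
  proof (rule hol_at_fsub_extend[OF sheafy_M_I _ F U mU])
    show "Inr (pt645 a b 0) \<in> ell_total" using b by (simp add: part_iffs)
    fix m assume m: "m \<in> U" "m \<in> ell_total"
    then consider x y z e where "m = Inl (pt3245 x y z e)" | a b c where "m = Inr (pt645 a b c)"
      unfolding U_def by blast
    then show "W_inv m = W_inv (retr_exc m)"
      using m(2) by cases (simp_all add: part_iffs retr_exc_Inl retr_exc_Inr)
  qed
qed

lemma W_inv_hol:
  assumes m: "m \<in> ell_total" shows "hol_at (fsub M_I ell_total) W_quot m W_inv"
proof -
  have "m \<in> fpts M_I" using m parts_subset by blast
  then show ?thesis
  proof (cases rule: M_I_cases)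
    case (1 x y z e)
    with m have "z \<noteq> 0" "e = 0" by (simp_all add: part_iffs)
    with 1 W_inv_hol_affine show ?thesis by simp
  next
    case (2 a b c)
    with m have "b \<noteq> 0" "c = 0" by (simp_all add: part_iffs)
    with 2 W_inv_hol_exc show ?thesis by simp
  qed
qed

lemma W_map_biholomorphic: "biholomorphic_map W_quot (fsub M_I ell_total) W_map"
  by (rule biholomorphic_onto_fsub[OF sheafy_cyc_quot[OF sheafy_W_space] sheafy_M_I W_map_hol W_map_inj W_map_image])
    (auto simp flip: W_inv_def intro: W_inv_hol)

section \<open>The projection to the base\<close>

definition W_base :: "wpoint set \<Rightarrow> mpoint" where
  "W_base q = the_elem ((\<lambda>(\<xi>, g). chart2 (vector [g / 4, 0, 0])) ` q)"

text \<open>Defined through the family and not by coordinates of the blow-up, so that its holomorphy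
  descends from that of \<open>g / 4\<close>.\<close>

definition W_proj :: "mpoint \<Rightarrow> mpoint" where
  "W_proj m = W_base (W_inv m)"

lemma W_base_cls: "W_base (W_cls t g) = chart2 (vector [g / 4, 0, 0])"
proof -
  have "(\<lambda>(\<xi>, g). chart2 (vector [g / 4, 0, 0])) ` W_cls t g =
    (\<lambda>c. chart2 (vector [g / 4, 0, 0])) ` {c :: complex. c ^ 4 = 1}"
    unfolding W_cls_eq image_image
  proof (intro image_cong refl)
    fix c :: complex assume "c \<in> {c. c ^ 4 = 1}"
    then have "c ^ 2 = 1 \<or> c ^ 2 = - 1" using fourth_root_square by blast
    then show "(case (orb111 (W_rot c t), c ^ 2 * g) of (\<xi>, g) \<Rightarrow> chart2 (vector [g / 4, 0, 0])) =
      chart2 (vector [g / 4, 0, 0])" by (auto simp: chart2_base_eq_iff)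
  qed
  also have "\<dots> = {chart2 (vector [g / 4, 0, 0])}" by (auto intro!: image_eqI[of _ _ 1])
  finally show ?thesis by (simp add: W_base_def)
qed

lemma chart2_base_in_ell_base: "chart2 (vector [a, 0, 0]) \<in> ell_base"
  by (simp add: chart2_Inr Inr_in_ell_base)

lemma W_base_hol:
  assumes q: "q \<in> fpts W_quot" shows "hol_at W_quot (fsub M_I ell_base) q W_base"
proof (rule hol_at_fsub_cod[OF sheafy_cyc_quot[OF sheafy_W_space] sheafy_M_I, where ?N0.0 = "fpts W_quot"])
  show "hol_at W_quot M_I q W_base"
  proof (rule hol_at_W_quot_desc[OF sheafy_M_I _ q])
    fix t assume "t \<in> W_set"
    have L: "hol_at cspace cspace t (\<lambda>t. vector [t $ 4 / 4, 0, 0] :: complex ^ 3)"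
      by (rule hol_at_vec3[of UNIV]; (intro cdiff_intros)?) auto
    show "hol_at (fsub cspace W_set) M_I t (\<lambda>t. W_base (W_cls (vector [t $ 1, t $ 2, t $ 3]) (t $ 4)))"
      unfolding W_base_cls using hol_at_comp[OF L hol_at_chart2] \<open>t \<in> W_set\<close>
      by (intro hol_at_fsub_dom) (simp_all add: comp_def)
  qed
  show "W_base p \<in> ell_base" if "p \<in> fpts W_quot" for p
  proof -
    from that obtain t g where "p = W_cls t g" unfolding fpts_W_quot by blast
    then show ?thesis by (simp add: W_base_cls chart2_base_in_ell_base)
  qed
qed (use q in auto)

lemma W_proj_hol: "hol_map (fsub M_I ell_total) (fsub M_I ell_base) W_proj"
proof (rule hol_mapI)
  fix m assume "m \<in> fpts (fsub M_I ell_total)"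
  then have "m \<in> ell_total" by simp
  note h = W_inv_hol[OF this]
  from hol_at_comp[OF h W_base_hol[OF hol_at_pts(2)[OF h]]]
  show "hol_at (fsub M_I ell_total) (fsub M_I ell_base) m W_proj"
    unfolding W_proj_def[abs_def] by (simp add: comp_def)
qed (intro sheafy_fsub sheafy_M_I)+

lemma W_proj_W_pt:
  assumes "t \<in> wcubic (-2) g - {0}" shows "W_proj (W_pt t g) = chart2 (vector [g / 4, 0, 0])"
  by (simp only: W_proj_def W_inv_W_pt[OF assms] W_base_cls)

lemma ell_base_chart2:
  assumes "b \<in> ell_base" obtains a where "b = chart2 (vector [a, 0, 0])"
proof -
  obtain a0 b0 where ab: "b = Inr (pt645 a0 b0 0)" using assms by (auto simp: ell_base_def CP1_64_def)
  with assms have b0: "b0 \<noteq> 0" by (simp add: Inr_in_ell_base)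
  obtain r where r: "r ^ 4 = 1 / b0" by (rule complex_nth_root_exists[of 4]) auto
  have "pt645 a0 b0 0 = pt645 (r ^ 6 * a0) 1 0" unfolding pt645_eq_iff
    using r b0 by (intro exI[of _ r]) auto
  then have "b = chart2 (vector [r ^ 6 * a0, 0, 0])" by (simp add: ab chart2_Inr)
  then show ?thesis by (rule that)
qed

text \<open>A base point is the point at infinity of the curve it represents, so it lies in its own
  fiber.\<close>

lemma W_proj_base: assumes "b \<in> ell_base" shows "W_proj b = b"
proof -
  obtain a where a: "b = chart2 (vector [a, 0, 0])" by (rule ell_base_chart2[OF assms])
  have "b = W_pt (vector [1, 0, 0]) (4 * a)" by (simp add: a W_pt_def)
  moreover have "vector [1, 0, 0] \<in> wcubic (-2) (4 * a) - {0}" by (simp add: wcubic_iff vec3_eq_iff)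
  ultimately show ?thesis using W_proj_W_pt[of "vector [1, 0, 0]" "4 * a"] by (simp add: a)
qed

lemma W_map_orbit:
  assumes "\<xi> \<in> wcurve (-2) g"
  obtains t where "t \<in> wcubic (-2) g - {0}" "W_map (cyc_orbit z4_act (\<xi>, g)) = W_pt t g"
proof -
  obtain t where t: "t \<in> wcubic (-2) g - {0}" "\<xi> = orb111 t" using assms unfolding wcurve_def by blast
  then show ?thesis using that[of t] W_map_cls[of t g] by (simp add: W_cls_def)
qed

lemma W_proj_W_map:
  assumes "\<xi> \<in> wcurve (-2) g"
  shows "W_proj (W_map (cyc_orbit z4_act (\<xi>, g))) = chart2 (vector [g / 4, 0, 0])"
  using W_map_orbit[OF assms] W_proj_W_pt by metis

section \<open>The moduli space\<close>

lemma moduli_pt_normal: "moduli_pt (-2, g) = chart2 (vector [g / 4, 0, 0])"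
  by (simp add: moduli_pt_def chart2_Inr)

text \<open>The weights \<open>4\<close> and \<open>6\<close> of \<open>g2\<close> and
  \<open>g3\<close> are those of the projective line; \<open>wiso\<close> scales in the opposite
  direction, whence \<open>1 / c\<close>.\<close>

lemma moduli_pt_eq_iff: "moduli_pt a = moduli_pt b \<longleftrightarrow> wiso a b"
proof -
  obtain g2 g3 h2 h3 where ab: "a = (g2, g3)" "b = (h2, h3)" by (cases a, cases b)
  show ?thesis
  proof
    assume "moduli_pt a = moduli_pt b"
    then obtain c where "c \<noteq> 0" "h3 = c ^ 6 * g3" "h2 = c ^ 4 * g2"
      by (auto simp: moduli_pt_def ab pt645_eq_iff)
    then show "wiso a b" unfolding wiso_def ab by (auto intro!: exI[of _ "1 / c"] simp: power_divide)
  next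
    assume "wiso a b"
    then obtain c where "c \<noteq> 0" "g3 = c ^ 6 * h3" "g2 = c ^ 4 * h2" by (auto simp: wiso_def ab)
    then show "moduli_pt a = moduli_pt b"
      by (auto simp: moduli_pt_def ab pt645_eq_iff power_divide intro!: exI[of _ "1 / c"])
  qed
qed

lemma ell_base_moduli: "ell_base = moduli_pt ` {(g2, g3). g2 \<noteq> 0}"
proof
  show "ell_base \<subseteq> moduli_pt ` {(g2, g3). g2 \<noteq> 0}"
  proof
    fix b assume "b \<in> ell_base"
    then obtain a where "b = chart2 (vector [a, 0, 0])" by (rule ell_base_chart2)
    then have "b = moduli_pt (-2, 4 * a)" by (simp add: moduli_pt_normal)
    then show "b \<in> moduli_pt ` {(g2, g3). g2 \<noteq> 0}" by (rule image_eqI) simp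
  qed
  show "moduli_pt ` {(g2, g3). g2 \<noteq> 0} \<subseteq> ell_base" by (auto simp: moduli_pt_def Inr_in_ell_base)
qed

text \<open>With \<open>g2 = 0\<close> a sixth root rescales \<open>g3\<close> to any nonzero value,
  so the whole class is one point.\<close>

lemma moduli_pt_q: "g3 \<noteq> 0 \<Longrightarrow> moduli_pt (0, g3) = q_pt"
proof -
  assume g3: "g3 \<noteq> 0"
  obtain r where "r ^ 6 = 4 / g3" by (rule complex_nth_root_exists[of 6]) auto
  then have "pt645 (g3 / 4) 0 0 = pt645 1 0 0"
    unfolding pt645_eq_iff using g3 by (intro exI[of _ r]) auto
  then show ?thesis by (simp add: moduli_pt_def q_pt_eq)
qed

text \<open>A member with parameter \<open>g\<close> lies over \<open>moduli_pt (-2, g)\<close>, so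
  the fibers are compared by \<open>moduli_pt_eq_iff\<close>.\<close>

lemma W_fiber:
  "{m \<in> ell_total. W_proj m = moduli_pt (g2, g3)} =
     {W_map (cyc_orbit z4_act (\<xi>, g)) | \<xi> g. \<xi> \<in> wcurve (-2) g \<and> wiso (-2, g) (g2, g3)}"
proof (intro set_eqI iffI)
  fix m assume "m \<in> {m \<in> ell_total. W_proj m = moduli_pt (g2, g3)}"
  then have m: "m \<in> W_map ` fpts W_quot" "W_proj m = moduli_pt (g2, g3)" by (auto simp: W_map_image)
  then obtain q where q: "q \<in> fpts W_quot" "m = W_map q" by blast
  then obtain t g where t: "q = W_cls t g" "t \<in> wcubic (-2) g - {0}" unfolding fpts_W_quot by blast
  have "orb111 t \<in> wcurve (-2) g" unfolding wcurve_def using t(2) by blast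
  moreover have "m = W_map (cyc_orbit z4_act (orb111 t, g))" unfolding q t W_cls_def ..
  moreover have "W_proj m = moduli_pt (-2, g)"
    using W_proj_W_pt[OF t(2)] unfolding q t W_map_cls moduli_pt_normal .
  then have "moduli_pt (-2, g) = moduli_pt (g2, g3)" using m(2) by simp
  then have "wiso (-2, g) (g2, g3)" unfolding moduli_pt_eq_iff .
  ultimately show "m \<in> {W_map (cyc_orbit z4_act (\<xi>, g)) | \<xi> g. \<xi> \<in> wcurve (-2) g \<and> wiso (-2, g) (g2, g3)}"
    by blast
next
  fix m assume "m \<in> {W_map (cyc_orbit z4_act (\<xi>, g)) | \<xi> g. \<xi> \<in> wcurve (-2) g \<and> wiso (-2, g) (g2, g3)}"
  then obtain \<xi> g where m: "m = W_map (cyc_orbit z4_act (\<xi>, g))" "\<xi> \<in> wcurve (-2) g" "wiso (-2, g) (g2, g3)"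
    by blast
  have "W_proj m = moduli_pt (g2, g3)"
    using W_proj_W_map[OF m(2)] m(1,3) moduli_pt_eq_iff moduli_pt_normal by metis
  moreover have "cyc_orbit z4_act (\<xi>, g) \<in> fpts W_quot"
    unfolding fpts_cyc_quot fpts_W_space using m(2) by blast
  then have "m \<in> ell_total" unfolding m(1) using W_map_image by blast
  ultimately show "m \<in> {m \<in> ell_total. W_proj m = moduli_pt (g2, g3)}" by simp
qed

text \<open>The singular point is a double root \<open>y\<close> of the cubic:
  \<open>4 Y^3 - g2 Y - g3 = 4 (Y - y)^2 (Y + 2 y)\<close>.\<close>

lemma wsingular_iff: "wsingular g2 g3 \<longleftrightarrow> (\<exists>y. g2 = 12 * y ^ 2 \<and> g3 = - 8 * y ^ 3)"
proof
  assume "wsingular g2 g3"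
  then obtain t where t: "t \<in> wcubic g2 g3" "t \<noteq> 0" and D': "2 * t $ 1 * t $ 3 = 0"
    "- 12 * t $ 2 ^ 2 + g2 * t $ 3 ^ 2 = 0" "t $ 1 ^ 2 + 2 * g2 * t $ 2 * t $ 3 + 3 * g3 * t $ 3 ^ 2 = 0"
    unfolding wsingular_def Let_def by blast
  define X Y T where "X = t $ 1" "Y = t $ 2" "T = t $ 3"
  note d = this
  have C: "X ^ 2 * T = 4 * Y ^ 3 - g2 * Y * T ^ 2 - g3 * T ^ 3" "X \<noteq> 0 \<or> Y \<noteq> 0 \<or> T \<noteq> 0"
    using t by (auto simp: wcubic_def Let_def d vec3_eq_iff)
  have D: "2 * X * T = 0" "- 12 * Y ^ 2 + g2 * T ^ 2 = 0" "X ^ 2 + 2 * g2 * Y * T + 3 * g3 * T ^ 2 = 0"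
    unfolding d by (fact D')+
  \<comment> \<open>On \<open>T = 0\<close> the second and third derivative conditions force
    \<open>Y = 0\<close> and \<open>X = 0\<close>.\<close>
  have T: "T \<noteq> 0" using C D by auto
  then have X: "X = 0" using D(1) by simp
  define y where "y = Y / T"
  have Y: "Y = y * T" using T by (simp add: y_def)
  have "(g2 - 12 * y ^ 2) * T ^ 2 = 0" using D(2) unfolding Y by (simp add: algebra_simps power2_eq_square)
  then have g2: "g2 = 12 * y ^ 2" using T by simp
  have "(3 * T ^ 2) * (g3 + 8 * y ^ 3) = 0" using D(3) unfolding Y X g2
    by (simp add: algebra_simps power2_eq_square power3_eq_cube)
  then have "g3 + 8 * y ^ 3 = 0" using T by (simp only: mult_eq_0_iff) simp
  then have "g3 = - 8 * y ^ 3" by (simp add: eq_neg_iff_add_eq_0)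
  with g2 show "\<exists>y. g2 = 12 * y ^ 2 \<and> g3 = - 8 * y ^ 3" by blast
next
  assume "\<exists>y. g2 = 12 * y ^ 2 \<and> g3 = - 8 * y ^ 3"
  then obtain y where "g2 = 12 * y ^ 2" "g3 = - 8 * y ^ 3" by blast
  then show "wsingular g2 g3"
    unfolding wsingular_def wcubic_def Let_def
    by (intro bexI[of _ "vector [0, y, 1]"]) (auto simp: vec3_eq_iff power2_eq_square power3_eq_cube)
qed

text \<open>\<open>(12, - 8)\<close> is the case \<open>y = 1\<close>. A square root
  \<open>c\<close> of \<open>y\<close> rescales every other case to it, as
  \<open>g2 \<noteq> 0\<close> makes \<open>y\<close> nonzero.\<close>

lemma wsingular_unique:
  "\<exists>!b. b \<in> ell_base \<and> (\<exists>g2 g3. g2 \<noteq> 0 \<and> b = moduli_pt (g2, g3) \<and> wsingular g2 g3)"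
proof (rule ex1I[of _ "moduli_pt (12, - 8)"])
  have "wsingular 12 (- 8)" unfolding wsingular_iff by (intro exI[of _ 1]) simp
  moreover have "moduli_pt (12, - 8) \<in> ell_base" unfolding ell_base_moduli by (rule imageI) simp
  ultimately show "moduli_pt (12, - 8) \<in> ell_base \<and>
      (\<exists>g2 g3. g2 \<noteq> 0 \<and> moduli_pt (12, - 8) = moduli_pt (g2, g3) \<and> wsingular g2 g3)"
    by (intro conjI exI[of _ 12] exI[of _ "- 8"]) auto
next
  fix b assume "b \<in> ell_base \<and> (\<exists>g2 g3. g2 \<noteq> 0 \<and> b = moduli_pt (g2, g3) \<and> wsingular g2 g3)"
  then obtain y where y: "12 * y ^ 2 \<noteq> 0" "b = moduli_pt (12 * y ^ 2, - 8 * y ^ 3)"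
    unfolding wsingular_iff by auto
  obtain c where c: "c ^ 2 = y" by (rule complex_nth_root_exists[of 2]) auto
  have "wiso (12 * y ^ 2, - 8 * y ^ 3) (12, - 8)"
    unfolding wiso_def c[symmetric] using y(1) c by (auto intro!: exI[of _ c] simp flip: power_mult)
  then show "b = moduli_pt (12, - 8)" unfolding y(2) moduli_pt_eq_iff .
qed

text \<open>With weights \<open>3\<close> and \<open>2\<close> for \<open>X\<close> and
  \<open>Y\<close> the coefficients \<open>g2\<close> and \<open>g3\<close> pick up
  \<open>c^4\<close> and \<open>c^6\<close>.\<close>

definition curve_scale :: "complex \<Rightarrow> (complex ^ 3) set \<Rightarrow> (complex ^ 3) set" where
  "curve_scale c \<xi> = (\<lambda>t. vector [c ^ 3 * t $ 1, c ^ 2 * t $ 2, t $ 3]) ` \<xi>"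

lemma curve_scale_orb: "curve_scale c (orb111 t) = orb111 (vector [c ^ 3 * t $ 1, c ^ 2 * t $ 2, t $ 3])"
  unfolding curve_scale_def
  by (rule image_worbit) (simp add: vec3_eq_iff mult.left_commute)

lemma curve_scale_hol:
  assumes c: "c \<noteq> 0" and q: "q \<in> fpts CP2"
  shows "hol_at CP2 CP2 q (curve_scale c)"
proof (rule hol_at_wproj_desc[OF sheafy_wproj openin_topspace _ q])
  fix t :: "complex ^ 3" assume t: "t \<noteq> 0"
  have L: "hol_at cspace cspace t (\<lambda>t. vector [c ^ 3 * t $ 1, c ^ 2 * t $ 2, t $ 3] :: complex ^ 3)"
    by (rule hol_at_vec3[of UNIV]; (intro cdiff_intros)?) auto
  have "vector [c ^ 3 * t $ 1, c ^ 2 * t $ 2, t $ 3] \<noteq> (0 :: complex ^ 3)"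
    using t c by (auto simp: vec3_eq_iff)
  from hol_at_comp[OF L hol_at_worbit[OF this]]
  show "hol_at cspace CP2 t (\<lambda>t. curve_scale c (orb111 t))"
    unfolding curve_scale_orb comp_def .
qed

lemma curve_scale_wcurve:
  assumes c: "c \<noteq> 0" and \<xi>: "\<xi> \<in> wcurve g2 g3"
  shows "curve_scale c \<xi> \<in> wcurve (c ^ 4 * g2) (c ^ 6 * g3)"
proof -
  obtain t where t: "t \<in> wcubic g2 g3" "t \<noteq> 0" "\<xi> = orb111 t" using \<xi> unfolding wcurve_def by blast
  have C: "t $ 1 ^ 2 * t $ 3 = 4 * t $ 2 ^ 3 - g2 * t $ 2 * t $ 3 ^ 2 - g3 * t $ 3 ^ 3"
    using t(1) by (simp add: wcubic_def Let_def)
  have "(c ^ 3 * t $ 1) ^ 2 * t $ 3 = c ^ 6 * (t $ 1 ^ 2 * t $ 3)"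
    by (simp add: power_mult_distrib flip: power_mult)
  also have "\<dots> = 4 * (c ^ 2 * t $ 2) ^ 3 - c ^ 4 * g2 * (c ^ 2 * t $ 2) * t $ 3 ^ 2 - c ^ 6 * g3 * t $ 3 ^ 3"
    unfolding C by (simp add: algebra_simps eval_nat_numeral)
  finally have "vector [c ^ 3 * t $ 1, c ^ 2 * t $ 2, t $ 3] \<in> wcubic (c ^ 4 * g2) (c ^ 6 * g3)"
    by (simp add: wcubic_def Let_def)
  moreover have "vector [c ^ 3 * t $ 1, c ^ 2 * t $ 2, t $ 3] \<noteq> (0 :: complex ^ 3)"
    using t c by (auto simp: vec3_eq_iff)
  ultimately show ?thesis unfolding t(3) curve_scale_orb wcurve_def by blast
qed

lemma curve_scale_inverse: "c * d = 1 \<Longrightarrow> curve_scale c (curve_scale d \<xi>) = \<xi>"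
proof -
  assume cd: "c * d = 1"
  have "c ^ 3 * (d ^ 3 * a) = a" "c ^ 2 * (d ^ 2 * a) = a" for a
    using cd by (simp_all flip: mult.assoc power_mult_distrib)
  note * = this
  show ?thesis by (simp add: curve_scale_def image_image *)
qed

text \<open>Both directions are restrictions of linear automorphisms of the projective plane, which
  covers smooth and singular curves alike.\<close>

lemma wiso_biholomorphic:
  assumes "wiso (g2, g3) (h2, h3)"
  shows "\<exists>f. biholomorphic_map (fsub CP2 (wcurve g2 g3)) (fsub CP2 (wcurve h2 h3)) f"
proof -
  obtain c where c: "c \<noteq> 0" "g2 = c ^ 4 * h2" "g3 = c ^ 6 * h3" using assms by (auto simp: wiso_def)
  define d where "d = 1 / c"
  have d: "d \<noteq> 0" "c * d = 1" "d * c = 1" using c by (simp_all add: d_def)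
  have h: "h2 = d ^ 4 * g2" "h3 = d ^ 6 * g3" unfolding c using c(1) by (simp_all add: d_def power_divide)
  have hol: "hol_at (fsub CP2 S) (fsub CP2 S') q (curve_scale e)"
    if e: "e \<noteq> 0" and q: "q \<in> fpts (fsub CP2 S)" and S: "\<And>p. p \<in> S \<Longrightarrow> curve_scale e p \<in> S'" for e q S S'
  proof (rule hol_at_fsub_cod[OF sheafy_fsub[OF sheafy_wproj] sheafy_wproj, where ?N0.0 = "fpts (fsub CP2 S)"])
    show "hol_at (fsub CP2 S) CP2 q (curve_scale e)"
      by (rule hol_at_fsub_dom[OF curve_scale_hol[OF e]]) (use q in auto)
    show "fopen (fsub CP2 S) (fpts (fsub CP2 S))" by (rule openin_topspace)
    show "q \<in> fpts (fsub CP2 S)" by (rule q)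
    show "curve_scale e p \<in> S'" if "p \<in> fpts (fsub CP2 S)" for p using S that by simp
  qed
  have "biholomorphic_map (fsub CP2 (wcurve g2 g3)) (fsub CP2 (wcurve h2 h3)) (curve_scale d)"
  proof (rule biholomorphic_mapI)
    show "hol_at (fsub CP2 (wcurve g2 g3)) (fsub CP2 (wcurve h2 h3)) q (curve_scale d)"
      if "q \<in> fpts (fsub CP2 (wcurve g2 g3))" for q
      using hol[OF d(1) that] curve_scale_wcurve[OF d(1)] h by blast
    show "hol_at (fsub CP2 (wcurve h2 h3)) (fsub CP2 (wcurve g2 g3)) q (curve_scale c)"
      if "q \<in> fpts (fsub CP2 (wcurve h2 h3))" for q
      using hol[OF c(1) that] curve_scale_wcurve[OF c(1)] c by blast
  qed (use d in \<open>auto intro: sheafy_fsub sheafy_wproj simp: curve_scale_inverse\<close>)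
  then show ?thesis by blast
qed

section \<open>The projective line\<close>

abbreviation cp1 :: "complex \<Rightarrow> complex \<Rightarrow> (complex ^ 2) set" where
  "cp1 a b \<equiv> worbit (vector [1, 1]) (vector [a, b])"

lemma cp1_eq_iff: "cp1 a b = cp1 a' b' \<longleftrightarrow> (\<exists>c. c \<noteq> 0 \<and> a' = c * a \<and> b' = c * b)"
  unfolding worbit_eq_iff vec2_eq_iff by simp

text \<open>The union runs over equal sets, since \<open>x^2\<close> and \<open>y^3\<close> both
  have weight \<open>6\<close>. The exceptional divisor gets \<open>[4 : 1]\<close>, the value of
  the coordinate at \<open>p\<close>.\<close>

definition line_of :: "mpoint \<Rightarrow> (complex ^ 2) set" where
  "line_of m = (case m of Inl \<xi> \<Rightarrow> \<Union>t\<in>\<xi>. cp1 (t $ 1 ^ 2) (t $ 2 ^ 3) | Inr _ \<Rightarrow> cp1 4 1)"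

lemma worbit_memE:
  assumes "t \<in> worbit w x" obtains c where "c \<noteq> 0" "\<And>i. t $ i = c ^ (w $ i) * x $ i"
  using assms by (auto simp: worbit_def)

lemma line_of_Inl: "line_of (Inl (pt3245 x y z e)) = cp1 (x ^ 2) (y ^ 3)"
proof -
  have "cp1 (t $ 1 ^ 2) (t $ 2 ^ 3) = cp1 (x ^ 2) (y ^ 3)" if t: "t \<in> pt3245 x y z e" for t
  proof -
    obtain c where c: "c \<noteq> 0" "\<And>i. t $ i = c ^ (w3245 $ i) * vector [x, y, z, e] $ i"
      using t unfolding pt3245_def by (rule worbit_memE) blast
    have "t $ 1 = c ^ 3 * x" "t $ 2 = c ^ 2 * y" by (simp_all add: c(2))
    with c(1) have "cp1 (x ^ 2) (y ^ 3) = cp1 (t $ 1 ^ 2) (t $ 2 ^ 3)"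
      unfolding cp1_eq_iff by (intro exI[of _ "c ^ 6"]) (simp add: power_mult_distrib flip: power_mult)
    then show ?thesis ..
  qed
  moreover have "vector [x, y, z, e] \<in> pt3245 x y z e" unfolding pt3245_def by (rule worbit_self)
  ultimately show ?thesis unfolding line_of_def sum.case by (intro SUP_eq_const) auto
qed

lemma line_of_Inr: "line_of (Inr \<eta>) = cp1 4 1"
  by (simp add: line_of_def)

lemma line_of_chart1:
  "line_of (chart1 t) = cp1 ((2 + t $ 1 ^ 6 + t $ 1 ^ 4 * t $ 2 / 2 - t $ 1 ^ 5 * t $ 3 / 2) ^ 2) 1"
  by (cases "t $ 1 = 0") (simp_all add: chart1_Inl chart1_Inr line_of_Inl line_of_Inr)

lemma line_of_chart2:
  "line_of (chart2 t) = cp1 ((2 + t $ 2 ^ 6 * t $ 1 + t $ 2 ^ 4 / 2 - t $ 2 ^ 5 * t $ 3 / 2) ^ 2) 1"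
  by (cases "t $ 2 = 0") (simp_all add: chart2_Inl chart2_Inr line_of_Inl line_of_Inr)

lemma line_of_chart3:
  "line_of (chart3 t) = cp1 ((2 + t $ 3 ^ 6 * t $ 1 + t $ 3 ^ 4 * t $ 2 / 2 - t $ 3 ^ 5 / 2) ^ 2) 1"
  by (cases "t $ 3 = 0") (simp_all add: chart3_Inl chart3_Inr line_of_Inl line_of_Inr)

lemma hol_at_cp1:
  assumes "open N" "x \<in> N" "\<And>y. y \<in> N \<Longrightarrow> cdiff a y" "\<And>y. y \<in> N \<Longrightarrow> cdiff b y" "a x \<noteq> 0 \<or> b x \<noteq> 0"
  shows "hol_at cspace CP1 x (\<lambda>t. cp1 (a t) (b t))"
proof -
  have "vector [a x, b x] \<noteq> (0 :: complex ^ 2)" using assms(5) by (auto simp: vec2_eq_iff)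
  from hol_at_comp[OF hol_at_vec2[OF assms(1-4)] hol_at_worbit[OF this]]
  show ?thesis unfolding comp_def .
qed

text \<open>The coordinate is defined on the open set where \<open>x\<close> and \<open>y\<close> do
  not both vanish. In the charts \<open>y = 1\<close>, and its value
  \<open>(2 + u + v / 2 - w / 2)^2\<close> is a polynomial that is \<open>4\<close> on the
  divisor.\<close>

lemma line_of_hol:
  assumes m: "m \<in> line_part"
  shows "hol_at M_I CP1 m line_of"
proof -
  define U where "U = fpts M_I - {Inl (pt3245 0 0 z e) | z e. True}"
  have iff: "Inl (pt3245 x y z e) \<in> U \<longleftrightarrow> (x \<noteq> 0 \<or> y \<noteq> 0) \<and> (z \<noteq> 0 \<or> e \<noteq> 0 \<or> x ^ 2 \<noteq> 4 * y ^ 3)" for x y z e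
  proof -
    have "(\<exists>z' e'. pt3245 x y z e = pt3245 0 0 z' e') \<longleftrightarrow> x = 0 \<and> y = 0"
    proof
      assume "\<exists>z' e'. pt3245 x y z e = pt3245 0 0 z' e'"
      then show "x = 0 \<and> y = 0" unfolding pt3245_eq_iff by auto
    qed auto
    then show ?thesis by (auto simp: U_def Inl_in_M_I_iff)
  qed
  have iff2: "Inr (pt645 a b c) \<in> U \<longleftrightarrow> (a, b, c) \<noteq> (0, 0, 0)" for a b c
    by (auto simp: U_def Inr_in_M_I_iff)
  have U: "fopen M_I U"
  proof (rule openin_M_I)
    show "U \<subseteq> fpts M_I" by (auto simp: U_def)
    have 0: "{t. t \<noteq> 0 \<and> Inl (worbit w3245 t) \<in> U} =
      {t. (t $ 1 \<noteq> 0 \<or> t $ 2 \<noteq> 0) \<and> (t $ 3 \<noteq> 0 \<or> t $ 4 \<noteq> 0 \<or> t $ 1 ^ 2 \<noteq> 4 * t $ 2 ^ 3)}"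
      unfolding worbit_pt3245 iff by auto
    have 1: "chart1 t \<in> U \<longleftrightarrow> chart1 t \<noteq> Inl p_pt" for t
    proof
      assume "chart1 t \<in> U"
      then have "chart1 t \<in> fpts M_I" by (simp add: U_def)
      moreover have "Inl p_pt \<notin> fpts M_I" using Inl_in_M_I_iff[of 2 1 0 0] by (auto simp: p_pt_def)
      ultimately show "chart1 t \<noteq> Inl p_pt" by auto
    next
      assume "chart1 t \<noteq> Inl p_pt"
      then have c: "chart1 t \<in> fpts M_I" by (rule chart_in_M_I)
      show "chart1 t \<in> U"
      proof (cases "t $ 1 = 0")
        case False
        show ?thesis using c unfolding chart1_Inl[OF False] iff Inl_in_M_I_iff by simp
      qed (simp add: chart1_Inr iff2)
    qed
    have 2: "chart2 t \<in> U \<longleftrightarrow> True" for t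
      by (cases "t $ 2 = 0") (simp_all add: chart2_Inl chart2_Inr iff iff2)
    have 3: "chart3 t \<in> U \<longleftrightarrow> True" for t
      by (cases "t $ 3 = 0") (simp_all add: chart3_Inl chart3_Inr iff iff2)
    show "open {t. t \<noteq> 0 \<and> Inl (worbit w3245 t) \<in> U}"
      unfolding 0 by (intro open_Collect_conj open_Collect_disj open_Collect_neq continuous_intros)
    show "open {t. chart1 t \<in> U}" unfolding 1 by (rule open_chart1_dom)
    show "open {t. chart2 t \<in> U}" "open {t. chart3 t \<in> U}" unfolding 2 3 by simp_all
  qed
  have "m \<in> U"
  proof -
    have "m \<in> fpts M_I" using m parts_subset by blast
    then show ?thesis
    proof (cases rule: M_I_cases)
      case (1 x y z e)
      with m show ?thesis by (auto simp: part_iffs iff)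
    next
      case (2 a b c)
      then show ?thesis by (simp add: iff2)
    qed
  qed
  then show ?thesis
  proof (rule hol_at_M_I_desc[OF sheafy_wproj U, rotated -1])
    fix t :: "complex ^ 4" assume "Inl (worbit w3245 t) \<in> U"
    then have "t $ 1 \<noteq> 0 \<or> t $ 2 \<noteq> 0" by (simp add: worbit_pt3245 iff)
    then show "hol_at cspace CP1 t (\<lambda>t. line_of (Inl (worbit w3245 t)))"
      unfolding worbit_pt3245 line_of_Inl by (intro hol_at_cp1[of UNIV] cdiff_intros) auto
  next
    fix t :: "complex ^ 3"
    show "hol_at cspace CP1 t (\<lambda>t. line_of (chart1 t))"
      unfolding line_of_chart1 by (intro hol_at_cp1[of UNIV] cdiff_intros) auto
    show "hol_at cspace CP1 t (\<lambda>t. line_of (chart2 t))"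
      unfolding line_of_chart2 by (intro hol_at_cp1[of UNIV] cdiff_intros) auto
    show "hol_at cspace CP1 t (\<lambda>t. line_of (chart3 t))"
      unfolding line_of_chart3 by (intro hol_at_cp1[of UNIV] cdiff_intros) auto
  qed
qed

lemma line_part_cases:
  assumes "m \<in> line_part"
  obtains x y where "m = Inl (pt3245 x y 0 0)" "x ^ 2 \<noteq> 4 * y ^ 3" | "m = q_pt"
  using assms unfolding line_part_def by blast

lemma line_of_inj: "inj_on line_of line_part"
proof (rule inj_onI)
  have q: "line_of q_pt = cp1 4 1" by (simp add: q_pt_eq line_of_Inr)
  have neq: "cp1 (x ^ 2) (y ^ 3) \<noteq> cp1 4 1" if "x ^ 2 \<noteq> 4 * y ^ 3" for x y
  proof
    assume "cp1 (x ^ 2) (y ^ 3) = cp1 4 1"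
    then obtain c where c: "c \<noteq> 0" "4 = c * x ^ 2" "1 = c * y ^ 3" unfolding cp1_eq_iff by blast
    have "c * x ^ 2 = 4 * 1" using c(2) by simp
    also have "\<dots> = c * (4 * y ^ 3)" unfolding c(3) by simp
    finally show False using that c(1) by simp
  qed
  fix m n assume m: "m \<in> line_part" and n: "n \<in> line_part" and eq: "line_of m = line_of n"
  show "m = n"
    using m
  proof (cases rule: line_part_cases)
    case (1 x y)
    note mxy = this
    show ?thesis using n
    proof (cases rule: line_part_cases)
      case (1 x' y')
      have "cp1 (x ^ 2) (y ^ 3) = cp1 (x' ^ 2) (y' ^ 3)" using eq by (simp add: mxy 1 line_of_Inl)
      then obtain k where k: "k \<noteq> 0" "x' ^ 2 = k * x ^ 2" "y' ^ 3 = k * y ^ 3" unfolding cp1_eq_iff by blast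
      \<comment> \<open>If \<open>x\<close> or \<open>y\<close> vanishes, a single equation is left
        and a root of a ratio solves it; otherwise both have to be solved by one
        \<open>c\<close>.\<close>
      obtain c where c: "c \<noteq> 0" "x' = c ^ 3 * x" "y' = c ^ 2 * y"
      proof (cases "x = 0 \<or> y = 0")
        case True
        then show ?thesis
        proof
          assume x: "x = 0"
          with mxy have y: "y \<noteq> 0" by auto
          with k have y': "y' \<noteq> 0" by auto
          obtain c where c: "c ^ 2 = y' / y" by (rule complex_nth_root_exists[of 2]) auto
          then have "c ^ 2 \<noteq> 0" using y y' by simp
          then have "c \<noteq> 0" by auto
          moreover have "x' = c ^ 3 * x" "y' = c ^ 2 * y" using x y k c by simp_all
          ultimately show ?thesis by (rule that)
        next
          assume y: "y = 0"
          with mxy have x: "x \<noteq> 0" by auto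
          with k have x': "x' \<noteq> 0" by auto
          obtain c where c: "c ^ 3 = x' / x" by (rule complex_nth_root_exists[of 3]) auto
          then have "c ^ 3 \<noteq> 0" using x x' by simp
          then have "c \<noteq> 0" by auto
          moreover have "x' = c ^ 3 * x" "y' = c ^ 2 * y" using x y k c by simp_all
          ultimately show ?thesis by (rule that)
        qed
      next
        case False
        with k have nz: "x \<noteq> 0" "y \<noteq> 0" "x' \<noteq> 0" "y' \<noteq> 0" by auto
        define a b where "a = x' / x" and "b = y' / y"
        have a: "x' = a * x" and b: "y' = b * y" using nz by (simp_all add: a_def b_def)
        have ab0: "a \<noteq> 0" "b \<noteq> 0" using a b nz by auto
        have "a ^ 2 = k" using k(2) nz unfolding a by (simp add: power_mult_distrib)
        moreover have "b ^ 3 = k" using k(3) nz unfolding b by (simp add: power_mult_distrib)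
        ultimately have "a ^ 2 = b * b ^ 2" by (simp add: power3_eq_cube power2_eq_square mult.assoc)
        \<comment> \<open>The cusp \<open>a^2 = b^3\<close> is parametrised by
          \<open>c = a / b\<close>, with \<open>c^2 = b\<close> and \<open>c^3 = a\<close>.\<close>
        then have c2: "(a / b) ^ 2 = b" using ab0 by (simp add: power_divide)
        have "(a / b) ^ 3 = (a / b) * (a / b) ^ 2" by (simp only: power3_eq_cube power2_eq_square mult.assoc)
        also have "\<dots> = a" unfolding c2 using ab0 by simp
        finally have "(a / b) ^ 3 = a" .
        with c2 a b ab0 show ?thesis by (intro that[of "a / b"]) simp_all
      qed
      then have "pt3245 x y 0 0 = pt3245 x' y' 0 0" unfolding pt3245_eq_iff by auto
      then show ?thesis by (simp add: mxy 1)
    next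
      case 2
      then show ?thesis using eq mxy neq[of x y] q by (simp add: line_of_Inl)
    qed
  next
    case 2
    note mq = this
    show ?thesis using n
    proof (cases rule: line_part_cases)
      case (1 x y)
      then show ?thesis using eq mq neq[of x y] q by (simp add: line_of_Inl)
    qed (simp add: mq)
  qed
qed

lemma line_part_Inl: "x ^ 2 \<noteq> 4 * y ^ 3 \<Longrightarrow> Inl (pt3245 x y 0 0) \<in> line_part"
  by (simp add: part_iffs)

text \<open>With \<open>y = 1\<close> every value other than \<open>4\<close> is some
  \<open>r^2\<close>; the value \<open>4\<close> is taken at \<open>q\<close>, and
  \<open>[1 : 0]\<close> at \<open>y = 0\<close>.\<close>

lemma line_of_image: "line_of ` line_part = fpts CP1"
proof
  show "line_of ` line_part \<subseteq> fpts CP1"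
    using hol_at_pts(2)[OF line_of_hol] by blast
  show "fpts CP1 \<subseteq> line_of ` line_part"
  proof
    fix \<xi> assume "\<xi> \<in> fpts CP1"
    then obtain t :: "complex ^ 2" where t: "t \<noteq> 0" "\<xi> = cp1 (t $ 1) (t $ 2)" by auto
    show "\<xi> \<in> line_of ` line_part"
    proof (cases "t $ 2 = 0")
      case True
      then have "t $ 1 \<noteq> 0" using t by (auto simp: vec2_eq_iff)
      with True have "cp1 1 0 = cp1 (t $ 1) (t $ 2)" unfolding cp1_eq_iff by (intro exI[of _ "t $ 1"]) simp
      then have "\<xi> = line_of (Inl (pt3245 1 0 0 0))" using t by (simp add: line_of_Inl)
      then show ?thesis by (rule image_eqI) (simp add: part_iffs)
    next
      case False
      define s where "s = t $ 1 / t $ 2"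
      have "cp1 s 1 = cp1 (t $ 1) (t $ 2)" unfolding cp1_eq_iff s_def using False by (intro exI[of _ "t $ 2"]) simp
      then have \<xi>: "\<xi> = cp1 s 1" using t by simp
      show ?thesis
      proof (cases "s = 4")
        case True
        then have "\<xi> = line_of q_pt" by (simp add: \<xi> q_pt_eq line_of_Inr)
        then show ?thesis by (rule image_eqI) (simp add: line_part_def)
      next
        case s4: False
        obtain r where r: "r ^ 2 = s" by (rule complex_nth_root_exists[of 2]) auto
        then have "\<xi> = line_of (Inl (pt3245 r 1 0 0))" by (simp add: \<xi> line_of_Inl)
        then show ?thesis by (rule image_eqI) (use r s4 in \<open>simp add: part_iffs\<close>)
      qed
    qed
  qed
qed

section \<open>The inverse on the projective line\<close>

definition line_inv :: "(complex ^ 2) set \<Rightarrow> mpoint" where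
  "line_inv = inv_into line_part line_of"

lemma line_inv_line_of: "m \<in> line_part \<Longrightarrow> line_inv (line_of m) = m"
  unfolding line_inv_def by (rule inv_into_f_f[OF line_of_inj])

lemma hol_at_cline_M_I:
  assumes "\<And>s. (\<lambda>s. a s) field_differentiable at s" "\<And>s. b field_differentiable at s" "a x ^ 2 \<noteq> 4 * b x ^ 3"
  shows "hol_at cline M_I x (\<lambda>s. Inl (pt3245 (a s) (b s) 0 0))"
proof -
  have "hol_at cline cspace x (\<lambda>s. vector [a s, b s, 0, 0] :: complex ^ 4)"
  proof (rule hol_at_cline_cspaceI[of UNIV])
    fix y :: complex and i :: 4
    have "\<forall>i :: 4. (\<lambda>s. (vector [a s, b s, 0, 0] :: complex ^ 4) $ i) field_differentiable at y"
      unfolding forall_4 vector_4 using assms by (simp add: field_differentiable_const)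
    then show "(\<lambda>s. (vector [a s, b s, 0, 0] :: complex ^ 4) $ i) field_differentiable at y" by blast
  qed auto
  from hol_at_comp[OF this hol_at_M_I_worbit] assms(3) show ?thesis
    by (simp add: comp_def worbit_pt3245)
qed

text \<open>At the points \<open>[x : 0]\<close>, \<open>[0 : y]\<close> and \<open>q\<close> the piece is parametrised by a quotient of a disc by
  \<open>\<int>\<^sub>3\<close>, \<open>\<int>\<^sub>2\<close> and \<open>\<int>\<^sub>6\<close>, whose coordinates are the powers.\<close>

lemma line_inv_finite_hol: "hol_at cline M_I s (\<lambda>s. line_inv (cp1 s 1))"
proof (cases "s = 4")
  case False
  show ?thesis
  proof (rule hol_at_root_desc[OF sheafy_M_I, of 2 "- {4}" "\<lambda>x. Inl (pt3245 x 1 0 0)"])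
    fix x :: complex assume "x ^ 2 \<in> - {4}"
    then have x: "x ^ 2 \<noteq> 4 * 1 ^ 3" by simp
    then show "hol_at cline M_I x (\<lambda>x. Inl (pt3245 x 1 0 0))"
      by (intro hol_at_cline_M_I) (auto simp: field_differentiable_ident field_differentiable_const)
    show "line_inv (cp1 (x ^ 2) 1) = Inl (pt3245 x 1 0 0)"
      using line_inv_line_of[OF line_part_Inl[OF x]] by (simp add: line_of_Inl)
  qed (use False in \<open>auto simp: open_Compl\<close>)
next
  case True
  have \<sigma>: "hol_at cline M_I 0 (\<lambda>s. line_inv (cp1 ((2 + s) ^ 2) 1))"
  \<comment> \<open>Along the strict transform \<open>u = u1^6\<close> and the coordinate is
    \<open>(2 + u)^2\<close>; the excluded value \<open>-4\<close> is where the chart returns to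
    \<open>p\<close>.\<close>
  proof (rule hol_at_root_desc[OF sheafy_M_I, of 6 "- {- 4}" "\<lambda>u. chart1 (vector [u, 0, 0])"])
    fix u :: complex assume "u ^ 6 \<in> - {- 4}"
    then have u: "u ^ 6 \<noteq> - 4" by simp
    then have c: "chart1 (vector [u, 0, 0]) \<noteq> Inl p_pt" by (simp add: chart1_eq_p_iff)
    have "hol_at cline cspace u (\<lambda>s. vector [s, 0, 0] :: complex ^ 3)"
    proof (rule hol_at_cline_cspaceI[of UNIV])
      fix y :: complex and i :: 3
      have "\<forall>i :: 3. (\<lambda>s. (vector [s, 0, 0] :: complex ^ 3) $ i) field_differentiable at y"
        unfolding forall_3 vector_3 by (simp add: field_differentiable_const field_differentiable_ident)
      then show "(\<lambda>s. (vector [s, 0, 0] :: complex ^ 3) $ i) field_differentiable at y" by blast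
    qed auto
    from hol_at_comp[OF this hol_at_chart1[OF c]]
    show "hol_at cline M_I u (\<lambda>u. chart1 (vector [u, 0, 0]))" by (simp add: comp_def)
    have "chart1 (vector [u, 0, 0]) \<in> line_part"
    proof (cases "u = 0")
      case False
      have "(2 + u ^ 6) ^ 2 - 4 = u ^ 6 * (u ^ 6 + 4)" by (simp add: algebra_simps power2_eq_square)
      moreover have "u ^ 6 + 4 \<noteq> 0" using u by (simp add: eq_neg_iff_add_eq_0)
      ultimately have "(2 + u ^ 6) ^ 2 \<noteq> 4" using False by auto
      with False show ?thesis by (simp add: chart1_Inl part_iffs)
    qed (simp add: chart1_Inr part_iffs)
    from line_inv_line_of[OF this]
    show "line_inv (cp1 ((2 + u ^ 6) ^ 2) 1) = chart1 (vector [u, 0, 0])"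
      by (simp add: line_of_chart1)
  qed (auto simp: open_Compl)
  show ?thesis unfolding True
  \<comment> \<open>Near \<open>4\<close> the coordinate \<open>(2 + u)^2\<close> is inverted by
    \<open>u = csqrt s - 2\<close>.\<close>
  proof (rule hol_at_comp'[OF sheafy_cline])
    let ?N = "- \<real>\<^sub>\<le>\<^sub>0 :: complex set"
    show "hol_at cline cline 4 (\<lambda>t. csqrt t - 2)"
      by (rule hol_at_cline_clineI[of ?N])
        (auto simp: open_Compl intro!: field_differentiable_diff field_differentiable_at_csqrt)
    show "hol_at cline M_I (csqrt 4 - 2) (\<lambda>s. line_inv (cp1 ((2 + s) ^ 2) 1))" using \<sigma> by simp
    show "fopen cline UNIV" "4 \<in> (UNIV :: complex set)" by auto
    show "line_inv (cp1 y 1) = line_inv (cp1 ((2 + (csqrt y - 2)) ^ 2) 1)" for y by simp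
  qed
qed

text \<open>With \<open>x = 1\<close> the coordinate is \<open>s = y^3\<close>; the excluded value
  \<open>1 / 4\<close> is the one at \<open>p\<close>.\<close>

lemma line_inv_infinite_hol: "hol_at cline M_I 0 (\<lambda>s. line_inv (cp1 1 s))"
proof (rule hol_at_root_desc[OF sheafy_M_I, of 3 "- {1 / 4}" "\<lambda>y. Inl (pt3245 1 y 0 0)"])
  fix y :: complex assume "y ^ 3 \<in> - {1 / 4}"
  have y: "1 ^ 2 \<noteq> 4 * y ^ 3"
  proof
    assume "1 ^ 2 = 4 * y ^ 3"
    then have "y ^ 3 = 1 / 4" by (simp add: field_simps)
    with \<open>y ^ 3 \<in> - {1 / 4}\<close> show False by simp
  qed
  then show "hol_at cline M_I y (\<lambda>y. Inl (pt3245 1 y 0 0))"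
    by (intro hol_at_cline_M_I) (auto simp: field_differentiable_ident field_differentiable_const)
  show "line_inv (cp1 1 (y ^ 3)) = Inl (pt3245 1 y 0 0)"
    using line_inv_line_of[OF line_part_Inl[OF y]] by (simp add: line_of_Inl)
qed (auto simp: open_Compl)

lemma line_inv_hol:
  assumes q: "q \<in> fpts CP1" shows "hol_at CP1 M_I q line_inv"
proof (rule hol_at_wproj_desc[OF sheafy_M_I openin_topspace _ q])
  fix t :: "complex ^ 2" assume t: "t \<noteq> 0"
  show "hol_at cspace M_I t (\<lambda>t. line_inv (worbit (vector [1, 1]) t))"
  proof (cases "t $ 2 = 0")
    case False
    let ?N = "{t :: complex ^ 2. t $ 2 \<noteq> 0}"
    have N: "open ?N" by (intro open_Collect_neq continuous_intros)
    have h: "hol_at cspace cline t (\<lambda>t. t $ 1 / t $ 2)"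
      by (rule hol_at_cspace_clineI[OF N]) (use False in \<open>auto intro!: cdiff_intros\<close>)
    show ?thesis
    proof (rule hol_at_comp'[OF sheafy_cspace h line_inv_finite_hol, of ?N])
      fix y :: "complex ^ 2" assume "y \<in> ?N"
      then have "cp1 (y $ 1 / y $ 2) 1 = cp1 (y $ 1) (y $ 2)"
        unfolding cp1_eq_iff by (intro exI[of _ "y $ 2"]) simp
      then show "line_inv (worbit (vector [1, 1]) y) = line_inv (cp1 (y $ 1 / y $ 2) 1)" by simp
    qed (use N False in auto)
  next
    case True
    then have t1: "t $ 1 \<noteq> 0" using t by (auto simp: vec2_eq_iff)
    let ?N = "{t :: complex ^ 2. t $ 1 \<noteq> 0}"
    have N: "open ?N" by (intro open_Collect_neq continuous_intros)
    have h: "hol_at cspace cline t (\<lambda>t. t $ 2 / t $ 1)"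
      by (rule hol_at_cspace_clineI[OF N]) (use t1 in \<open>auto intro!: cdiff_intros\<close>)
    have 0: "t $ 2 / t $ 1 = 0" using True by simp
    show ?thesis
    proof (rule hol_at_comp'[OF sheafy_cspace h line_inv_infinite_hol[folded 0], of ?N])
      fix y :: "complex ^ 2" assume "y \<in> ?N"
      then have "cp1 1 (y $ 2 / y $ 1) = cp1 (y $ 1) (y $ 2)"
        unfolding cp1_eq_iff by (intro exI[of _ "y $ 1"]) simp
      then show "line_inv (worbit (vector [1, 1]) y) = line_inv (cp1 1 (y $ 2 / y $ 1))" by simp
    qed (use N t1 in auto)
  qed
qed

text \<open>\<open>line_of\<close> is already holomorphic as a map from \<open>M_I\<close> near the
  piece, so it only has to be restricted; the work lies in \<open>line_inv\<close>.\<close>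

lemma line_inv_biholomorphic: "biholomorphic_map CP1 (fsub M_I line_part) line_inv"
proof (rule biholomorphic_mapI)
  show "sheafy CP1" by (rule sheafy_wproj)
  show "sheafy (fsub M_I line_part)" by (intro sheafy_fsub sheafy_M_I)
  have inv: "line_inv q \<in> line_part" "line_of (line_inv q) = q" if "q \<in> fpts CP1" for q
    using that inv_into_into[of q line_of line_part] f_inv_into_f[of q line_of line_part]
    unfolding line_inv_def line_of_image[symmetric] by blast+
  show "hol_at CP1 (fsub M_I line_part) q line_inv" if "q \<in> fpts CP1" for q
    by (rule hol_at_fsub_cod[OF sheafy_wproj sheafy_M_I line_inv_hol[OF that] openin_topspace that inv(1)])
  show "hol_at (fsub M_I line_part) CP1 m line_of" if "m \<in> fpts (fsub M_I line_part)" for m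
    by (rule hol_at_fsub_dom[OF line_of_hol]) (use that in auto)
  show "line_of (line_inv q) = q" if "q \<in> fpts CP1" for q by (rule inv(2)[OF that])
  show "line_inv (line_of m) = m" if "m \<in> fpts (fsub M_I line_part)" for m
    by (rule line_inv_line_of) (use that in auto)
qed

theorem theorem8p1:
  shows "\<exists>A C.
    \<comment> \<open>the decomposition\<close>
    fpts M_I = A \<union> ell_total \<union> C \<and> A \<inter> ell_total = {} \<and> A \<inter> C = {} \<and> ell_total \<inter> C = {} \<and>

    \<comment> \<open>(1) the fiber space divided by the cyclic group of order 5\<close>
    (\<exists>\<Phi>. biholomorphic_map (cyc_quot z5_act P_space) (fsub M_I A) \<Phi> \<and>
      (\<forall>x y z. \<Phi> (cyc_orbit z5_act (P_xyz (vector [x, y, z]))) = Inl (pt3245 x y z 1))) \<and>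

    \<comment> \<open>(2) the elliptic fibration, i.e. the Weierstrass family divided by the cyclic group of order 4\<close>
    (\<exists>\<Phi> \<pi>. biholomorphic_map (cyc_quot z4_act W_space) (fsub M_I ell_total) \<Phi> \<and>
      (\<forall>X Y. \<Phi> (cyc_orbit z4_act (W_hom (vector [X, Y, 1, 4 * Y ^ 3 + 2 * Y - X ^ 2])))
               = Inl (pt3245 X Y 1 0)) \<and>
      (\<forall>g3. \<Phi> (cyc_orbit z4_act (W_hom (vector [1, 0, 0, g3]))) = chart2 (vector [g3 / 4, 0, 0])) \<and>
      hol_map (fsub M_I ell_total) (fsub M_I ell_base) \<pi> \<and>
      (\<forall>b\<in>ell_base. \<pi> b = b) \<and>
      (\<forall>\<xi> g3. \<xi> \<in> wcurve (-2) g3 \<longrightarrow>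
         \<pi> (\<Phi> (cyc_orbit z4_act (\<xi>, g3))) = chart2 (vector [g3 / 4, 0, 0])) \<and>
      \<comment> \<open>the fiber over a point of the moduli space is the isomorphism class of curves it represents\<close>
      (\<forall>g2 g3. g2 \<noteq> 0 \<longrightarrow> {m \<in> ell_total. \<pi> m = moduli_pt (g2, g3)} =
         {\<Phi> (cyc_orbit z4_act (\<xi>, g)) | \<xi> g. \<xi> \<in> wcurve (-2) g \<and> wiso (-2, g) (g2, g3)})) \<and>
    \<comment> \<open>the base is the moduli space of the curves with nonzero g2\<close>
    ell_base = moduli_pt ` {(g2, g3). g2 \<noteq> 0} \<and>
    (\<forall>a b. fst a \<noteq> 0 \<and> fst b \<noteq> 0 \<longrightarrow> (moduli_pt a = moduli_pt b \<longleftrightarrow> wiso a b)) \<and>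
    (\<forall>g3. g3 \<noteq> 0 \<longrightarrow> moduli_pt (0, g3) = q_pt) \<and>
    (\<forall>g2 g3 g2' g3'. wiso (g2, g3) (g2', g3') \<longrightarrow>
       (\<exists>f. biholomorphic_map (fsub CP2 (wcurve g2 g3)) (fsub CP2 (wcurve g2' g3')) f)) \<and>
    (\<exists>!b. b \<in> ell_base \<and> (\<exists>g2 g3. g2 \<noteq> 0 \<and> b = moduli_pt (g2, g3) \<and> wsingular g2 g3)) \<and>

    \<comment> \<open>(3) a projective line\<close>
    (\<exists>\<Psi>. biholomorphic_map CP1 (fsub M_I C) \<Psi>)"
proof (rule exI[of _ painleve_part], rule exI[of _ line_part], intro conjI)
  show "fpts M_I = painleve_part \<union> ell_total \<union> line_part" "painleve_part \<inter> ell_total = {}"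
    "painleve_part \<inter> line_part = {}" "ell_total \<inter> line_part = {}" by (fact M_I_decomposition)+
  show "\<exists>\<Phi>. biholomorphic_map P_quot (fsub M_I painleve_part) \<Phi> \<and>
      (\<forall>x y z. \<Phi> (cyc_orbit z5_act (P_xyz (vector [x, y, z]))) = Inl (pt3245 x y z 1))"
    using P_map_biholomorphic P_map_P_xyz by blast
  show "\<exists>\<Phi> \<pi>. biholomorphic_map W_quot (fsub M_I ell_total) \<Phi> \<and>
      (\<forall>X Y. \<Phi> (cyc_orbit z4_act (W_hom (vector [X, Y, 1, 4 * Y ^ 3 + 2 * Y - X ^ 2])))
               = Inl (pt3245 X Y 1 0)) \<and>
      (\<forall>g3. \<Phi> (cyc_orbit z4_act (W_hom (vector [1, 0, 0, g3]))) = chart2 (vector [g3 / 4, 0, 0])) \<and>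
      hol_map (fsub M_I ell_total) (fsub M_I ell_base) \<pi> \<and>
      (\<forall>b\<in>ell_base. \<pi> b = b) \<and>
      (\<forall>\<xi> g3. \<xi> \<in> wcurve (-2) g3 \<longrightarrow>
         \<pi> (\<Phi> (cyc_orbit z4_act (\<xi>, g3))) = chart2 (vector [g3 / 4, 0, 0])) \<and>
      (\<forall>g2 g3. g2 \<noteq> 0 \<longrightarrow> {m \<in> ell_total. \<pi> m = moduli_pt (g2, g3)} =
         {\<Phi> (cyc_orbit z4_act (\<xi>, g)) | \<xi> g. \<xi> \<in> wcurve (-2) g \<and> wiso (-2, g) (g2, g3)})"
  proof (intro exI[of _ W_map] exI[of _ W_proj] conjI allI ballI impI)
    show "biholomorphic_map W_quot (fsub M_I ell_total) W_map" by (rule W_map_biholomorphic)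
    show "W_map (cyc_orbit z4_act (W_hom (vector [X, Y, 1, 4 * Y ^ 3 + 2 * Y - X ^ 2]))) = Inl (pt3245 X Y 1 0)"
      for X Y using W_map_cls[of "vector [X, Y, 1]" "4 * Y ^ 3 + 2 * Y - X ^ 2"]
      by (simp add: W_cls_def W_hom_def W_pt_def)
    show "W_map (cyc_orbit z4_act (W_hom (vector [1, 0, 0, g3]))) = chart2 (vector [g3 / 4, 0, 0])" for g3
      using W_map_cls[of "vector [1, 0, 0]" g3] by (simp add: W_cls_def W_hom_def W_pt_def)
    show "hol_map (fsub M_I ell_total) (fsub M_I ell_base) W_proj" by (rule W_proj_hol)
    show "W_proj b = b" if "b \<in> ell_base" for b by (rule W_proj_base[OF that])
    show "W_proj (W_map (cyc_orbit z4_act (\<xi>, g3))) = chart2 (vector [g3 / 4, 0, 0])"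
      if "\<xi> \<in> wcurve (-2) g3" for \<xi> g3 by (rule W_proj_W_map[OF that])
    show "{m \<in> ell_total. W_proj m = moduli_pt (g2, g3)} =
         {W_map (cyc_orbit z4_act (\<xi>, g)) | \<xi> g. \<xi> \<in> wcurve (-2) g \<and> wiso (-2, g) (g2, g3)}" for g2 g3
      by (rule W_fiber)
  qed
  show "ell_base = moduli_pt ` {(g2, g3). g2 \<noteq> 0}" by (rule ell_base_moduli)
  show "\<forall>a b. fst a \<noteq> 0 \<and> fst b \<noteq> 0 \<longrightarrow> (moduli_pt a = moduli_pt b \<longleftrightarrow> wiso a b)"
    by (simp add: moduli_pt_eq_iff)
  show "\<forall>g3. g3 \<noteq> 0 \<longrightarrow> moduli_pt (0, g3) = q_pt" by (simp add: moduli_pt_q)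
  show "\<forall>g2 g3 g2' g3'. wiso (g2, g3) (g2', g3') \<longrightarrow>
       (\<exists>f. biholomorphic_map (fsub CP2 (wcurve g2 g3)) (fsub CP2 (wcurve g2' g3')) f)"
    by (intro allI impI wiso_biholomorphic)
  show "\<exists>!b. b \<in> ell_base \<and> (\<exists>g2 g3. g2 \<noteq> 0 \<and> b = moduli_pt (g2, g3) \<and> wsingular g2 g3)"
    by (rule wsingular_unique)
  show "\<exists>\<Psi>. biholomorphic_map CP1 (fsub M_I line_part) \<Psi>"
    using line_inv_biholomorphic by blast
qed

end
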